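(* For each integer $k\geq 2$, each positive integer $m$, and each $\epsilon\in\{-,+\}$, the orthogonal group $\mathrm{O}^{\epsilon}(2m,\mathbb{F}_{2^k})$ acts as the group of automorphisms of an abstract regular polytope of rank $2m$, and the symplectic group $\mathrm{Sp}(2m,\mathbb{F}_{2^k})$ acts as the group of automorphisms of an abstract regular polytope of rank $2m+1$. (That is, there are abstract regular polytopes $\mathcal{P}$ of rank $2m$ and $\mathcal{Q}$ of rank $2m+1$ with $\mathrm{Aut}(\mathcal{P})\cong \mathrm{O}^{\epsilon}(2m,\mathbb{F}_{2^k})$ and $\mathrm{Aut}(\mathcal{Q})\cong\mathrm{Sp}(2m,\mathbb{F}_{2^k})$.)
   Context: $\mathrm{Sp}(2m,\mathbb{F}_{2^k})$ is the isometry group of a nondegenerate alternating bilinear form on $\mathbb{F}_{2^k}^{2m}$. $\mathrm{O}^{+}(2m,\mathbb{F}_{2^k})$ (respectively $\mathrm{O}^{-}(2m,\mathbb{F}_{2^k})$) is the full isometry group of a quadratic form $\varphi$ on $\mathbb{F}_{2^k}^{2m}$ whose associated bilinear form $(u,v)=\varphi(u+v)+\varphi(u)+\varphi(v)$ is nondegenerate and whose maximal totally singular subspaces have dimension $m$ (respectively $m-1$). An abstract polytope of rank $r$ is a partially ordered set $\mathcal{P}$ (whose elements are called faces) with a least face and a greatest face, in which every maximal chain (flag) has exactly $r+2$ elements (so that there is a rank function with values in $\{-1,0,\ldots,r\}$), which is strongly flag-connected (any two flags $\Phi,\Psi$ are joined by a sequence of flags, each containing $\Phi\cap\Psi$, in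 which consecutive flags differ in exactly one face), and which satisfies the diamond condition (whenever $F<G$ have ranks $i-1$ and $i+1$, there are exactly two faces $H$ with $F<H<G$). $\mathcal{P}$ is regular if its group $\mathrm{Aut}(\mathcal{P})$ of order-preserving bijections is transitive on flags. Standard fact (McMullen–Schulte): a group $G$ is isomorphic to the automorphism group of an abstract regular polytope of rank $r$ if and only if $G$ is a string C-group of rank $r$, i.e. $G$ is generated by involutions $\rho_0,\ldots,\rho_{r-1}$ such that $\rho_i\rho_j=\rho_j\rho_i$ whenever $|i-j|\geq 2$ and $\langle \rho_i: i\in I\rangle\cap\langle\rho_j: j\in J\rangle=\langle \rho_k: k\in I\cap J\rangle$ for all $I,J\subseteq\{0,\ldots,r-1\}$. *)

theory Defs
  imports "HOL-Analysis.Cartesian_Space" "HOL-Algebra.Bij"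
begin

section \<open>Abstract regular polytopes\<close>

definition flags :: "'f set \<Rightarrow> 'f rel \<Rightarrow> 'f set set"
  where "flags P leq = {\<Phi>. pred_on.maxchain P (\<lambda>x y. (x, y) \<in> leq) \<Phi>}"

text \<open>
  The value does not depend on the choice of the flag when all flags have the same finite
  cardinality (lemma \<open>face_rank_eq\<close>). The least face has rank \<open>-1\<close>.
\<close>
definition face_rank :: "'f set \<Rightarrow> 'f rel \<Rightarrow> 'f \<Rightarrow> int"
  where "face_rank P leq F =
    int (card {H \<in> (SOME \<Phi>. \<Phi> \<in> flags P leq \<and> F \<in> \<Phi>). (H, F) \<in> leq \<and> H \<noteq> F}) - 1"

definition adjacent_flags :: "'f set \<Rightarrow> 'f set \<Rightarrow> bool"
  where "adjacent_flags \<Phi> \<Psi> \<longleftrightarrow> card (\<Phi> - \<Psi>) = 1 \<and> card (\<Psi> - \<Phi>) = 1"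

definition strongly_flag_connected :: "'f set \<Rightarrow> 'f rel \<Rightarrow> bool"
  where "strongly_flag_connected P leq \<longleftrightarrow>
    (\<forall>\<Phi>\<in>flags P leq. \<forall>\<Psi>\<in>flags P leq.
      (\<Phi>, \<Psi>) \<in> {(X, Y). X \<in> flags P leq \<and> Y \<in> flags P leq \<and>
                      \<Phi> \<inter> \<Psi> \<subseteq> X \<and> \<Phi> \<inter> \<Psi> \<subseteq> Y \<and> adjacent_flags X Y}\<^sup>*)"

definition diamond_condition :: "'f set \<Rightarrow> 'f rel \<Rightarrow> bool"
  where "diamond_condition P leq \<longleftrightarrow>
    (\<forall>F\<in>P. \<forall>G\<in>P. \<forall>i.
      (F, G) \<in> leq \<and> F \<noteq> G \<and> face_rank P leq F = i - 1 \<and> face_rank P leq G = i + 1 \<longrightarrow>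
      card {H \<in> P. (F, H) \<in> leq \<and> F \<noteq> H \<and> (H, G) \<in> leq \<and> H \<noteq> G} = 2)"

locale abstract_polytope =
  fixes P :: "'f set" and leq :: "'f rel" and r :: nat
  assumes partial_order: "partial_order_on P leq"
    and least_face: "\<exists>b\<in>P. \<forall>x\<in>P. (b, x) \<in> leq"
    and greatest_face: "\<exists>t\<in>P. \<forall>x\<in>P. (x, t) \<in> leq"
    and card_flag: "\<And>\<Phi>. \<Phi> \<in> flags P leq \<Longrightarrow> card \<Phi> = r + 2"
    and flag_connected: "strongly_flag_connected P leq"
    and diamond: "diamond_condition P leq"

definition polytope_aut :: "'f set \<Rightarrow> 'f rel \<Rightarrow> ('f \<Rightarrow> 'f) monoid"
  where "polytope_aut P leq = BijGroup P
    \<lparr>carrier := {f \<in> Bij P. \<forall>x\<in>P. \<forall>y\<in>P. (f x, f y) \<in> leq \<longleftrightarrow> (x, y) \<in> leq}\<rparr>"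

locale abstract_regular_polytope = abstract_polytope +
  assumes flag_transitive:
    "\<And>\<Phi> \<Psi>. \<Phi> \<in> flags P leq \<Longrightarrow> \<Psi> \<in> flags P leq \<Longrightarrow>
      \<exists>f\<in>carrier (polytope_aut P leq). f ` \<Phi> = \<Psi>"

lemma flag_splice:
  assumes po: "partial_order_on P leq"
    and \<Phi>: "\<Phi> \<in> flags P leq" "F \<in> \<Phi>" and \<Psi>: "\<Psi> \<in> flags P leq" "F \<in> \<Psi>"
  shows "{H \<in> \<Phi>. (H, F) \<in> leq \<and> H \<noteq> F} \<union> {H \<in> \<Psi>. (F, H) \<in> leq} \<in> flags P leq"
    (is "?L \<union> ?U \<in> _")
proof -
  let ?rel = "\<lambda>x y. (x, y) \<in> leq"
  have chain_iff: "pred_on.chain P ?rel C \<longleftrightarrow> C \<subseteq> P \<and> (\<forall>x\<in>C. \<forall>y\<in>C. (x, y) \<in> leq \<or> (y, x) \<in> leq)" for C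
    using po unfolding pred_on.chain_def partial_order_on_def preorder_on_def refl_on_def by blast
  have tr: "(x, z) \<in> leq" if "(x, y) \<in> leq" "(y, z) \<in> leq" for x y z
    using po that unfolding partial_order_on_def preorder_on_def trans_def by blast
  have an: "x = y" if "(x, y) \<in> leq" "(y, x) \<in> leq" for x y
    using po that unfolding partial_order_on_def antisym_def by blast
  have maxD: "C = \<Theta>" if "\<Theta> \<in> flags P leq" "pred_on.chain P ?rel C" "\<Theta> \<subseteq> C" for \<Theta> C
    using that unfolding flags_def pred_on.maxchain_def by blast
  have chD: "pred_on.chain P ?rel \<Theta>" if "\<Theta> \<in> flags P leq" for \<Theta>
    using that unfolding flags_def pred_on.maxchain_def by blast
  have c\<Phi>: "\<Phi> \<subseteq> P" "\<And>x y. x \<in> \<Phi> \<Longrightarrow> y \<in> \<Phi> \<Longrightarrow> (x, y) \<in> leq \<or> (y, x) \<in> leq"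
    and c\<Psi>: "\<Psi> \<subseteq> P" "\<And>x y. x \<in> \<Psi> \<Longrightarrow> y \<in> \<Psi> \<Longrightarrow> (x, y) \<in> leq \<or> (y, x) \<in> leq"
    using chD[OF \<Phi>(1)] chD[OF \<Psi>(1)] unfolding chain_iff by blast+
  have ch: "pred_on.chain P ?rel (?L \<union> ?U)"
    unfolding chain_iff
  proof (intro conjI ballI)
    show "?L \<union> ?U \<subseteq> P" using c\<Phi>(1) c\<Psi>(1) by blast
    show "(x, y) \<in> leq \<or> (y, x) \<in> leq" if "x \<in> ?L \<union> ?U" "y \<in> ?L \<union> ?U" for x y
      using that c\<Phi>(2)[of x y] c\<Psi>(2)[of x y] tr[of x F y] tr[of y F x] by blast
  qed
  have Fin: "F \<in> ?U" using c\<Psi>(2)[OF \<Psi>(2) \<Psi>(2)] \<Psi>(2) by blast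
  have "C = ?L \<union> ?U" if C: "pred_on.chain P ?rel C" "?L \<union> ?U \<subseteq> C" for C
  proof (rule ccontr)
    assume "C \<noteq> ?L \<union> ?U"
    then obtain x where x: "x \<in> C" "x \<notin> ?L" "x \<notin> ?U" using C(2) by blast
    have xP: "x \<in> P" and xC: "\<And>y. y \<in> C \<Longrightarrow> (x, y) \<in> leq \<or> (y, x) \<in> leq" and xx: "(x, x) \<in> leq"
      using C(1) x(1) unfolding chain_iff by blast+
    have "F \<in> C" using Fin C(2) by blast
    then consider "(x, F) \<in> leq" "x \<noteq> F" | "(F, x) \<in> leq" using xC by metis
    then show False
    proof cases
      case 1
      have "(x, y) \<in> leq \<or> (y, x) \<in> leq" if y: "y \<in> \<Phi>" for y
      proof (cases "y \<in> ?L")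
        case True then show ?thesis using xC C(2) by blast
      next
        case False
        then have "(F, y) \<in> leq" using c\<Phi>(2)[OF \<Phi>(2) y] c\<Phi>(2)[OF y y] y by auto
        then show ?thesis using tr 1(1) by blast
      qed
      then have "pred_on.chain P ?rel (insert x \<Phi>)"
        unfolding chain_iff using c\<Phi> xP xx by blast
      then have "x \<in> \<Phi>" using maxD[OF \<Phi>(1)] by blast
      then show False using 1 x(2) by blast
    next
      case 2
      have "(x, y) \<in> leq \<or> (y, x) \<in> leq" if y: "y \<in> \<Psi>" for y
      proof (cases "y \<in> ?U")
        case True then show ?thesis using xC C(2) by blast
      next
        case False
        then have "(y, F) \<in> leq" using c\<Psi>(2)[OF \<Psi>(2) y] y by auto
        then show ?thesis using tr 2 by blast
      qed
      then have "pred_on.chain P ?rel (insert x \<Psi>)"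
        unfolding chain_iff using c\<Psi> xP xx by blast
      then have "x \<in> \<Psi>" using maxD[OF \<Psi>(1)] by blast
      then show False using 2 x(3) by blast
    qed
  qed
  then show ?thesis
    using ch unfolding flags_def pred_on.maxchain_def by blast
qed

lemma face_rank_eq:
  assumes po: "partial_order_on P leq"
    and cf: "\<And>\<Phi>. \<Phi> \<in> flags P leq \<Longrightarrow> card \<Phi> = r + 2"
    and \<Phi>: "\<Phi> \<in> flags P leq" "F \<in> \<Phi>"
  shows "face_rank P leq F = int (card {H \<in> \<Phi>. (H, F) \<in> leq \<and> H \<noteq> F}) - 1"
proof -
  define \<Psi> where "\<Psi> = (SOME \<Phi>. \<Phi> \<in> flags P leq \<and> F \<in> \<Phi>)"
  have \<Psi>: "\<Psi> \<in> flags P leq" "F \<in> \<Psi>"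
    using someI[of "\<lambda>\<Phi>. \<Phi> \<in> flags P leq \<and> F \<in> \<Phi>", OF conjI[OF \<Phi>]] unfolding \<Psi>_def by blast+
  have an: "antisym leq" using po unfolding partial_order_on_def by blast
  have add: "card {H \<in> X. (H, F) \<in> leq \<and> H \<noteq> F} + card {H \<in> Y. (F, H) \<in> leq} = r + 2"
    if X: "X \<in> flags P leq" "F \<in> X" and Y: "Y \<in> flags P leq" "F \<in> Y" for X Y
  proof -
    have fin: "finite X" "finite Y"
      using cf[OF X(1)] cf[OF Y(1)] card.infinite by fastforce+
    show ?thesis
      using cf[OF flag_splice[OF po X Y]] an fin
      by (subst card_Un_disjoint[symmetric]) (auto simp: antisym_def)
  qed
  show ?thesis
    using add[OF \<Phi> \<Phi>] add[OF \<Psi> \<Phi>] unfolding face_rank_def \<Psi>_def by simp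
qed

section \<open>Isometry groups\<close>

definition bilinear_form :: "('a::field ^ 'n \<Rightarrow> 'a ^ 'n \<Rightarrow> 'a) \<Rightarrow> bool"
  where "bilinear_form B \<longleftrightarrow>
    (\<forall>u. Vector_Spaces.linear (*s) (*) (\<lambda>v. B u v)) \<and>
    (\<forall>v. Vector_Spaces.linear (*s) (*) (\<lambda>u. B u v))"

definition nondegenerate :: "('a::field ^ 'n \<Rightarrow> 'a ^ 'n \<Rightarrow> 'a) \<Rightarrow> bool"
  where "nondegenerate B \<longleftrightarrow>
    (\<forall>u. (\<forall>v. B u v = 0) \<longrightarrow> u = 0) \<and> (\<forall>v. (\<forall>u. B u v = 0) \<longrightarrow> v = 0)"

definition alternating :: "('a::field ^ 'n \<Rightarrow> 'a ^ 'n \<Rightarrow> 'a) \<Rightarrow> bool"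
  where "alternating B \<longleftrightarrow> (\<forall>v. B v v = 0)"

text \<open>
  All fields of interest here have characteristic 2; signs are therefore omitted in the polar form.
\<close>
definition polar :: "('a::field ^ 'n \<Rightarrow> 'a) \<Rightarrow> 'a ^ 'n \<Rightarrow> 'a ^ 'n \<Rightarrow> 'a"
  where "polar \<phi> u v = \<phi> (u + v) + \<phi> u + \<phi> v"

definition quadratic_form :: "('a::field ^ 'n \<Rightarrow> 'a) \<Rightarrow> bool"
  where "quadratic_form \<phi> \<longleftrightarrow> (\<forall>c v. \<phi> (c *s v) = c ^ 2 * \<phi> v) \<and> bilinear_form (polar \<phi>)"

definition totally_singular :: "('a::field ^ 'n \<Rightarrow> 'a) \<Rightarrow> ('a ^ 'n) set \<Rightarrow> bool"
  where "totally_singular \<phi> W \<longleftrightarrow> vec.subspace W \<and> (\<forall>w\<in>W. \<phi> w = 0)"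

definition maximal_totally_singular :: "('a::field ^ 'n \<Rightarrow> 'a) \<Rightarrow> ('a ^ 'n) set \<Rightarrow> bool"
  where "maximal_totally_singular \<phi> W \<longleftrightarrow>
    totally_singular \<phi> W \<and> (\<forall>W'. totally_singular \<phi> W' \<and> W \<subseteq> W' \<longrightarrow> W' = W)"

datatype form_sign = Plus_type | Minus_type

fun witt_index :: "form_sign \<Rightarrow> nat \<Rightarrow> nat"
  where
    "witt_index Plus_type m = m"
  | "witt_index Minus_type m = m - 1"

definition quadratic_form_of_type :: "form_sign \<Rightarrow> nat \<Rightarrow> ('a::field ^ 'n \<Rightarrow> 'a) \<Rightarrow> bool"
  where "quadratic_form_of_type \<epsilon> m \<phi> \<longleftrightarrow>
    quadratic_form \<phi> \<and> nondegenerate (polar \<phi>) \<and>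
    (\<forall>W. maximal_totally_singular \<phi> W \<longrightarrow> vec.dim W = witt_index \<epsilon> m)"

definition symplectic_form :: "('a::field ^ 'n \<Rightarrow> 'a ^ 'n \<Rightarrow> 'a) \<Rightarrow> bool"
  where "symplectic_form B \<longleftrightarrow> bilinear_form B \<and> alternating B \<and> nondegenerate B"

definition orthogonal_group :: "('a::field ^ 'n \<Rightarrow> 'a) \<Rightarrow> ('a ^ 'n \<Rightarrow> 'a ^ 'n) monoid"
  where "orthogonal_group \<phi> = BijGroup UNIV
    \<lparr>carrier := {g \<in> Bij UNIV. Vector_Spaces.linear (*s) (*s) g \<and> (\<forall>v. \<phi> (g v) = \<phi> v)}\<rparr>"

definition symplectic_group ::
    "('a::field ^ 'n \<Rightarrow> 'a ^ 'n \<Rightarrow> 'a) \<Rightarrow> ('a ^ 'n \<Rightarrow> 'a ^ 'n) monoid"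
  where "symplectic_group B = BijGroup UNIV
    \<lparr>carrier := {g \<in> Bij UNIV. Vector_Spaces.linear (*s) (*s) g \<and>
                              (\<forall>u v. B (g u) (g v) = B u v)}\<rparr>"

end

theory Submission
  imports Defs "HOL-Algebra.Multiplicative_Group"
begin

text \<open>
  In characteristic 2 let \<open>v 1, \<dots>, v n\<close> be a basis of a nonsingular quadratic space such that
  \<open>\<phi> (v i) = 1\<close> and \<open>v i\<close>, \<open>v j\<close> are orthogonal exactly when \<open>\<bar>i - j\<bar> \<noteq> 1\<close>. The reflections in the
  \<open>v i\<close> are a string of involutions. If \<open>g\<close> is a product of reflections in the \<open>v i\<close>, \<open>i \<in> I\<close>, then
  \<open>g x - x\<close> lies in the span of these \<open>v i\<close>; hence the intersection property follows once each parabolic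
  subgroup involved is known to contain all elements of the larger ones with this property.

  Take weights \<open>(a, b, 1, \<dots>, 1)\<close> for the consecutive products \<open>B (v i) (v (i + 1))\<close>. The parabolic
  subgroups on \<open>i \<ge> 3\<close> are symmetric groups, for which the claim is combinatorial. If
  \<open>v 2\<close>, \<open>v 3\<close> span an anisotropic plane on which their reflections generate the whole dihedral orthogonal
  group, then adding one vector at a time shows that the subgroup on \<open>{2..d}\<close> contains the reflections
  in all unit vectors of the span (here more than two field elements are needed), and a
  Cartan--Dieudonne argument yields all isometries supported on the span. The type of the form plays no
  role, as \<open>a\<close> is left free: every nonsingular form of dimension \<open>n \<ge> 3\<close> that occurs has such a basis,
  and \<open>n = 2\<close> is the dihedral case. Finally, the symplectic group in dimension \<open>2 * m\<close> is the orthogonal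
  group of a space of dimension \<open>2 * m + 1\<close> with one-dimensional radical.
\<close>

section \<open>Regular polytopes from string C-groups\<close>

text \<open>If all weights were 1, the reflections would generate no more than a symmetric group;
  the weight b breaks this. An element of both groups on \<open>{i..d}\<close> and
  \<open>{i+1..n}\<close> moves every vector within the span of \<open>v (i+1), ..., v d\<close>.
  For i \<ge> 2 these indices are at least 3, where the group is symmetric; for i = 1 fullness is
  needed on \<open>{2..d}\<close> with d < n, and never on a proper interval starting at 1. Hence b
  stands at the second place and the free weight a at the first. The obstacle is degeneracy: on a
  span of odd dimension an alternating form always has a radical. In dimension three this forces the
  counting argument of \<open>units_plane_step\<close>, and the Cartan--Dieudonne induction cannot
  split off orthogonal complements; it fixes the basis vector just beyond the span instead. The
  condition b \<noteq> 1 returns several times: it keeps the radical line of the span of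
  \<open>v 2\<close>, \<open>v 3\<close>, \<open>v 4\<close> nonsingular, it gives linear
  independence in odd dimension, and it keeps the weight a nonzero in even dimension.\<close>

lemma initial_segment_split:
  fixes I :: "nat set"
  assumes "I \<subseteq> {i..r}" "i \<in> I"
  obtains d where "i \<le> d" "{i..d} \<subseteq> I" "Suc d \<notin> I" "d \<le> r"
proof -
  have ex: "\<exists>d. i \<le> d \<and> Suc d \<notin> I"
    using assms by (intro exI[of _ r]) auto
  define d where "d = (LEAST d. i \<le> d \<and> Suc d \<notin> I)"
  have d: "i \<le> d" "Suc d \<notin> I" using LeastI_ex[OF ex] unfolding d_def by auto
  have below: "Suc k \<in> I" if "i \<le> k" "k < d" for k
    using not_less_Least[of k "\<lambda>d. i \<le> d \<and> Suc d \<notin> I"] that unfolding d_def by auto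
  have "{i..d} \<subseteq> I"
  proof
    fix k assume "k \<in> {i..d}"
    then show "k \<in> I" using assms below[of "k - 1"] by (cases "k = i") auto
  qed
  moreover from this have "d \<le> r" using assms d by (meson atLeastAtMost_iff order.refl subsetD)
  ultimately show ?thesis using d that by blast
qed

text \<open>An automorphism sends a flag into a flag, and the induced map on indices is strictly
  increasing; this shows that it preserves ranks. The lower bound is an induction from 0, the upper
  bound one downwards from \<open>n\<close>.\<close>

lemma strict_mono_bounded_eq:
  fixes \<sigma> :: "nat \<Rightarrow> nat"
  assumes bound: "\<And>i. i \<le> n \<Longrightarrow> \<sigma> i \<le> n" and mono: "\<And>i j. i < j \<Longrightarrow> j \<le> n \<Longrightarrow> \<sigma> i < \<sigma> j" and i: "i \<le> n"
  shows "\<sigma> i = i"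
proof (rule antisym)
  show "i \<le> \<sigma> i" using i
  proof (induction i)
    case (Suc i)
    then show ?case using mono[of i "Suc i"] by simp
  qed simp
  have "d \<le> n \<Longrightarrow> \<sigma> (n - d) \<le> n - d" for d
  proof (induction d)
    case 0 then show ?case using bound by simp
  next
    case (Suc d)
    have "n - Suc d < n - d" using Suc.prems by simp
    then have "\<sigma> (n - Suc d) < \<sigma> (n - d)" using mono by simp
    then show ?case using Suc by linarith
  qed
  from this[of "n - i"] show "\<sigma> i \<le> i" using i by simp
qed

text \<open>
  The intersection property is required only for the intervals \<open>{i..d}\<close> and \<open>{i+1..r}\<close>; the general one
  is the theorem \<open>par_intersection\<close> below.
\<close>
locale string_C_group = group G for G (structure) +
  fixes \<rho> :: "nat \<Rightarrow> 'a" and r :: nat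
  assumes fin: "finite (carrier G)"
    and gen_closed: "i \<in> {1..r} \<Longrightarrow> \<rho> i \<in> carrier G"
    and gen_involution: "i \<in> {1..r} \<Longrightarrow> \<rho> i \<otimes> \<rho> i = \<one>"
    and gen_nontrivial: "i \<in> {1..r} \<Longrightarrow> \<rho> i \<noteq> \<one>"
    and gen_commute: "1 \<le> i \<Longrightarrow> i + 2 \<le> j \<Longrightarrow> j \<le> r \<Longrightarrow> \<rho> i \<otimes> \<rho> j = \<rho> j \<otimes> \<rho> i"
    and generates: "generate G (\<rho> ` {1..r}) = carrier G"
    and interval_intersection: "1 \<le> i \<Longrightarrow> d \<le> r \<Longrightarrow>
      generate G (\<rho> ` {i..d}) \<inter> generate G (\<rho> ` {i+1..r}) \<subseteq> generate G (\<rho> ` {i+1..d})"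
begin

definition par :: "nat set \<Rightarrow> 'a set"
  where "par I = generate G (\<rho> ` I)"

lemma gens_subset: "I \<subseteq> {1..r} \<Longrightarrow> \<rho> ` I \<subseteq> carrier G"
  using gen_closed by blast

lemma par_subgroup: "I \<subseteq> {1..r} \<Longrightarrow> subgroup (par I) G"
  unfolding par_def by (rule generate_is_subgroup[OF gens_subset])

lemma par_mono: "I \<subseteq> J \<Longrightarrow> par I \<subseteq> par J"
  unfolding par_def by (rule mono_generate) blast

lemma par_closed: "I \<subseteq> {1..r} \<Longrightarrow> x \<in> par I \<Longrightarrow> x \<in> carrier G"
  using subgroup.mem_carrier[OF par_subgroup] .

lemma gen_in_par: "i \<in> I \<Longrightarrow> \<rho> i \<in> par I"
  unfolding par_def by (simp add: generate.incl)

lemma one_in_par: "\<one> \<in> par I"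
  unfolding par_def by (rule generate.one)

lemma mult_in_par: "x \<in> par I \<Longrightarrow> y \<in> par I \<Longrightarrow> x \<otimes> y \<in> par I"
  unfolding par_def by (rule generate.eng)

lemma inv_in_par: "I \<subseteq> {1..r} \<Longrightarrow> x \<in> par I \<Longrightarrow> inv x \<in> par I"
  using subgroup.m_inv_closed[OF par_subgroup] .

lemma inv_gen: "i \<in> {1..r} \<Longrightarrow> inv (\<rho> i) = \<rho> i"
  using gen_closed gen_involution inv_equality by blast

text \<open>Elements of \<open>par I\<close> are words in the generators, which are their own
  inverses. The start \<open>s\<close> is arbitrary so that the product case can continue from
  \<open>s \<otimes> h1\<close>; galleries of flags start at such an \<open>s\<close>.\<close>

lemma par_right_induct:
  assumes I: "I \<subseteq> {1..r}" and x: "x \<in> par I" and s: "s \<in> carrier G" "P s"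
    and step: "\<And>i y. i \<in> I \<Longrightarrow> y \<in> carrier G \<Longrightarrow> P y \<Longrightarrow> P (y \<otimes> \<rho> i)"
  shows "P (s \<otimes> x)"
  using x s unfolding par_def
proof (induction x arbitrary: s rule: generate.induct)
  case one then show ?case by simp
next
  case (incl h) then show ?case using step by blast
next
  case (inv h) then show ?case using step inv_gen I by (metis imageE subsetD)
next
  case (eng h1 h2)
  then have c: "h1 \<in> carrier G" "h2 \<in> carrier G"
    using generate_in_carrier[OF gens_subset[OF I]] by blast+
  have "P ((s \<otimes> h1) \<otimes> h2)"
    using eng.IH(1)[OF eng.prems] eng.IH(2)[of "s \<otimes> h1"] c eng.prems(1) by simp
  then show ?case using c eng.prems(1) by (simp add: m_assoc)
qed

text \<open>No index of one set equals or neighbours an index of the other, so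
  \<open>gen_commute\<close> applies to all pairs.\<close>

definition far :: "nat set \<Rightarrow> nat set \<Rightarrow> bool"
  where "far I J \<longleftrightarrow> (\<forall>i\<in>I. \<forall>j\<in>J. i + 2 \<le> j \<or> j + 2 \<le> i)"

lemma gen_commute_far:
  assumes "i \<in> {1..r}" "j \<in> {1..r}" "i + 2 \<le> j \<or> j + 2 \<le> i"
  shows "\<rho> i \<otimes> \<rho> j = \<rho> j \<otimes> \<rho> i"
  using assms gen_commute[of i j] gen_commute[of j i] by auto

lemma par_commute:
  assumes I: "I \<subseteq> {1..r}" and J: "J \<subseteq> {1..r}" and far: "far I J"
    and x: "x \<in> par I" and y: "y \<in> par J"
  shows "x \<otimes> y = y \<otimes> x"
proof -
  have *: "\<rho> i \<otimes> y = y \<otimes> \<rho> i" if i: "i \<in> I" for i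
  proof -
    have ic: "\<rho> i \<in> carrier G" using i I gen_closed by blast
    have "\<rho> i \<otimes> (\<one> \<otimes> y) = (\<one> \<otimes> y) \<otimes> \<rho> i"
    proof (rule par_right_induct[OF J y, where P = "\<lambda>y. \<rho> i \<otimes> y = y \<otimes> \<rho> i"])
      fix j z assume j: "j \<in> J" and z: "z \<in> carrier G" "\<rho> i \<otimes> z = z \<otimes> \<rho> i"
      have jc: "\<rho> j \<in> carrier G" using j J gen_closed by blast
      have "\<rho> i \<otimes> \<rho> j = \<rho> j \<otimes> \<rho> i"
        using gen_commute_far i j I J far unfolding far_def by blast
      then show "\<rho> i \<otimes> (z \<otimes> \<rho> j) = z \<otimes> \<rho> j \<otimes> \<rho> i"
        using z ic jc by (metis m_assoc)
    qed (use ic in auto)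
    then show ?thesis using par_closed[OF J y] by simp
  qed
  have yc: "y \<in> carrier G" by (rule par_closed[OF J y])
  have "(\<one> \<otimes> x) \<otimes> y = y \<otimes> (\<one> \<otimes> x)"
  proof (rule par_right_induct[OF I x, where P = "\<lambda>x. x \<otimes> y = y \<otimes> x"])
    fix i z assume i: "i \<in> I" and z: "z \<in> carrier G" "z \<otimes> y = y \<otimes> z"
    have "\<rho> i \<in> carrier G" using i I gen_closed by blast
    then show "z \<otimes> \<rho> i \<otimes> y = y \<otimes> (z \<otimes> \<rho> i)"
      using z yc *[OF i] by (metis m_assoc)
  qed (use yc in auto)
  then show ?thesis using par_closed[OF I x] by simp
qed

text \<open>A word is sorted letter by letter: a new letter from \<open>J\<close> joins
  \<open>b\<close>, one from \<open>I\<close> is moved past \<open>b\<close> by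
  \<open>par_commute\<close> and joins \<open>a\<close>.\<close>

lemma par_factor:
  assumes I: "I \<subseteq> {1..r}" and J: "J \<subseteq> {1..r}" and far: "far I J"
    and x: "x \<in> par (I \<union> J)"
  shows "\<exists>a\<in>par I. \<exists>b\<in>par J. x = a \<otimes> b"
proof -
  have IJ: "I \<union> J \<subseteq> {1..r}" using I J by blast
  have "\<exists>a\<in>par I. \<exists>b\<in>par J. \<one> \<otimes> x = a \<otimes> b"
  proof (rule par_right_induct[OF IJ x, where P = "\<lambda>x. \<exists>a\<in>par I. \<exists>b\<in>par J. x = a \<otimes> b"])
    show "\<exists>a\<in>par I. \<exists>b\<in>par J. \<one> = a \<otimes> b"
      using one_in_par by (intro bexI[of _ \<one>]) auto
  next
    fix i y assume i: "i \<in> I \<union> J" and "\<exists>a\<in>par I. \<exists>b\<in>par J. y = a \<otimes> b"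
    then obtain a b where ab: "a \<in> par I" "b \<in> par J" "y = a \<otimes> b" by blast
    have c: "a \<in> carrier G" "b \<in> carrier G" "\<rho> i \<in> carrier G"
      using ab par_closed I J i gen_closed by blast+
    show "\<exists>a\<in>par I. \<exists>b\<in>par J. y \<otimes> \<rho> i = a \<otimes> b"
    proof (cases "i \<in> J")
      case True
      then show ?thesis using ab c gen_in_par mult_in_par m_assoc by metis
    next
      case False
      then have "i \<in> I" using i by blast
      then have "\<rho> i \<otimes> b = b \<otimes> \<rho> i" and "a \<otimes> \<rho> i \<in> par I"
        using par_commute[OF I J far gen_in_par ab(2)] mult_in_par[OF ab(1) gen_in_par] by auto
      then show ?thesis using ab c m_assoc by metis
    qed
  qed auto
  then show ?thesis using par_closed[OF IJ x] by simp
qed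

text \<open>\<open>J\<close> consists of the run \<open>{i..d}\<close> and a part \<open>J'\<close>
  beyond the gap at \<open>Suc d\<close>, and an element factors accordingly as
  \<open>x \<otimes> z\<close>. Since \<open>z\<close> is already free of \<open>\<rho> i\<close>,
  dividing it off leaves an \<open>x\<close> to which \<open>interval_intersection\<close>
  applies.\<close>

lemma par_upper_intersection:
  assumes i: "1 \<le> i" and J: "J \<subseteq> {i..r}"
  shows "par {i+1..r} \<inter> par J \<subseteq> par (J - {i})"
proof (cases "i \<in> J")
  case False
  then show ?thesis by auto
next
  case True
  then obtain d where d: "i \<le> d" "Suc d \<notin> J" and sub: "{i..d} \<subseteq> J" and dr: "d \<le> r"
    using initial_segment_split[OF J] by metis
  define J' where "J' = {j \<in> J. d + 2 \<le> j}"
  have JJ: "J = {i..d} \<union> J'"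
  proof -
    have "j \<in> {i..d} \<union> J'" if "j \<in> J" for j
      using that J d unfolding J'_def by (cases "j = Suc d") auto
    moreover have "{i..d} \<union> J' \<subseteq> J" using sub unfolding J'_def by blast
    ultimately show ?thesis by blast
  qed
  have far: "far {i..d} J'" and far': "far {i+1..d} J'"
    unfolding far_def J'_def by auto
  have J'r: "J' \<subseteq> {1..r}" and J'i: "J' \<subseteq> {i+1..r}" using J d unfolding J'_def by auto
  have id: "{i..d} \<subseteq> {1..r}" "{i+1..r} \<subseteq> {1..r}" using i dr by auto
  show ?thesis
  proof
    fix g assume g: "g \<in> par {i+1..r} \<inter> par J"
    then obtain x z where xz: "x \<in> par {i..d}" "z \<in> par J'" "g = x \<otimes> z"
      using par_factor[OF id(1) J'r far, of g] JJ by auto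
    have z': "z \<in> par {i+1..r}" using xz(2) par_mono[OF J'i] by blast
    have c: "x \<in> carrier G" "z \<in> carrier G"
      using par_closed[OF id(1) xz(1)] par_closed[OF J'r xz(2)] .
    have "x = g \<otimes> inv z" using xz(3) c by (simp add: m_assoc)
    then have "x \<in> par {i+1..r}"
      using g mult_in_par inv_in_par[OF id(2) z'] by auto
    then have "x \<in> par {i+1..d}"
      using interval_intersection[OF i dr] xz(1) unfolding par_def by blast
    then have "x \<in> par (J - {i})"
      using par_mono[of "{i+1..d}" "J - {i}"] sub by (auto simp: subset_iff)
    moreover have "J' \<subseteq> J - {i}" using J'i JJ by force
    then have "z \<in> par (J - {i})" using par_mono xz(2) by blast
    ultimately show "g \<in> par (J - {i})" using mult_in_par xz(3) by blast
  qed
qed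

text \<open>Induction on the number of indices from \<open>i\<close> on. If one set misses
  \<open>i\<close>, \<open>par_upper_intersection\<close> removes \<open>i\<close> from the other.
  If both contain \<open>i\<close>, the shorter of their initial runs lies in both sets; its factor
  is split off, and the cofactor is free of \<open>\<rho> i\<close>.\<close>

lemma par_intersection_aux:
  assumes "1 \<le> i" "I \<subseteq> {i..r}" "J \<subseteq> {i..r}"
  shows "par I \<inter> par J \<subseteq> par (I \<inter> J)"
  using assms
proof (induction "r + 1 - i" arbitrary: i I J rule: less_induct)
  case less
  note i = less.prems(1)
  have IH: "par I' \<inter> par J' \<subseteq> par (I' \<inter> J')"
    if "I' \<subseteq> {i+1..r}" "J' \<subseteq> {i+1..r}" "i \<le> r" for I' J'
    using less.hyps[of "i+1" I' J'] that by auto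
  have missing: "par I' \<inter> par J' \<subseteq> par (I' \<inter> J')"
    if I': "I' \<subseteq> {i..r}" "i \<notin> I'" and J': "J' \<subseteq> {i..r}" for I' J'
  proof (cases "i \<le> r")
    case False
    then show ?thesis using that by auto
  next
    case True
    have I1: "I' \<subseteq> {i+1..r}"
    proof
      fix k assume "k \<in> I'"
      then show "k \<in> {i+1..r}" using I' by (cases "k = i") auto
    qed
    have "par I' \<inter> par J' \<subseteq> par I' \<inter> par (J' - {i})"
      using par_upper_intersection[OF i J'] par_mono[OF I1] by blast
    also have "\<dots> \<subseteq> par (I' \<inter> (J' - {i}))"
      using J' by (intro IH[OF I1 _ True]) force
    also have "I' \<inter> (J' - {i}) = I' \<inter> J'" using I'(2) by blast
    finally show ?thesis .
  qed
  have both: "par I' \<inter> par J' \<subseteq> par (I' \<inter> J')"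
    if I': "I' \<subseteq> {i..r}" "{i..c} \<subseteq> I'" "Suc c \<notin> I'" "i \<le> c" "c \<le> r"
      and J': "J' \<subseteq> {i..r}" "{i..c} \<subseteq> J'" for I' J' c
  proof
    fix g assume g: "g \<in> par I' \<inter> par J'"
    define K where "K = {j \<in> I'. c + 2 \<le> j}"
    have IK: "I' = {i..c} \<union> K"
    proof -
      have "j \<in> {i..c} \<union> K" if "j \<in> I'" for j
        using that I' unfolding K_def by (cases "j = Suc c") auto
      moreover have "{i..c} \<union> K \<subseteq> I'" using I'(2) unfolding K_def by blast
      ultimately show ?thesis by blast
    qed
    have far: "far {i..c} K" unfolding far_def K_def by auto
    have Ki: "K \<subseteq> {i+1..r}" using I' unfolding K_def by auto
    have r1: "{i..c} \<subseteq> {1..r}" "K \<subseteq> {1..r}" "J' \<subseteq> {1..r}"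
      using I'(4,5) J'(1) Ki i by auto
    obtain x y where xy: "x \<in> par {i..c}" "y \<in> par K" "g = x \<otimes> y"
      using par_factor[OF r1(1,2) far, of g] g IK by auto
    have c: "x \<in> carrier G" "y \<in> carrier G"
      using par_closed[OF r1(1) xy(1)] par_closed[OF r1(2) xy(2)] .
    have xJ: "x \<in> par J'" using xy(1) par_mono[OF J'(2)] by blast
    have "y = inv x \<otimes> g" using xy(3) c by (simp add: m_assoc[symmetric])
    then have yJ: "y \<in> par J'"
      using g mult_in_par inv_in_par[OF r1(3) xJ] by auto
    have ir: "i \<le> r" using I'(4,5) by simp
    have "y \<in> par (J' - {i})"
      using par_upper_intersection[OF i J'(1)] yJ xy(2) par_mono[OF Ki] by blast
    moreover have "J' - {i} \<subseteq> {i+1..r}" using J'(1) by force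
    ultimately have "y \<in> par (K \<inter> (J' - {i}))"
      using IH[OF Ki _ ir] xy(2) by blast
    then have "y \<in> par (I' \<inter> J')" using par_mono[of "K \<inter> (J' - {i})" "I' \<inter> J'"] IK by blast
    moreover have "x \<in> par (I' \<inter> J')"
      using par_mono[of "{i..c}" "I' \<inter> J'"] I'(2) J'(2) xy(1) by blast
    ultimately show "g \<in> par (I' \<inter> J')" using mult_in_par xy(3) by blast
  qed
  show ?case
  proof (cases "i \<in> I \<and> i \<in> J")
    case False
    then show ?thesis
      using missing[OF less.prems(2) _ less.prems(3)] missing[OF less.prems(3) _ less.prems(2)]
      by (auto simp: Int_commute)
  next
    case True
    obtain c where c: "i \<le> c" "{i..c} \<subseteq> I" "Suc c \<notin> I" "c \<le> r"
      using initial_segment_split[OF less.prems(2)] True by metis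
    obtain d where d: "i \<le> d" "{i..d} \<subseteq> J" "Suc d \<notin> J" "d \<le> r"
      using initial_segment_split[OF less.prems(3)] True by metis
    show ?thesis
    proof (cases "c \<le> d")
      case True
      then have "{i..c} \<subseteq> J" using d(2) by (meson atLeastatMost_subset_iff order.refl subset_trans)
      then show ?thesis using both[of I c J] c less.prems by blast
    next
      case False
      then have "{i..d} \<subseteq> I" using c(2) by (meson atLeastatMost_subset_iff order.refl subset_trans nat_le_linear)
      then show ?thesis using both[of J d I] d less.prems by (simp add: Int_commute)
    qed
  qed
qed

theorem par_intersection:
  assumes "I \<subseteq> {1..r}" "J \<subseteq> {1..r}"
  shows "par I \<inter> par J = par (I \<inter> J)"
  using par_intersection_aux[OF order.refl assms] par_mono[of "I \<inter> J"] by blast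

end

section \<open>Stabilizers of the base faces and the poset of their cosets\<close>

context string_C_group
begin

definition stab :: "nat \<Rightarrow> 'a set"
  where "stab i = par ({1..r} - {i})"

lemma stab_closed: "x \<in> stab i \<Longrightarrow> x \<in> carrier G"
  unfolding stab_def using par_closed[of "{1..r} - {i}"] by blast

lemma gen_in_stab: "i \<in> {1..r} \<Longrightarrow> i \<noteq> j \<Longrightarrow> \<rho> i \<in> stab j"
  unfolding stab_def by (rule gen_in_par) blast

lemma par_all: "par {1..r} = carrier G"
  unfolding par_def by (rule generates)

lemma par_empty: "par {} = {\<one>}"
proof -
  have "x = \<one>" if "x \<in> par {}" for x
    using that unfolding par_def by (induction x rule: generate.induct) auto
  then show ?thesis using one_in_par by blast
qed

lemma stab_extreme: "i \<notin> {1..r} \<Longrightarrow> stab i = carrier G"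
  unfolding stab_def using par_all by simp

text \<open>By \<open>par_intersection\<close>, each further \<open>stab j\<close> deletes one more
  generator. Agreement of two flags in the faces indexed by \<open>J\<close> thus becomes a word in
  the remaining generators.\<close>

lemma par_stab_iff:
  assumes "J \<subseteq> {1..r}" "x \<in> carrier G"
  shows "(\<forall>j\<in>J. x \<in> stab j) \<longleftrightarrow> x \<in> par ({1..r} - J)"
proof -
  have "finite J" using assms(1) finite_subset by blast
  then show ?thesis using assms
  proof (induction J rule: finite_induct)
    case empty then show ?case using par_all by simp
  next
    case (insert j J)
    have "x \<in> par ({1..r} - insert j J) \<longleftrightarrow> x \<in> par ({1..r} - {j}) \<and> x \<in> par ({1..r} - J)"
      using par_intersection[of "{1..r} - {j}" "{1..r} - J"]
      by (metis Diff_subset Int_iff Diff_Un Un_insert_left sup_bot_left)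
    then show ?case using insert unfolding stab_def by auto
  qed
qed

text \<open>Otherwise \<open>\<rho> i\<close> would lie in both \<open>par {i}\<close> and
  \<open>par ({1..r} - {i})\<close>, whose intersection \<open>par {}\<close> is trivial.\<close>

lemma gen_notin_stab: "i \<in> {1..r} \<Longrightarrow> \<rho> i \<notin> stab i"
  using par_intersection[of "{i}" "{1..r} - {i}"] gen_in_par[of i "{i}"] par_empty gen_nontrivial[of i]
  unfolding stab_def by auto

lemma par_singleton:
  assumes "i \<in> {1..r}" "x \<in> par {i}" shows "x = \<one> \<or> x = \<rho> i"
proof -
  have "\<one> \<otimes> x = \<one> \<or> \<one> \<otimes> x = \<rho> i"
    by (rule par_right_induct[of "{i}", where P = "\<lambda>x. x = \<one> \<or> x = \<rho> i"])
      (use assms gen_involution gen_closed in auto)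
  then show ?thesis using par_closed[of "{i}"] assms by auto
qed

end

text \<open>
  \<open>F i k\<close> stands for the coset of \<open>k\<close> modulo \<open>stab i\<close>. As the generators are numbered from 1, it has rank
  \<open>i - 1\<close>, and the indices 0 and \<open>r + 1\<close>, whose stabilizer is the whole group, are the improper faces.
\<close>
locale string_C_group_faces = string_C_group +
  fixes F :: "nat \<Rightarrow> 'a \<Rightarrow> 'f"
  assumes F_eq: "i \<le> r + 1 \<Longrightarrow> j \<le> r + 1 \<Longrightarrow> k \<in> carrier G \<Longrightarrow> h \<in> carrier G \<Longrightarrow>
    F i k = F j h \<longleftrightarrow> i = j \<and> inv k \<otimes> h \<in> stab i"
begin

definition faces :: "'f set"
  where "faces = {F i k |i k. i \<le> r + 1 \<and> k \<in> carrier G}"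

definition face_leq :: "'f rel"
  where "face_leq = {(F i k, F j k) |i j k. i \<le> j \<and> j \<le> r + 1 \<and> k \<in> carrier G}"

definition flag_at :: "'a \<Rightarrow> 'f set"
  where "flag_at k = {F i k |i. i \<le> r + 1}"

lemma F_index: "F i k = F j h \<Longrightarrow> i \<le> r + 1 \<Longrightarrow> j \<le> r + 1 \<Longrightarrow> k \<in> carrier G \<Longrightarrow> h \<in> carrier G \<Longrightarrow> i = j"
  using F_eq by blast

lemma F_mult: "i \<le> r + 1 \<Longrightarrow> k \<in> carrier G \<Longrightarrow> x \<in> stab i \<Longrightarrow> F i (k \<otimes> x) = F i k"
  using F_eq[of i i k "k \<otimes> x"] stab_closed[of x i] by (simp add: m_assoc[symmetric])

lemma F_extreme: "i = 0 \<or> i = r + 1 \<Longrightarrow> k \<in> carrier G \<Longrightarrow> h \<in> carrier G \<Longrightarrow> F i k = F i h"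
  using F_eq[of i i k h] stab_extreme[of i] by auto

lemma F_left: "i \<le> r + 1 \<Longrightarrow> k \<in> carrier G \<Longrightarrow> h \<in> carrier G \<Longrightarrow> g \<in> carrier G \<Longrightarrow>
    F i (g \<otimes> k) = F i (g \<otimes> h) \<longleftrightarrow> F i k = F i h"
  by (simp add: F_eq inv_mult_group m_assoc inv_solve_left')
    (metis inv_closed l_inv l_one m_assoc m_closed)

text \<open>
  \<open>stab j\<close> is the product of the commuting subgroups on the generators below and above \<open>j\<close>.
\<close>
lemma splice:
  assumes j: "j \<le> r + 1" and k: "k \<in> carrier G" and k': "k' \<in> carrier G" and eq: "F j k = F j k'"
  shows "\<exists>k''\<in>carrier G. (\<forall>i\<le>j. F i k'' = F i k) \<and> (\<forall>l. j \<le> l \<longrightarrow> l \<le> r + 1 \<longrightarrow> F l k'' = F l k')"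
proof -
  have x: "inv k \<otimes> k' \<in> par ({j+1..r} \<union> {1..j-1})"
  proof -
    have "{1..r} - {j} \<subseteq> {j+1..r} \<union> {1..j-1}" by auto
    then show ?thesis using F_eq[OF j j k k'] eq par_mono unfolding stab_def by blast
  qed
  have sub: "{j+1..r} \<subseteq> {1..r}" "{1..j-1} \<subseteq> {1..r}" using j by auto
  obtain a b where ab: "a \<in> par {j+1..r}" "b \<in> par {1..j-1}" "inv k \<otimes> k' = a \<otimes> b"
    using par_factor[OF sub _ x] unfolding far_def by force
  have c: "a \<in> carrier G" "b \<in> carrier G"
    using par_closed[OF sub(1) ab(1)] par_closed[OF sub(2) ab(2)] .
  have k'': "k' = k \<otimes> a \<otimes> b"
    using ab(3) c k k' by (metis inv_closed l_one m_assoc m_closed r_inv)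
  have "F i (k \<otimes> a) = F i k" if "i \<le> j" for i
  proof (rule F_mult)
    have "{j+1..r} \<subseteq> {1..r} - {i}" using that by auto
    then show "a \<in> stab i" unfolding stab_def using ab(1) par_mono by blast
  qed (use that j k in auto)
  moreover have "F l k' = F l (k \<otimes> a)" if "j \<le> l" "l \<le> r + 1" for l
    unfolding k''
  proof (rule F_mult)
    have "{1..j-1} \<subseteq> {1..r} - {l}" using that by auto
    then show "b \<in> stab l" unfolding stab_def using ab(2) par_mono by blast
  qed (use that c k in auto)
  ultimately show ?thesis using k c by (intro bexI[of _ "k \<otimes> a"]) auto
qed

text \<open>Incidence means that the two cosets share an element \<open>g\<close>. The
  representatives occurring in \<open>face_leq\<close> may be exchanged because \<open>F\<close>
  determines its index.\<close>

lemma leq_iff: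
  assumes "i \<le> r + 1" "j \<le> r + 1" "k \<in> carrier G" "h \<in> carrier G"
  shows "(F i k, F j h) \<in> face_leq \<longleftrightarrow> i \<le> j \<and> (\<exists>g\<in>carrier G. F i k = F i g \<and> F j h = F j g)"
proof
  assume "(F i k, F j h) \<in> face_leq"
  then obtain i' j' g where g: "F i k = F i' g" "F j h = F j' g" "i' \<le> j'" "j' \<le> r + 1" "g \<in> carrier G"
    unfolding face_leq_def by blast
  then have "i = i'" "j = j'" using F_index assms by auto
  then show "i \<le> j \<and> (\<exists>g\<in>carrier G. F i k = F i g \<and> F j h = F j g)" using g by blast
next
  assume "i \<le> j \<and> (\<exists>g\<in>carrier G. F i k = F i g \<and> F j h = F j g)"
  then show "(F i k, F j h) \<in> face_leq" unfolding face_leq_def using assms by fastforce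
qed

lemma faces_cases:
  assumes "x \<in> faces" obtains i k where "i \<le> r + 1" "k \<in> carrier G" "x = F i k"
  using assms unfolding faces_def by blast

lemma F_in_faces: "i \<le> r + 1 \<Longrightarrow> k \<in> carrier G \<Longrightarrow> F i k \<in> faces"
  unfolding faces_def by blast

lemma face_leq_same: "i \<le> j \<Longrightarrow> j \<le> r + 1 \<Longrightarrow> k \<in> carrier G \<Longrightarrow> (F i k, F j k) \<in> face_leq"
  unfolding face_leq_def by blast

lemma face_partial_order: "partial_order_on faces face_leq"
proof -
  have "trans face_leq"
  proof (rule transI)
    fix x y z assume "(x, y) \<in> face_leq" "(y, z) \<in> face_leq"
    then obtain i j k j' l k' where
      1: "x = F i k" "y = F j k" "i \<le> j" "j \<le> r + 1" "k \<in> carrier G" and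
      2: "y = F j' k'" "z = F l k'" "j' \<le> l" "l \<le> r + 1" "k' \<in> carrier G"
      unfolding face_leq_def by blast
    have j: "j' = j" using F_index 1 2 by (metis order.trans)
    obtain k'' where "k'' \<in> carrier G" "F i k'' = F i k" "F l k'' = F l k'"
      using splice[OF 1(4,5) 2(5)] 1 2 j by metis
    then show "(x, z) \<in> face_leq"
      using face_leq_same[of i l k''] 1 2 j by simp
  qed
  moreover have "antisym face_leq"
  proof (rule antisymI)
    fix x y assume "(x, y) \<in> face_leq" "(y, x) \<in> face_leq"
    then obtain i j k i' j' k' where
      1: "x = F i k" "y = F j k" "i \<le> j" "j \<le> r + 1" "k \<in> carrier G" and
      2: "y = F j' k'" "x = F i' k'" "j' \<le> i'" "i' \<le> r + 1" "k' \<in> carrier G"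
      unfolding face_leq_def by blast
    have "j' = j" "i' = i" using F_index 1 2 by (metis order.trans)+
    then show "x = y" using 1 2 by simp
  qed
  moreover have "refl_on faces face_leq"
    unfolding refl_on_def faces_def using face_leq_same by blast
  moreover have "face_leq \<subseteq> faces \<times> faces"
    unfolding face_leq_def faces_def by fastforce
  ultimately show ?thesis
    unfolding partial_order_on_def preorder_on_def by blast
qed

abbreviation "lq \<equiv> (\<lambda>x y. (x, y) \<in> face_leq)"

lemma leq_refl: "x \<in> faces \<Longrightarrow> (x, x) \<in> face_leq"
  using face_partial_order unfolding partial_order_on_def preorder_on_def refl_on_def by blast

lemma chain_iff: "pred_on.chain faces lq C \<longleftrightarrow>
    C \<subseteq> faces \<and> (\<forall>x\<in>C. \<forall>y\<in>C. (x, y) \<in> face_leq \<or> (y, x) \<in> face_leq)"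
  using leq_refl unfolding pred_on.chain_def by blast

lemma same_rank_comparable:
  assumes "i \<le> r + 1" "k \<in> carrier G" "h \<in> carrier G"
    and "(F i k, F i h) \<in> face_leq \<or> (F i h, F i k) \<in> face_leq"
  shows "F i k = F i h"
  using assms by (auto simp: leq_iff)

text \<open>Ranks are treated from below: \<open>k\<close> represents all faces of the chain up to
  index \<open>n\<close>, and a face at \<open>Suc n\<close> is glued on by \<open>splice\<close> at
  the highest index below that the chain occupies. Indices omitted by the chain impose
  nothing.\<close>

lemma chain_subset_flag:
  assumes C: "pred_on.chain faces lq C"
  shows "\<exists>k\<in>carrier G. C \<subseteq> flag_at k"
proof -
  have cmp: "(x, y) \<in> face_leq \<or> (y, x) \<in> face_leq" if "x \<in> C" "y \<in> C" for x y
    using C that unfolding chain_iff by blast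
  have "n \<le> r + 1 \<Longrightarrow> \<exists>k\<in>carrier G. \<forall>i\<le>n. \<forall>h\<in>carrier G. F i h \<in> C \<longrightarrow> F i h = F i k" for n
  proof (induction n)
    case 0
    have "F i h = F i \<one>" if "i \<le> 0" "h \<in> carrier G" for i h
      using that by (intro F_extreme) auto
    then show ?case by (intro bexI[of _ \<one>]) blast+
  next
    case (Suc n)
    then obtain k where k: "k \<in> carrier G"
      "\<And>i h. i \<le> n \<Longrightarrow> h \<in> carrier G \<Longrightarrow> F i h \<in> C \<Longrightarrow> F i h = F i k" by auto
    show ?case
    proof (cases "\<exists>h\<in>carrier G. F (Suc n) h \<in> C")
      case False
      then show ?thesis using k by (metis le_Suc_eq)
    next
      case True
      then obtain h where h: "h \<in> carrier G" "F (Suc n) h \<in> C" by blast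
      have top: "F (Suc n) h' = F (Suc n) h" if "h' \<in> carrier G" "F (Suc n) h' \<in> C" for h'
        using same_rank_comparable[OF Suc.prems that(1) h(1)] cmp[OF that(2) h(2)] by blast
      define J where "J = {i. i \<le> n \<and> (\<exists>h\<in>carrier G. F i h \<in> C)}"
      have finJ: "finite J" unfolding J_def by simp
      show ?thesis
      proof (cases "J = {}")
        case True
        then show ?thesis using h(1) top unfolding J_def by (metis (mono_tags, lifting) empty_Collect_eq le_Suc_eq)
      next
        case False
        \<comment> \<open>Incidence with this one face suffices: \<open>splice\<close> keeps
          everything up to \<open>j\<close>, and the chain has no face strictly between
          \<open>j\<close> and \<open>Suc n\<close>.\<close>
        define j where "j = Max J"
        have jJ: "j \<in> J" and jmax: "\<And>i. i \<in> J \<Longrightarrow> i \<le> j"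
          using Max_in[OF finJ False] Max_ge[OF finJ] unfolding j_def by auto
        then obtain h' where h': "h' \<in> carrier G" "F j h' \<in> C" "j \<le> n" unfolding J_def by blast
        have "F j k \<in> C" using k(2)[OF h'(3,1,2)] h'(2) by simp
        then have "(F j k, F (Suc n) h) \<in> face_leq \<or> (F (Suc n) h, F j k) \<in> face_leq"
          using cmp h(2) by blast
        then obtain g where g: "g \<in> carrier G" "F j k = F j g" "F (Suc n) h = F (Suc n) g"
          using leq_iff[of j "Suc n" k h] leq_iff[of "Suc n" j h k] h'(3) Suc.prems k(1) h(1) by auto
        obtain k'' where k'': "k'' \<in> carrier G" "\<And>i. i \<le> j \<Longrightarrow> F i k'' = F i k"
          "F (Suc n) k'' = F (Suc n) g"
          using splice[OF _ k(1) g(1,2)] h'(3) Suc.prems by force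
        have "F i h1 = F i k''" if i: "i \<le> Suc n" "h1 \<in> carrier G" "F i h1 \<in> C" for i h1
        proof (cases "i = Suc n")
          case True
          then show ?thesis using top[of h1] that k''(3) g(3) by simp
        next
          case False
          then have "i \<in> J" using that unfolding J_def by auto
          then have "i \<le> j" by (rule jmax)
          then show ?thesis using k(2)[of i h1] k''(2) False that by simp
        qed
        then show ?thesis using k''(1) by blast
      qed
    qed
  qed
  from this[of "r + 1"] obtain k where k: "k \<in> carrier G"
    "\<forall>i\<le>r+1. \<forall>h\<in>carrier G. F i h \<in> C \<longrightarrow> F i h = F i k" by blast
  have "C \<subseteq> flag_at k"
  proof
    fix x assume x: "x \<in> C"
    then have "x \<in> faces" using C unfolding chain_iff by blast
    then obtain i h where "i \<le> r + 1" "h \<in> carrier G" "x = F i h" by (rule faces_cases)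
    then show "x \<in> flag_at k" using k x unfolding flag_at_def by auto
  qed
  then show ?thesis using k(1) by blast
qed

lemma flag_at_chain: "k \<in> carrier G \<Longrightarrow> pred_on.chain faces lq (flag_at k)"
  unfolding chain_iff flag_at_def using F_in_faces face_leq_same by (auto, meson nat_le_linear)

lemma flag_at_subset:
  assumes "k \<in> carrier G" "h \<in> carrier G" "flag_at k \<subseteq> flag_at h" "i \<le> r + 1"
  shows "F i k = F i h"
proof -
  have "F i k \<in> flag_at h" using assms unfolding flag_at_def by blast
  then obtain j where "j \<le> r + 1" "F i k = F j h" unfolding flag_at_def by blast
  then show ?thesis using F_index[of i k j h] assms by auto
qed

lemma flag_at_eqI: "(\<And>i. i \<le> r + 1 \<Longrightarrow> F i k = F i h) \<Longrightarrow> flag_at k = flag_at h"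
  unfolding flag_at_def by force

lemma flags_eq: "flags faces face_leq = flag_at ` carrier G"
proof -
  have "flag_at k \<in> flags faces face_leq" if k: "k \<in> carrier G" for k
  proof -
    have "C = flag_at k" if C: "pred_on.chain faces lq C" "flag_at k \<subseteq> C" for C
    proof -
      obtain h where h: "h \<in> carrier G" "C \<subseteq> flag_at h" using chain_subset_flag C(1) by blast
      then have "flag_at k = flag_at h"
        using flag_at_subset[OF k h(1)] C(2) by (intro flag_at_eqI) blast
      then show ?thesis using C(2) h(2) by blast
    qed
    then show ?thesis
      using flag_at_chain[OF k] unfolding flags_def pred_on.maxchain_def by blast
  qed
  moreover have "\<exists>k\<in>carrier G. C = flag_at k" if "C \<in> flags faces face_leq" for C
  proof -
    have C: "pred_on.chain faces lq C" "\<And>S. pred_on.chain faces lq S \<Longrightarrow> \<not> C \<subset> S"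
      using that unfolding flags_def pred_on.maxchain_def by blast+
    then show ?thesis using chain_subset_flag[OF C(1)] flag_at_chain by blast
  qed
  ultimately show ?thesis by blast
qed

lemma flag_at_image: "flag_at k = (\<lambda>i. F i k) ` {..r+1}"
  unfolding flag_at_def by auto

lemma inj_on_flag: "k \<in> carrier G \<Longrightarrow> inj_on (\<lambda>i. F i k) {..r+1}"
  using F_index by (intro inj_onI) auto

lemma card_flag_at: "k \<in> carrier G \<Longrightarrow> card (flag_at k) = r + 2"
  unfolding flag_at_image using card_image[OF inj_on_flag] by simp

lemma face_rank_F:
  assumes i: "i \<le> r + 1" and k: "k \<in> carrier G"
  shows "face_rank faces face_leq (F i k) = int i - 1"
proof -
  have "face_rank faces face_leq (F i k)
      = int (card {H \<in> flag_at k. (H, F i k) \<in> face_leq \<and> H \<noteq> F i k}) - 1"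
    using face_rank_eq[OF face_partial_order, of r "flag_at k" "F i k"] card_flag_at flags_eq k i
    unfolding flag_at_image by auto
  also have "{H \<in> flag_at k. (H, F i k) \<in> face_leq \<and> H \<noteq> F i k} = (\<lambda>i. F i k) ` {..<i}"
  proof -
    have iff: "(F j k, F i k) \<in> face_leq \<and> F j k \<noteq> F i k \<longleftrightarrow> j < i" if "j \<le> r + 1" for j
      using leq_iff[OF that i k k] F_index[of j k i k] that i k by (auto simp: order.strict_iff_order)
    have "j \<le> r + 1 \<and> (F j k, F i k) \<in> face_leq \<and> F j k \<noteq> F i k \<longleftrightarrow> j < i" for j
    proof (cases "j \<le> r + 1")
      case True then show ?thesis using iff by simp
    next
      case False then show ?thesis using i by simp
    qed
    then have "{j. j \<le> r + 1 \<and> (F j k, F i k) \<in> face_leq \<and> F j k \<noteq> F i k} = {..<i}"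
      unfolding lessThan_def by (intro Collect_cong)
    moreover have "{H \<in> flag_at k. (H, F i k) \<in> face_leq \<and> H \<noteq> F i k}
        = (\<lambda>j. F j k) ` {j. j \<le> r + 1 \<and> (F j k, F i k) \<in> face_leq \<and> F j k \<noteq> F i k}"
      unfolding flag_at_def by auto
    ultimately show ?thesis by simp
  qed
  also have "card \<dots> = i"
  proof -
    have "{..<i} \<subseteq> {..r+1}" using i by auto
    from card_image[OF inj_on_subset[OF inj_on_flag[OF k] this]] show ?thesis by simp
  qed
  finally show ?thesis by simp
qed

text \<open>A face between \<open>F i k\<close> and \<open>F (i + 2) k\<close> is represented by
  some \<open>k \<otimes> x\<close> with \<open>x\<close> in both stabilizers. Deleting both
  neighbours of \<open>s = i + 1\<close> makes \<open>\<rho> s\<close> commute with the remaining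
  generators, so \<open>x\<close> is a power of \<open>\<rho> s\<close> up to an element of
  \<open>stab s\<close>. This leaves two faces, distinct by \<open>gen_notin_stab\<close>.\<close>

lemma face_diamond: "diamond_condition faces face_leq"
  unfolding diamond_condition_def
proof (intro ballI allI impI)
  fix A B n
  assume A: "A \<in> faces" and B: "B \<in> faces"
    and h: "(A, B) \<in> face_leq \<and> A \<noteq> B \<and>
      face_rank faces face_leq A = n - 1 \<and> face_rank faces face_leq B = n + 1"
  then obtain i j k where ijk: "A = F i k" "B = F j k" "i \<le> j" "j \<le> r + 1" "k \<in> carrier G"
    unfolding face_leq_def by blast
  then have j: "j = i + 2" using h face_rank_F[of i k] face_rank_F[of j k] by auto
  define s where "s = i + 1"
  have s: "s \<in> {1..r}" "s \<le> r + 1" and i: "i \<le> r + 1" using j ijk(4) unfolding s_def by auto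
  note k = ijk(5)
  have sc: "\<rho> s \<in> carrier G" using s gen_closed by blast
  have "{H \<in> faces. (A, H) \<in> face_leq \<and> A \<noteq> H \<and> (H, B) \<in> face_leq \<and> H \<noteq> B} = {F s k, F s (k \<otimes> \<rho> s)}"
    (is "?M = _")
  proof
    have ne: "A \<noteq> F s h" "F s h \<noteq> B" if "h \<in> carrier G" for h
      using that F_index[of i k s h] F_index[of s h j k] ijk i s s_def j by auto
    have 1: "F i (k \<otimes> \<rho> s) = F i k" "F j (k \<otimes> \<rho> s) = F j k"
      using F_mult[OF i k gen_in_stab[OF s(1)]] F_mult[OF ijk(4) k gen_in_stab[OF s(1)]] j
      unfolding s_def by auto
    have "(F i k, F s h) \<in> face_leq" "(F s h, F j k) \<in> face_leq"
      if "h = k \<or> h = k \<otimes> \<rho> s" for h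
      using that face_leq_same[of i s h] face_leq_same[of s j h] 1 k sc s(2) ijk(4) j
      unfolding s_def by auto
    then show "{F s k, F s (k \<otimes> \<rho> s)} \<subseteq> ?M"
      using ne k sc F_in_faces[OF s(2)] ijk(1,2) by auto
  next
    show "?M \<subseteq> {F s k, F s (k \<otimes> \<rho> s)}"
    proof
      fix H assume H: "H \<in> ?M"
      then obtain l h where lh: "l \<le> r + 1" "h \<in> carrier G" "H = F l h" by (auto elim: faces_cases)
      obtain g1 where g1: "i \<le> l" "g1 \<in> carrier G" "F i k = F i g1" "F l h = F l g1"
        using H leq_iff[OF i lh(1) k lh(2)] ijk lh by auto
      obtain g2 where g2: "l \<le> j" "g2 \<in> carrier G" "F l h = F l g2" "F j k = F j g2"
        using H leq_iff[OF lh(1) ijk(4) lh(2) k] ijk lh by auto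
      have "l \<noteq> i" "l \<noteq> j" using H ijk lh g1 g2 by auto
      then have l: "l = s" using g1(1) g2(1) j unfolding s_def by auto
      obtain g where g: "g \<in> carrier G" "F i g = F i g1" "F j g = F j g2" "F s g = F s h"
        using splice[OF lh(1) g1(2) g2(2)] g1 g2 l ijk(4) by (metis order.refl)
      define x where "x = inv k \<otimes> g"
      have x: "x \<in> stab i" "x \<in> stab j"
        using F_eq[OF i i k g(1)] F_eq[OF ijk(4) ijk(4) k g(1)] g g1 g2 unfolding x_def by auto
      have gx: "g = k \<otimes> x" and xc: "x \<in> carrier G"
        unfolding x_def using k g(1) by (auto simp: m_assoc[symmetric])
      have "x \<in> par (({1..r} - {i}) \<inter> ({1..r} - {j}))"
        using par_intersection[of "{1..r} - {i}" "{1..r} - {j}"] x unfolding stab_def by auto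
      moreover have "({1..r} - {i}) \<inter> ({1..r} - {j}) \<subseteq> {s} \<union> ({1..r} - {i, s, j})" by auto
      ultimately have "x \<in> par ({s} \<union> ({1..r} - {i, s, j}))" using par_mono by blast
      moreover have "far {s} ({1..r} - {i, s, j})" unfolding far_def s_def j by auto
      ultimately obtain a b where ab: "a \<in> par {s}" "b \<in> par ({1..r} - {i, s, j})" "x = a \<otimes> b"
        using par_factor[of "{s}" "{1..r} - {i, s, j}" x] s by auto
      have a: "a = \<one> \<or> a = \<rho> s" using par_singleton[OF s(1) ab(1)] .
      then have ac: "a \<in> carrier G" using sc by auto
      have bs: "b \<in> stab s" unfolding stab_def using ab(2) par_mono[of "{1..r} - {i, s, j}" "{1..r} - {s}"] by blast
      have "F s g = F s (k \<otimes> a \<otimes> b)" using gx ab(3) k ac stab_closed[OF bs] by (simp add: m_assoc)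
      also have "\<dots> = F s (k \<otimes> a)" using F_mult[OF s(2) _ bs] k ac by simp
      finally show "H \<in> {F s k, F s (k \<otimes> \<rho> s)}" using a g(4) lh l k by auto
    qed
  qed
  moreover have "F s k \<noteq> F s (k \<otimes> \<rho> s)"
    using F_eq[OF s(2) s(2) k, of "k \<otimes> \<rho> s"] gen_notin_stab[OF s(1)] k sc
    by (simp add: m_assoc[symmetric])
  ultimately show "card {H \<in> faces. (A, H) \<in> face_leq \<and> A \<noteq> H \<and> (H, B) \<in> face_leq \<and> H \<noteq> B} = 2"
    by simp
qed

text \<open>A word for \<open>inv k \<otimes> h\<close> in generators outside \<open>J\<close> is a
  gallery: right multiplication by \<open>\<rho> i\<close> changes only the face of index
  \<open>i\<close>, and for \<open>i\<close> outside \<open>J\<close> that face is not common to the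
  two flags. Such a word exists by \<open>par_stab_iff\<close>.\<close>

lemma face_flag_connected: "strongly_flag_connected faces face_leq"
  unfolding strongly_flag_connected_def
proof (intro ballI)
  fix \<Phi> \<Psi> assume "\<Phi> \<in> flags faces face_leq" "\<Psi> \<in> flags faces face_leq"
  then obtain k h where k: "k \<in> carrier G" "\<Phi> = flag_at k" and h: "h \<in> carrier G" "\<Psi> = flag_at h"
    unfolding flags_eq by blast
  define J where "J = {i \<in> {1..r}. F i k = F i h}"
  define x where "x = inv k \<otimes> h"
  have hx: "h = k \<otimes> x" and xc: "x \<in> carrier G"
    unfolding x_def using k h by (auto simp: m_assoc[symmetric])
  have "x \<in> stab j" if "j \<in> J" for j
    using that F_eq[of j j k h] k h unfolding J_def x_def by auto
  then have "x \<in> par ({1..r} - J)"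
    using par_stab_iff[of J x] xc unfolding J_def by blast
  let ?R = "{(X, Y). X \<in> flags faces face_leq \<and> Y \<in> flags faces face_leq \<and>
                      \<Phi> \<inter> \<Psi> \<subseteq> X \<and> \<Phi> \<inter> \<Psi> \<subseteq> Y \<and> adjacent_flags X Y}"
  let ?Q = "\<lambda>g. (\<Phi>, flag_at g) \<in> ?R\<^sup>* \<and> \<Phi> \<inter> \<Psi> \<subseteq> flag_at g"
  have "?Q (k \<otimes> x)"
  proof (rule par_right_induct[OF _ \<open>x \<in> par ({1..r} - J)\<close> k(1)])
    show "?Q k" using k by simp
  next
    fix i y assume i: "i \<in> {1..r} - J" and y: "y \<in> carrier G" "?Q y"
    have ic: "\<rho> i \<in> carrier G" and i1: "i \<in> {1..r}" using i gen_closed by auto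
    have same: "F j (y \<otimes> \<rho> i) = F j y" if "j \<noteq> i" "j \<le> r + 1" for j
      using F_mult[OF that(2) y(1) gen_in_stab[OF i1]] that by blast
    have diff: "F j (y \<otimes> \<rho> i) \<noteq> F i y" "F j y \<noteq> F i (y \<otimes> \<rho> i)" if "j \<le> r + 1" for j
    proof -
      have "F i (y \<otimes> \<rho> i) \<noteq> F i y"
        using F_eq[of i i y "y \<otimes> \<rho> i"] gen_notin_stab[OF i1] y(1) ic i1
        by (simp add: m_assoc[symmetric])
      then show "F j (y \<otimes> \<rho> i) \<noteq> F i y" "F j y \<noteq> F i (y \<otimes> \<rho> i)"
        using F_index[of j "y \<otimes> \<rho> i" i y] F_index[of j y i "y \<otimes> \<rho> i"] that i1 y(1) ic by auto
    qed
    have lost: "flag_at y - flag_at (y \<otimes> \<rho> i) = {F i y}"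
    proof -
      have "F i y \<notin> flag_at (y \<otimes> \<rho> i)" using diff unfolding flag_at_def by force
      moreover have "F j y \<in> flag_at (y \<otimes> \<rho> i)" if "j \<noteq> i" "j \<le> r + 1" for j
        using same[OF that] that unfolding flag_at_def by force
      ultimately show ?thesis using i1 unfolding flag_at_def by fastforce
    qed
    have "flag_at (y \<otimes> \<rho> i) - flag_at y = {F i (y \<otimes> \<rho> i)}"
    proof -
      have "F i (y \<otimes> \<rho> i) \<notin> flag_at y" using diff unfolding flag_at_def by force
      moreover have "F j (y \<otimes> \<rho> i) \<in> flag_at y" if "j \<noteq> i" "j \<le> r + 1" for j
        using same[OF that] that unfolding flag_at_def by force
      ultimately show ?thesis using i1 unfolding flag_at_def by fastforce
    qed
    then have adj: "adjacent_flags (flag_at y) (flag_at (y \<otimes> \<rho> i))"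
      using lost unfolding adjacent_flags_def by simp
    have kept: "F i y \<notin> \<Phi> \<inter> \<Psi>"
    proof
      assume "F i y \<in> \<Phi> \<inter> \<Psi>"
      then obtain a b where ab: "a \<le> r + 1" "F i y = F a k" "b \<le> r + 1" "F i y = F b h"
        using k h unfolding flag_at_def by auto
      then have "i = a" "i = b"
        using F_index[of i y a k] F_index[of i y b h] i1 y(1) k h by auto
      then show False using i ab unfolding J_def by auto
    qed
    have sub: "\<Phi> \<inter> \<Psi> \<subseteq> flag_at (y \<otimes> \<rho> i)"
    proof
      fix z assume z: "z \<in> \<Phi> \<inter> \<Psi>"
      then have "z \<noteq> F i y" using kept by metis
      moreover have "z \<in> flag_at y" by (rule subsetD[OF conjunct2[OF y(2)] z])
      ultimately show "z \<in> flag_at (y \<otimes> \<rho> i)" using lost by blast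
    qed
    have "(flag_at y, flag_at (y \<otimes> \<rho> i)) \<in> ?R"
      using y adj sub ic unfolding flags_eq by auto
    then show "?Q (y \<otimes> \<rho> i)" using y(2) sub by (meson rtrancl.rtrancl_into_rtrancl)
  qed blast
  then show "(\<Phi>, \<Psi>) \<in> ?R\<^sup>*" using hx h by simp
qed

lemma face_polytope: "abstract_polytope faces face_leq r"
proof
  show "partial_order_on faces face_leq" by (rule face_partial_order)
  show "\<exists>b\<in>faces. \<forall>x\<in>faces. (b, x) \<in> face_leq"
  proof (intro bexI ballI)
    fix x assume "x \<in> faces"
    then obtain i k where "i \<le> r + 1" "k \<in> carrier G" "x = F i k" by (rule faces_cases)
    then show "(F 0 \<one>, x) \<in> face_leq" using face_leq_same[of 0 i k] F_extreme[of 0 k \<one>] by simp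
  qed (simp add: F_in_faces)
  show "\<exists>t\<in>faces. \<forall>x\<in>faces. (x, t) \<in> face_leq"
  proof (intro bexI ballI)
    fix x assume "x \<in> faces"
    then obtain i k where "i \<le> r + 1" "k \<in> carrier G" "x = F i k" by (rule faces_cases)
    then show "(x, F (r+1) \<one>) \<in> face_leq"
      using face_leq_same[of i "r+1" k] F_extreme[of "r+1" k \<one>] by simp
  qed (simp add: F_in_faces)
  show "card \<Phi> = r + 2" if "\<Phi> \<in> flags faces face_leq" for \<Phi>
    using that card_flag_at unfolding flags_eq by auto
qed (rule face_flag_connected face_diamond)+

section \<open>Automorphisms of the coset poset are left multiplications\<close>

definition act :: "'a \<Rightarrow> 'f \<Rightarrow> 'f"
  where "act g = (\<lambda>x\<in>faces. SOME y. \<exists>i k. i \<le> r + 1 \<and> k \<in> carrier G \<and> x = F i k \<and> y = F i (g \<otimes> k))"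

text \<open>\<open>act\<close> picks a representative of the face; by \<open>F_left\<close> the
  result does not depend on the choice.\<close>

lemma act_F:
  assumes "g \<in> carrier G" "i \<le> r + 1" "k \<in> carrier G"
  shows "act g (F i k) = F i (g \<otimes> k)"
proof -
  have "(SOME y. \<exists>j h. j \<le> r + 1 \<and> h \<in> carrier G \<and> F i k = F j h \<and> y = F j (g \<otimes> h)) = F i (g \<otimes> k)"
  proof (rule some_equality)
    show "\<exists>j h. j \<le> r + 1 \<and> h \<in> carrier G \<and> F i k = F j h \<and> F i (g \<otimes> k) = F j (g \<otimes> h)"
      using assms by blast
  next
    fix y assume "\<exists>j h. j \<le> r + 1 \<and> h \<in> carrier G \<and> F i k = F j h \<and> y = F j (g \<otimes> h)"
    then obtain j h where jh: "j \<le> r + 1" "h \<in> carrier G" "F i k = F j h" "y = F j (g \<otimes> h)" by blast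
    then have "j = i" using F_index assms by metis
    then show "y = F i (g \<otimes> k)" using jh F_left[of i k h g] assms by simp
  qed
  then show ?thesis unfolding act_def using F_in_faces assms by simp
qed

lemma act_faces: "g \<in> carrier G \<Longrightarrow> x \<in> faces \<Longrightarrow> act g x \<in> faces"
  by (elim faces_cases) (simp add: act_F F_in_faces)

lemma act_mult: "g \<in> carrier G \<Longrightarrow> h \<in> carrier G \<Longrightarrow> x \<in> faces \<Longrightarrow> act (g \<otimes> h) x = act g (act h x)"
  by (elim faces_cases) (simp add: act_F m_assoc)

lemma act_one: "x \<in> faces \<Longrightarrow> act \<one> x = x"
  by (elim faces_cases) (simp add: act_F)

lemma act_inv:
  assumes "g \<in> carrier G" "x \<in> faces"
  shows "act (inv g) (act g x) = x" "act g (act (inv g) x) = x"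
  using act_mult[of "inv g" g x] act_mult[of g "inv g" x] act_one assms by simp_all

lemma act_leq:
  assumes "g \<in> carrier G" "(x, y) \<in> face_leq" shows "(act g x, act g y) \<in> face_leq"
proof -
  obtain i j k where "x = F i k" "y = F j k" "i \<le> j" "j \<le> r + 1" "k \<in> carrier G"
    using assms(2) unfolding face_leq_def by blast
  then show ?thesis using act_F[OF assms(1)] face_leq_same[of i j "g \<otimes> k"] assms(1) by simp
qed

abbreviation "Aut \<equiv> polytope_aut faces face_leq"

lemma Aut_carrier: "f \<in> carrier Aut \<longleftrightarrow> f \<in> extensional faces \<and> bij_betw f faces faces \<and>
    (\<forall>x\<in>faces. \<forall>y\<in>faces. (f x, f y) \<in> face_leq \<longleftrightarrow> (x, y) \<in> face_leq)"
  unfolding polytope_aut_def by (auto simp: Bij_def)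

lemma act_Aut: "g \<in> carrier G \<Longrightarrow> act g \<in> carrier Aut"
  unfolding Aut_carrier
proof (intro conjI ballI)
  assume g: "g \<in> carrier G"
  show "act g \<in> extensional faces" unfolding act_def by simp
  show "bij_betw (act g) faces faces"
    by (rule bij_betw_byWitness[where f' = "act (inv g)"]) (use g act_inv act_faces in auto)
  fix x y assume "x \<in> faces" "y \<in> faces"
  then show "(act g x, act g y) \<in> face_leq \<longleftrightarrow> (x, y) \<in> face_leq"
    using act_leq[OF g] act_leq[of "inv g" "act g x" "act g y"] act_inv(1) g by auto
qed

lemma act_flag: "g \<in> carrier G \<Longrightarrow> k \<in> carrier G \<Longrightarrow> act g ` flag_at k = flag_at (g \<otimes> k)"
  unfolding flag_at_image image_image by (intro image_cong) (auto simp: act_F)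

theorem face_regular_polytope: "abstract_regular_polytope faces face_leq r"
proof (intro abstract_regular_polytope.intro face_polytope abstract_regular_polytope_axioms.intro)
  fix \<Phi> \<Psi> assume "\<Phi> \<in> flags faces face_leq" "\<Psi> \<in> flags faces face_leq"
  then obtain k h where k: "k \<in> carrier G" "\<Phi> = flag_at k" and h: "h \<in> carrier G" "\<Psi> = flag_at h"
    unfolding flags_eq by blast
  then have "act (h \<otimes> inv k) ` \<Phi> = \<Psi>" using act_flag[of "h \<otimes> inv k" k] by (simp add: m_assoc)
  then show "\<exists>f\<in>carrier Aut. f ` \<Phi> = \<Psi>" using act_Aut[of "h \<otimes> inv k"] k h by blast
qed

text \<open>The image of a flag is a chain, so it lies in some \<open>flag_at k'\<close>. The
  induced map \<open>\<sigma>\<close> on the indices \<open>0, ..., r + 1\<close> is strictly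
  increasing, hence the identity.\<close>

lemma Aut_flag:
  assumes f: "f \<in> carrier Aut" and k: "k \<in> carrier G"
  shows "\<exists>k'\<in>carrier G. \<forall>i\<le>r+1. f (F i k) = F i k'"
proof -
  have bij: "bij_betw f faces faces"
    and leq: "\<And>x y. x \<in> faces \<Longrightarrow> y \<in> faces \<Longrightarrow> (f x, f y) \<in> face_leq \<longleftrightarrow> (x, y) \<in> face_leq"
    using f unfolding Aut_carrier by blast+
  have ch: "flag_at k \<subseteq> faces" "\<And>x y. x \<in> flag_at k \<Longrightarrow> y \<in> flag_at k \<Longrightarrow> (x, y) \<in> face_leq \<or> (y, x) \<in> face_leq"
    using flag_at_chain[OF k] unfolding chain_iff by blast+
  have "f ` flag_at k \<subseteq> faces" using ch(1) bij unfolding bij_betw_def by blast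
  moreover have "(x, y) \<in> face_leq \<or> (y, x) \<in> face_leq" if xy: "x \<in> f ` flag_at k" "y \<in> f ` flag_at k" for x y
  proof -
    obtain a b where ab: "a \<in> flag_at k" "b \<in> flag_at k" "x = f a" "y = f b" using xy by blast
    then show ?thesis using ch(2)[of a b] leq[of a b] leq[of b a] ch(1) by blast
  qed
  ultimately have "pred_on.chain faces lq (f ` flag_at k)" unfolding chain_iff by blast
  then obtain k' where k': "k' \<in> carrier G" "f ` flag_at k \<subseteq> flag_at k'" using chain_subset_flag by blast
  have "\<forall>i. \<exists>j. i \<le> r + 1 \<longrightarrow> j \<le> r + 1 \<and> f (F i k) = F j k'"
    using k'(2) unfolding flag_at_def by blast
  then obtain \<sigma> where \<sigma>: "\<And>i. i \<le> r + 1 \<Longrightarrow> \<sigma> i \<le> r + 1 \<and> f (F i k) = F (\<sigma> i) k'" by metis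
  have "\<sigma> i < \<sigma> j" if ij: "i < j" "j \<le> r + 1" for i j
  proof -
    have i: "i \<le> r + 1" using ij by simp
    have "(F i k, F j k) \<in> face_leq" using face_leq_same[of i j k] ij k by simp
    then have "(F (\<sigma> i) k', F (\<sigma> j) k') \<in> face_leq"
      using leq[OF F_in_faces[OF i k] F_in_faces[OF ij(2) k]] \<sigma>[OF i] \<sigma>[OF ij(2)] by simp
    then have "\<sigma> i \<le> \<sigma> j"
      using leq_iff[of "\<sigma> i" "\<sigma> j" k' k'] \<sigma>[OF i] \<sigma>[OF ij(2)] k' by simp
    moreover have "F i k \<noteq> F j k" using F_index[of i k j k] ij k by auto
    then have "f (F i k) \<noteq> f (F j k)"
      using bij F_in_faces[OF i k] F_in_faces[OF ij(2) k] unfolding bij_betw_def inj_on_def by blast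
    then have "\<sigma> i \<noteq> \<sigma> j" using \<sigma>[OF i] \<sigma>[OF ij(2)] by auto
    ultimately show ?thesis by simp
  qed
  then have "\<sigma> i = i" if "i \<le> r + 1" for i
    using strict_mono_bounded_eq[of "r + 1" \<sigma> i] \<sigma> that by blast
  then show ?thesis using \<sigma> k'(1) by (intro bexI[of _ k']) auto
qed

text \<open>The image of the base flag determines \<open>f\<close>, by propagation to adjacent
  flags. If \<open>f\<close> acts as \<open>g\<close> on the flag of \<open>k\<close>, the image of
  the flag of \<open>k \<otimes> \<rho> s\<close> agrees with that of \<open>g \<otimes> k\<close>
  except possibly at \<open>s\<close>, so the two differ by \<one> or \<open>\<rho> s\<close>;
  injectivity of \<open>f\<close> excludes \<one>.\<close>

lemma Aut_eq_act:
  assumes f: "f \<in> carrier Aut"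
  shows "\<exists>g\<in>carrier G. f = act g"
proof -
  obtain g where g: "g \<in> carrier G" "\<And>i. i \<le> r + 1 \<Longrightarrow> f (F i \<one>) = F i g"
    using Aut_flag[OF f, of \<one>] by auto
  have bij: "bij_betw f faces faces" using f unfolding Aut_carrier by blast
  have key: "\<forall>i\<le>r+1. f (F i (\<one> \<otimes> x)) = F i (g \<otimes> (\<one> \<otimes> x))" if x: "x \<in> par {1..r}" for x
  proof (rule par_right_induct[OF order.refl x, where P = "\<lambda>k. \<forall>i\<le>r+1. f (F i k) = F i (g \<otimes> k)"])
    fix s k assume s: "s \<in> {1..r}" and k: "k \<in> carrier G" "\<forall>i\<le>r+1. f (F i k) = F i (g \<otimes> k)"
    have sc: "\<rho> s \<in> carrier G" using s gen_closed by blast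
    have ks: "k \<otimes> \<rho> s \<in> carrier G" and gk: "g \<otimes> k \<in> carrier G" using k g sc by auto
    obtain k' where k': "k' \<in> carrier G" "\<And>i. i \<le> r + 1 \<Longrightarrow> f (F i (k \<otimes> \<rho> s)) = F i k'"
      using Aut_flag[OF f ks] by blast
    define x where "x = inv (g \<otimes> k) \<otimes> k'"
    have xc: "x \<in> carrier G" and k'x: "k' = g \<otimes> k \<otimes> x"
      unfolding x_def using gk k' by (simp_all add: m_assoc[symmetric])
    have "x \<in> stab i" if "i \<in> {1..r} - {s}" for i
    proof -
      have i: "i \<le> r + 1" "s \<noteq> i" using that by auto
      have "F i (g \<otimes> k) = F i k'"
        using F_mult[OF i(1) k(1) gen_in_stab[OF s i(2)]] k'(2)[OF i(1)] k(2) i by simp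
      then show ?thesis using F_eq[OF i(1) i(1) gk k'(1)] unfolding x_def by simp
    qed
    then have "x \<in> par ({1..r} - ({1..r} - {s}))" using par_stab_iff[of "{1..r} - {s}" x] xc by blast
    moreover have "{1..r} - ({1..r} - {s}) = {s}" using s by blast
    ultimately have "x = \<one> \<or> x = \<rho> s" using par_singleton[OF s] by simp
    moreover have "x \<noteq> \<one>"
    proof
      assume "x = \<one>"
      then have "f (F s (k \<otimes> \<rho> s)) = f (F s k)" using k'(2)[of s] k(2) k'x gk s by simp
      then have "F s (k \<otimes> \<rho> s) = F s k"
        using bij F_in_faces[of s] s k ks unfolding bij_betw_def inj_on_def by auto
      then show False
        using F_eq[of s s k "k \<otimes> \<rho> s"] gen_notin_stab[OF s] k(1) sc s by (simp add: m_assoc[symmetric])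
    qed
    ultimately have "k' = g \<otimes> (k \<otimes> \<rho> s)" using k'x g k sc by (simp add: m_assoc)
    then show "\<forall>i\<le>r+1. f (F i (k \<otimes> \<rho> s)) = F i (g \<otimes> (k \<otimes> \<rho> s))" using k'(2) by simp
  qed (use g in auto)
  have "f x = act g x" for x
  proof (cases "x \<in> faces")
    case True
    then obtain i k where "i \<le> r + 1" "k \<in> carrier G" "x = F i k" by (rule faces_cases)
    then show ?thesis using key[of k] par_all act_F[OF g(1)] by simp
  next
    case False
    then show ?thesis using f unfolding Aut_carrier act_def extensional_def by simp
  qed
  then show ?thesis using g(1) by blast
qed

theorem Aut_iso: "Aut \<cong> G"
proof -
  have "act \<in> iso G Aut"
  proof (rule isoI)
    show "act \<in> hom G Aut"
    proof (rule homI)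
      fix g h assume gh: "g \<in> carrier G" "h \<in> carrier G"
      have "act g \<in> Bij faces" "act h \<in> Bij faces"
        using act_Aut gh unfolding Aut_carrier Bij_def by auto
      then have "act g \<otimes>\<^bsub>Aut\<^esub> act h = compose faces (act g) (act h)"
        unfolding polytope_aut_def BijGroup_def by simp
      also have "\<dots> = act (g \<otimes> h)"
      proof
        show "compose faces (act g) (act h) x = act (g \<otimes> h) x" for x
          by (cases "x \<in> faces") (simp_all add: compose_def act_mult gh, simp add: act_def)
      qed
      finally show "act (g \<otimes> h) = act g \<otimes>\<^bsub>Aut\<^esub> act h" by simp
    qed (rule act_Aut)
    have "g = h" if gh: "g \<in> carrier G" "h \<in> carrier G" "act g = act h" for g h
    proof -
      have "inv g \<otimes> h \<in> stab i" if "i \<in> {1..r}" for i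
      proof -
        have "F i g = F i h" using act_F[of g i \<one>] act_F[of h i \<one>] gh that by simp
        then show ?thesis using F_eq[of i i g h] that gh by simp
      qed
      then have "inv g \<otimes> h \<in> par ({1..r} - {1..r})" using par_stab_iff[of "{1..r}"] gh by blast
      then have "inv g \<otimes> h = \<one>" using par_empty by simp
      then show ?thesis using gh by (metis inv_closed inv_equality inv_inv)
    qed
    then show "bij_betw act (carrier G) (carrier Aut)"
      unfolding bij_betw_def inj_on_def using act_Aut Aut_eq_act by blast
  qed
  then show ?thesis using iso_sym unfolding is_iso_def by blast
qed

end

theorem (in string_C_group) regular_polytope:
  "\<exists>(P :: nat set) leq. abstract_regular_polytope P leq r \<and> polytope_aut P leq \<cong> G"
proof -
  have "finite ({..r+1} \<times> Pow (carrier G))" using fin by simp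
  \<comment> \<open>Faces are coded as natural numbers, the type required by the conclusion. The
    index is part of the code because equal cosets occur at different ranks, for instance as the two
    improper faces.\<close>
  then obtain enc :: "nat \<times> 'a set \<Rightarrow> nat" where enc: "inj_on enc ({..r+1} \<times> Pow (carrier G))"
    using finite_imp_inj_to_nat_seg by metis
  define F where "F = (\<lambda>i k. enc (i, k <# stab i))"
  have sub: "subgroup (stab i) G" for i unfolding stab_def by (rule par_subgroup) blast
  interpret string_C_group_faces G \<rho> r F
  proof unfold_locales
    fix i j k h assume ij: "i \<le> r + 1" "j \<le> r + 1" and kh: "k \<in> carrier G" "h \<in> carrier G"
    have pow: "k <# stab i \<in> Pow (carrier G)" if "k \<in> carrier G" for i k
      using l_coset_subset_G subgroup.subset[OF sub] that by blast
    have "F i k = F j h \<longleftrightarrow> i = j \<and> k <# stab i = h <# stab j"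
      unfolding F_def using inj_on_eq_iff[OF enc, of "(i, k <# stab i)" "(j, h <# stab j)"] ij kh pow by auto
    moreover have "k <# stab i = h <# stab i \<longleftrightarrow> inv k \<otimes> h \<in> stab i"
    proof
      assume "k <# stab i = h <# stab i"
      then have "h \<in> k <# stab i" using subgroup.one_closed[OF sub, of i] kh unfolding l_coset_def by force
      then show "inv k \<otimes> h \<in> stab i" using kh stab_closed unfolding l_coset_def
        by (auto simp: m_assoc[symmetric])
    next
      assume a: "inv k \<otimes> h \<in> stab i"
      then have "h \<in> k <# stab i" unfolding l_coset_def using kh
        by (auto intro!: bexI[of _ "inv k \<otimes> h"] simp: m_assoc[symmetric])
      then show "k <# stab i = h <# stab i" using l_repr_independence[OF _ kh(1) sub] by blast
    qed
    ultimately show "F i k = F j h \<longleftrightarrow> i = j \<and> inv k \<otimes> h \<in> stab i" by auto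
  qed
  show ?thesis using face_regular_polytope Aut_iso by blast
qed

section \<open>Reflections in characteristic two\<close>

locale char2_field =
  fixes ty :: "'a::{field,finite} itself"
  assumes two_zero: "(1::'a) + 1 = 0" and card_ge4: "4 \<le> CARD('a)"
begin

lemma two_eq_zero [simp]: "(2::'a) = 0"
  using two_zero by (simp only: one_add_one)

lemma add_self [simp]: "(x::'a) + x = 0"
proof -
  have "x + x = x * (1 + 1)" by (simp add: distrib_left)
  then show ?thesis using two_zero by simp
qed

lemma add_self_left [simp]: "(x::'a) + (x + y) = y"
  by (simp flip: add.assoc)

lemma uminus_self [simp]: "- (x::'a) = x"
  using add_self[of x] by (metis add_eq_0_iff)

lemma add_eq_zero_iff: "(x::'a) + y = 0 \<longleftrightarrow> x = y"
  by (metis add_self add_self_left add.right_neutral)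

lemma vec_two_eq_zero [simp]: "(2::'a^'k) = 0"
  by (simp add: vec_eq_iff)

lemma vec_add_self [simp]: "(x::'a^'k) + x = 0"
  by (simp add: vec_eq_iff)

lemma vec_add_self_left [simp]: "(x::'a^'k) + (x + y) = y"
  by (simp flip: add.assoc)

lemma vec_add_eq_zero_iff: "(x::'a^'k) + y = 0 \<longleftrightarrow> x = y"
  by (metis vec_add_self vec_add_self_left add.right_neutral)

lemma square_add: "((x::'a) + y) * (x + y) = x * x + y * y"
  by (simp add: algebra_simps)

lemma square_inj: "(x::'a) * x = y * y \<Longrightarrow> x = y"
  using square_add[of x y] add_eq_zero_iff by auto

text \<open>Squaring is injective in characteristic 2, hence bijective on a finite field. Square
  roots are therefore unique, and every nonsingular vector can be scaled to a unit vector.\<close>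

definition rt :: "'a \<Rightarrow> 'a"
  where "rt x = (SOME y. y * y = x)"

lemma rt_square [simp]: "rt x * rt x = x"
proof -
  have "inj (\<lambda>y::'a. y * y)" using square_inj by (auto intro: injI)
  then have "surj (\<lambda>y::'a. y * y)" by (rule finite_UNIV_inj_surj[OF finite])
  then have "\<exists>y. y * y = x" by (metis surjD)
  then show ?thesis unfolding rt_def by (rule someI_ex)
qed

lemma rt_unique: "y * y = x \<Longrightarrow> rt x = y"
  using square_inj[of "rt x" y] by simp

lemma rt_eq_0 [simp]: "rt x = 0 \<longleftrightarrow> x = 0"
  by (metis mult_zero_left rt_square mult_eq_0_iff)

lemma avoid:
  assumes "finite S" "card S \<le> 3"
  shows "\<exists>t::'a. t \<notin> S"
proof (rule ccontr)
  assume "\<nexists>t::'a. t \<notin> S"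
  then have "S = UNIV" by blast
  then show False using assms card_ge4 by simp
qed

lemma avoid_roots3:
  fixes a b c x y z :: 'a
  assumes "a \<noteq> 0 \<or> x \<noteq> 0" "b \<noteq> 0 \<or> y \<noteq> 0" "c \<noteq> 0 \<or> z \<noteq> 0"
  shows "\<exists>t. a + t * x \<noteq> 0 \<and> b + t * y \<noteq> 0 \<and> c + t * z \<noteq> 0"
proof -
  \<comment> \<open>If the slope \<open>x\<close> is 0, then \<open>a / x\<close> is 0 and excludes
    one harmless value: the affine function is a nonzero constant.\<close>
  have "card {a / x, b / y, c / z} \<le> 3" by (simp add: card_insert_if)
  then obtain t where t: "t \<notin> {a / x, b / y, c / z}" using avoid[of "{a / x, b / y, c / z}"] by auto
  have "p + t * q \<noteq> 0" if "p \<noteq> 0 \<or> q \<noteq> 0" "t \<noteq> p / q" for p q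
    using that by (cases "q = 0") (auto simp: add_eq_zero_iff)
  then show ?thesis using t assms by blast
qed

end

locale quadratic_space = char2_field ty for ty :: "'a::{field,finite} itself" +
  fixes \<phi> :: "'a^'k \<Rightarrow> 'a" and B :: "'a^'k \<Rightarrow> 'a^'k \<Rightarrow> 'a"
  assumes phi_add: "\<phi> (x + y) = \<phi> x + \<phi> y + B x y"
    and phi_scale: "\<phi> (c *s x) = c * c * \<phi> x"
    and B_add_left: "B (x + y) z = B x z + B y z"
    and B_scale_left: "B (c *s x) y = c * B x y"
begin

lemma B_eq: "B x y = \<phi> (x + y) + \<phi> x + \<phi> y"
  using phi_add[of x y] by (simp add: add_ac)

lemma B_sym: "B x y = B y x"
  by (simp add: B_eq add_ac)

lemma B_add_right: "B x (y + z) = B x y + B x z"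
  using B_add_left B_sym by metis

lemma B_scale_right: "B x (c *s y) = c * B x y"
  using B_scale_left B_sym by metis

lemma phi_zero [simp]: "\<phi> 0 = 0"
  using phi_scale[of 0 0] by simp

lemma B_self [simp]: "B x x = 0"
  by (simp add: B_eq)

lemma B_zero [simp]: "B 0 y = 0" "B x 0 = 0"
  by (simp_all add: B_eq)

lemmas bilin = B_add_left B_add_right B_scale_left B_scale_right

lemma B_lincomb: "finite S \<Longrightarrow> B (\<Sum>i\<in>S. f i *s w i) y = (\<Sum>i\<in>S. f i * B (w i) y)"
  by (induction S rule: finite_induct) (simp_all add: bilin)

text \<open>For \<open>\<phi> u = 1\<close> this is the usual reflection x - (B x u / \<phi> u) u,
  which in characteristic 2 is an orthogonal transvection.\<close>

definition refl :: "'a^'k \<Rightarrow> 'a^'k \<Rightarrow> 'a^'k"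
  where "refl u x = x + B x u *s u"

definition isometries :: "('a^'k \<Rightarrow> 'a^'k) set"
  where "isometries = {g. bij g \<and> (\<forall>x y. g (x + y) = g x + g y) \<and> (\<forall>c x. g (c *s x) = c *s g x) \<and>
    (\<forall>x. \<phi> (g x) = \<phi> x)}"

lemma isometries_B: "g \<in> isometries \<Longrightarrow> B (g x) (g y) = B x y"
  unfolding isometries_def by (auto simp: B_eq) metis

lemma isometriesD:
  assumes "g \<in> isometries"
  shows "g (x + y) = g x + g y" "g (c *s x) = c *s g x" "\<phi> (g x) = \<phi> x" "bij g" "g 0 = 0"
proof -
  show *: "g (x + y) = g x + g y" "g (c *s x) = c *s g x" "\<phi> (g x) = \<phi> x" "bij g"
    using assms unfolding isometries_def by auto
  have "g (0 *s 0) = 0 *s g 0" using assms unfolding isometries_def by blast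
  then show "g 0 = 0" by simp
qed

lemma isometries_comp: "g \<in> isometries \<Longrightarrow> h \<in> isometries \<Longrightarrow> g \<circ> h \<in> isometries"
  unfolding isometries_def by (auto intro: bij_comp)

lemma id_isometry: "id \<in> isometries"
  unfolding isometries_def by auto

lemma refl_invol:
  assumes "\<phi> u = 1" shows "refl u (refl u x) = x"
  unfolding refl_def by (simp add: bilin vector_add_ldistrib add.assoc)

lemma phi_refl:
  assumes "\<phi> u = 1" shows "\<phi> (refl u x) = \<phi> x"
  unfolding refl_def using assms by (simp add: phi_add phi_scale bilin add.assoc)

lemma refl_add: "refl u (x + y) = refl u x + refl u y"
  unfolding refl_def by (simp add: bilin vec.scale_left_distrib add_ac)

lemma refl_scale: "refl u (c *s x) = c *s refl u x"
  unfolding refl_def by (simp add: bilin vector_add_ldistrib vector_smult_assoc)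

lemma refl_isometry: "\<phi> u = 1 \<Longrightarrow> refl u \<in> isometries"
proof -
  assume u: "\<phi> u = 1"
  have "bij (refl u)" by (rule o_bij[of "refl u"]) (auto simp: refl_invol[OF u])
  then show ?thesis unfolding isometries_def using refl_add refl_scale phi_refl[OF u] by blast
qed

lemma B_refl: "\<phi> u = 1 \<Longrightarrow> B (refl u x) (refl u y) = B x y"
  using isometries_B refl_isometry by blast

text \<open>Words in reflections, extended on the left. Reflections in unit vectors are involutions,
  so no inverses are listed; \<open>grp_left_inverse\<close> recovers them.\<close>

inductive_set grp :: "('a^'k) set \<Rightarrow> ('a^'k \<Rightarrow> 'a^'k) set" for U
  where
    grp_id: "id \<in> grp U"
  | grp_step: "g \<in> grp U \<Longrightarrow> u \<in> U \<Longrightarrow> refl u \<circ> g \<in> grp U"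

lemma grp_comp: "g \<in> grp U \<Longrightarrow> h \<in> grp U \<Longrightarrow> g \<circ> h \<in> grp U"
  by (induction g rule: grp.induct) (auto simp: comp_assoc intro: grp.intros)

lemma refl_in_grp: "u \<in> U \<Longrightarrow> refl u \<in> grp U"
  using grp_step[OF grp_id, of u U] by simp

lemma grp_subset:
  assumes "\<And>u. u \<in> U \<Longrightarrow> refl u \<in> grp U'"
  shows "grp U \<subseteq> grp U'"
proof
  fix g assume "g \<in> grp U"
  then show "g \<in> grp U'"
  proof (induction rule: grp.induct)
    case grp_id show ?case by (rule grp.grp_id)
  next
    case (grp_step g u) then show ?case using grp_comp assms by blast
  qed
qed

lemma grp_mono: "U \<subseteq> U' \<Longrightarrow> grp U \<subseteq> grp U'"
  by (rule grp_subset) (auto intro: refl_in_grp)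

lemma grp_isometries:
  assumes "\<And>u. u \<in> U \<Longrightarrow> \<phi> u = 1" and "g \<in> grp U"
  shows "g \<in> isometries"
  using assms(2)
proof (induction rule: grp.induct)
  case grp_id show ?case by (rule id_isometry)
next
  case (grp_step g u) then show ?case using isometries_comp refl_isometry assms(1) by blast
qed

lemma grp_left_inverse:
  assumes "\<And>u. u \<in> U \<Longrightarrow> \<phi> u = 1" "g \<in> grp U"
  shows "\<exists>h\<in>grp U. h \<circ> g = id \<and> g \<circ> h = id"
  using assms(2)
proof (induction g rule: grp.induct)
  case grp_id
  then show ?case using grp.grp_id by (intro bexI[of _ id]) auto
next
  case (grp_step g u)
  then obtain h where h: "h \<in> grp U" "h \<circ> g = id" "g \<circ> h = id" by blast
  have uu: "refl u \<circ> refl u = id" using refl_invol assms(1) grp_step by fastforce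
  show ?case
  proof (intro bexI conjI)
    show "h \<circ> refl u \<in> grp U" using grp_comp[OF h(1) refl_in_grp[OF grp_step(2)]] .
    have "(h \<circ> refl u) \<circ> (refl u \<circ> g) = h \<circ> (refl u \<circ> refl u) \<circ> g" by (simp only: comp_assoc)
    then show "(h \<circ> refl u) \<circ> (refl u \<circ> g) = id" using uu h by simp
    have "(refl u \<circ> g) \<circ> (h \<circ> refl u) = refl u \<circ> (g \<circ> h) \<circ> refl u" by (simp only: comp_assoc)
    then show "(refl u \<circ> g) \<circ> (h \<circ> refl u) = id" using uu h by simp
  qed
qed

definition units :: "('a^'k) set \<Rightarrow> ('a^'k) set"
  where "units W = {u \<in> W. \<phi> u = 1}"

definition refl_closed :: "('a^'k) set \<Rightarrow> bool"
  where "refl_closed R \<longleftrightarrow> (\<forall>u\<in>R. \<forall>v\<in>R. refl u v \<in> R)"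

text \<open>Since \<open>refl (refl u v)\<close> is a conjugate of \<open>refl v\<close>, \<open>roots U\<close> is closed under its own reflections.\<close>
definition roots :: "('a^'k) set \<Rightarrow> ('a^'k) set"
  where "roots U = {u. \<phi> u = 1 \<and> refl u \<in> grp U}"

lemma refl_refl:
  assumes "\<phi> u = 1" shows "refl (refl u v) = refl u \<circ> refl v \<circ> refl u"
proof
  fix x
  have "B x (refl u v) = B (refl u x) v"
    using B_refl[OF assms, of "refl u x" v] refl_invol[OF assms] by simp
  then have "refl (refl u v) x = x + B (refl u x) v *s refl u v" by (simp add: refl_def)
  also have "\<dots> = refl u (refl v (refl u x))"
    using refl_invol[OF assms] by (simp add: refl_def[of v] refl_add refl_scale)
  finally show "refl (refl u v) x = (refl u \<circ> refl v \<circ> refl u) x" by simp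
qed

lemma refl_closed_roots: "refl_closed (roots U)"
  unfolding refl_closed_def roots_def
  using refl_refl phi_refl grp_comp by auto

lemma roots_superset: "(\<And>u. u \<in> U \<Longrightarrow> \<phi> u = 1) \<Longrightarrow> U \<subseteq> roots U"
  unfolding roots_def using refl_in_grp by auto

text \<open>The vectors \<open>u + a *s z\<close> are pairwise orthogonal, so composing their
  reflections adds up the terms \<open>B x (u + a *s z) *s (u + a *s z)\<close>. For a = 1, l, 1 + l
  both the sum of the a and the sum of their squares vanish, and only three copies of the term of
  \<open>u\<close> remain, that is, one.\<close>

lemma orthogonal_triple:
  assumes "\<phi> u = 1" "\<phi> z = 0" "B u z = 0"
    and "u + z \<in> roots U" "u + l *s z \<in> roots U" "u + (1 + l) *s z \<in> roots U"
  shows "u \<in> roots U"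
proof -
  have "refl u = refl (u + z) \<circ> refl (u + l *s z) \<circ> refl (u + (1 + l) *s z)"
  proof
    fix x
    have o: "B (u + a *s z) (u + b *s z) = 0" for a b
      using assms(3) B_sym[of z u] by (simp add: bilin)
    have three: "refl p (refl q (refl w x)) = x + B x p *s p + B x q *s q + B x w *s w"
      if "B p q = 0" "B w q = 0" "B w p = 0" for p q w
      using that B_sym by (simp add: refl_def bilin add_ac)
    have "refl (u + 1 *s z) (refl (u + l *s z) (refl (u + (1 + l) *s z) x))
        = x + B x (u + 1 *s z) *s (u + 1 *s z) + B x (u + l *s z) *s (u + l *s z)
          + B x (u + (1 + l) *s z) *s (u + (1 + l) *s z)"
      by (rule three) (rule o)+
    also have "\<dots> = refl u x"
      unfolding refl_def vec_eq_iff by (simp add: bilin algebra_simps)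
    finally show "refl u x = (refl (u + z) \<circ> refl (u + l *s z) \<circ> refl (u + (1 + l) *s z)) x"
      by simp
  qed
  then show ?thesis using assms unfolding roots_def by (auto intro!: grp_comp)
qed

end

section \<open>Counting in the field and Lucas coordinates in a plane\<close>

context char2_field
begin

lemma quadratic_fibre:
  fixes b :: 'a
  shows "card {t. t * t + b * t = c} \<le> 2"
proof (cases "\<exists>t0. t0 * t0 + b * t0 = c")
  case True
  then obtain t0 where t0: "t0 * t0 + b * t0 = c" by blast
  have "{t. t * t + b * t = c} \<subseteq> {t0, t0 + b}"
  proof
    fix t assume "t \<in> {t. t * t + b * t = c}"
    then have "(t * t + b * t) + (t0 * t0 + b * t0) = 0" using t0 by simp
    then have "(t + t0) * (t + (t0 + b)) = 0" by (simp add: algebra_simps)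
    then have "t = t0 \<or> t = t0 + b" by (auto simp: add_eq_zero_iff)
    then show "t \<in> {t0, t0 + b}" by blast
  qed
  then have "card {t. t * t + b * t = c} \<le> card {t0, t0 + b}" by (intro card_mono) auto
  also have "\<dots> \<le> 2" by (simp add: card_insert_if)
  finally show ?thesis .
qed simp

text \<open>\<open>H\<close> and the set of all \<open>c / h\<close> have at least half as many
  elements as the field each, but avoid 0, so they meet.\<close>

lemma product_of_two:
  fixes H :: "'a set"
  assumes "0 \<notin> H" "CARD('a) \<le> 2 * card H" "c \<noteq> 0"
  shows "\<exists>h\<in>H. \<exists>h'\<in>H. c = h * h'"
proof (rule ccontr)
  assume no: "\<not> (\<exists>h\<in>H. \<exists>h'\<in>H. c = h * h')"
  let ?K = "(\<lambda>h. c / h) ` H"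
  have inj: "inj_on (\<lambda>h. c / h) H" using assms by (intro inj_onI) (auto simp: field_simps)
  have "H \<inter> ?K = {}"
  proof (rule ccontr)
    assume "H \<inter> ?K \<noteq> {}"
    then obtain h where h: "h \<in> H" "c / h \<in> H" by auto
    then have "c = h * (c / h)" using assms(1) by auto
    then show False using no h by blast
  qed
  then have "card (H \<union> ?K) = 2 * card H" using card_image[OF inj] by (subst card_Un_disjoint) auto
  moreover have "H \<union> ?K \<subseteq> UNIV - {0}" using assms by auto
  then have "card (H \<union> ?K) \<le> card (UNIV - {0::'a})" by (intro card_mono) auto
  moreover have "card (UNIV - {0::'a}) = CARD('a) - 1" by (simp add: card_Diff_singleton)
  ultimately show False using assms(2) card_ge4 by linarith
qed

lemma card_le_fibres:
  fixes f :: "'a \<Rightarrow> 'b"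
  assumes "\<And>y. card {x. f x = y} \<le> 2"
  shows "CARD('a) \<le> 2 * card (range f)"
proof -
  have "UNIV = (\<Union>y\<in>range f. {x. f x = y})" by auto
  then have "CARD('a) \<le> (\<Sum>y\<in>range f. card {x. f x = y})" by (metis card_UN_le finite finite_imageI)
  also have "\<dots> \<le> (\<Sum>y\<in>range f. 2)" by (rule sum_mono) (rule assms)
  finally show ?thesis by simp
qed

text \<open>
  If \<open>w1\<close>, \<open>w2\<close> are unit vectors with product \<open>b\<close>, then \<open>lucas b i\<close> are the coordinates of the \<open>i\<close>-th vector
  obtained from \<open>w1\<close>, \<open>w2\<close> by repeatedly reflecting the previous vector in the current one.
\<close>
fun lucas :: "'a \<Rightarrow> nat \<Rightarrow> 'a \<times> 'a"
  where
    "lucas b 0 = (1, 0)"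
  | "lucas b (Suc 0) = (0, 1)"
  | "lucas b (Suc (Suc i)) =
      (fst (lucas b i) + b * fst (lucas b (Suc i)), snd (lucas b i) + b * snd (lucas b (Suc i)))"

text \<open>x^2 + b x y + y^2 is the form of a plane in the coordinates given by two unit vectors
  with product b. The condition says that alternate reflections in them reach all unit vectors of
  the plane.\<close>

definition full_rotation :: "'a \<Rightarrow> bool"
  where "full_rotation b \<longleftrightarrow> (\<forall>x y. x * x + b * x * y + y * y = 1 \<longrightarrow> (\<exists>i. (x, y) = lucas b i))"

definition anisotropic :: "'a \<Rightarrow> bool"
  where "anisotropic b \<longleftrightarrow> (\<forall>x y. x * x + b * x * y + y * y = 0 \<longrightarrow> x = 0 \<and> y = 0)"

end

section \<open>Unit vectors in sets closed under reflection\<close>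

context quadratic_space
begin

lemma scaled_unit: "\<phi> x \<noteq> 0 \<Longrightarrow> \<phi> ((1 / rt (\<phi> x)) *s x) = 1"
  by (simp add: phi_scale)

lemma refl_scaled: "refl ((1 / rt (\<phi> x)) *s x) v = v + (B v x / \<phi> x) *s x"
  unfolding refl_def by (simp add: bilin vector_smult_assoc)

lemma refl_closed_scaled:
  assumes "refl_closed R" "units W \<subseteq> R" "vec.subspace W" "x \<in> W" "\<phi> x \<noteq> 0" "v \<in> R"
  shows "v + (B v x / \<phi> x) *s x \<in> R"
proof -
  have "(1 / rt (\<phi> x)) *s x \<in> units W"
    unfolding units_def using scaled_unit assms vec.subspace_scale by blast
  then show ?thesis using assms(1,2,6) refl_scaled unfolding refl_closed_def by (metis subsetD)
qed

lemma phi_scaled_refl: "\<phi> x \<noteq> 0 \<Longrightarrow> \<phi> (v + (B v x / \<phi> x) *s x) = \<phi> v"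
  using phi_refl[OF scaled_unit] refl_scaled by metis

text \<open>One of \<open>w1\<close>, \<open>w2\<close>, \<open>w1 + w2\<close> lies off both
  hyperplanes. If that vector \<open>w\<close> is singular, then \<open>\<phi> (r + t *s w)\<close>
  is affine in \<open>t\<close>, as are the two products, and \<open>avoid_roots3\<close> chooses
  \<open>t\<close>.\<close>

lemma avoid_hyperplanes:
  assumes W: "vec.subspace W" and r: "r \<in> W" "\<phi> r \<noteq> 0"
    and w1: "w1 \<in> W" "B a w1 \<noteq> 0" and w2: "w2 \<in> W" "B b w2 \<noteq> 0"
  shows "\<exists>u\<in>W. \<phi> u \<noteq> 0 \<and> B a u \<noteq> 0 \<and> B b u \<noteq> 0"
proof -
  have "\<exists>w\<in>W. B a w \<noteq> 0 \<and> B b w \<noteq> 0"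
  proof (cases "B b w1 = 0 \<and> B a w2 = 0")
    case True
    then show ?thesis using w1 w2 vec.subspace_add[OF W]
      by (intro bexI[of _ "w1 + w2"]) (auto simp: bilin)
  next
    case False then show ?thesis using w1 w2 by blast
  qed
  then obtain w where w: "w \<in> W" "B a w \<noteq> 0" "B b w \<noteq> 0" by blast
  show ?thesis
  proof (cases "\<phi> w = 0")
    case False then show ?thesis using w by blast
  next
    case True
    obtain t where t': "\<phi> r + t * B r w \<noteq> 0" "B a r + t * B a w \<noteq> 0" "B b r + t * B b w \<noteq> 0"
      using avoid_roots3[of "\<phi> r" "B r w" "B a r" "B a w" "B b r" "B b w"] r w by blast
    show ?thesis
    proof (intro bexI conjI)
      show "r + t *s w \<in> W" using r w W by (simp add: vec.subspace_add vec.subspace_scale)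
      show "\<phi> (r + t *s w) \<noteq> 0" using t'(1) True by (simp add: phi_add phi_scale bilin)
      show "B a (r + t *s w) \<noteq> 0" "B b (r + t *s w) \<noteq> 0" using t'(2,3) by (simp_all add: bilin)
    qed
  qed
qed

text \<open>\<open>u + v\<close> has norm \<open>B v u\<close>. If this is nonzero, the reflection
  in \<open>u + v\<close> takes \<open>v\<close> to \<open>u\<close>; if not, \<open>v\<close> is
  first reflected in a vector of \<open>W\<close> orthogonal to neither, after which the product is
  nonzero.\<close>

lemma transitive_mod_subspace:
  assumes R: "refl_closed R" "units W \<subseteq> R" and W: "vec.subspace W" and r: "r \<in> W" "\<phi> r \<noteq> 0"
    and u: "\<phi> u = 1" "w1 \<in> W" "B u w1 \<noteq> 0" and v: "v \<in> R" "\<phi> v = 1" "w2 \<in> W" "B v w2 \<noteq> 0"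
    and uv: "u + v \<in> W"
  shows "u \<in> R"
proof -
  have direct: "u \<in> R" if v: "v \<in> R" "\<phi> v = 1" "u + v \<in> W" "B v u \<noteq> 0" for v
  proof -
    have p: "\<phi> (u + v) = B v u" using u(1) v(2) B_sym by (simp add: phi_add)
    then have "v + (B v (u + v) / \<phi> (u + v)) *s (u + v) \<in> R"
      using refl_closed_scaled[OF R W v(3) _ v(1)] v(4) by simp
    moreover have "v + (B v (u + v) / \<phi> (u + v)) *s (u + v) = u"
      using v(4) unfolding p by (simp add: bilin add.commute[of u v])
    ultimately show ?thesis by simp
  qed
  show ?thesis
  proof (cases "B v u = 0")
    case False then show ?thesis using direct v(1,2) uv by blast
  next
    case True
    obtain x where x: "x \<in> W" "\<phi> x \<noteq> 0" "B v x \<noteq> 0" "B u x \<noteq> 0"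
      using avoid_hyperplanes[OF W r v(3,4) u(2,3)] by blast
    let ?v = "v + (B v x / \<phi> x) *s x"
    show ?thesis
    proof (rule direct)
      show "?v \<in> R" using refl_closed_scaled[OF R W x(1,2) v(1)] .
      show "\<phi> ?v = 1" using phi_scaled_refl[OF x(2)] v(2) by simp
      show "u + ?v \<in> W"
        using vec.subspace_add[OF W uv vec.subspace_scale[OF W x(1)]] by (simp add: add.assoc)
      show "B ?v u \<noteq> 0" using x True B_sym[of x u] by (simp add: bilin)
    qed
  qed
qed

text \<open>
  Each value \<open>c\<close> of the coordinate at \<open>v\<close> is attained by some \<open>refl v x\<close> with \<open>x\<close> a unit vector of \<open>W\<close>; up to
  reflections in \<open>W\<close> only this coordinate matters.
\<close>
lemma units_hyperplane_step:
  assumes R: "refl_closed R" "units W \<subseteq> R" and W: "vec.subspace W"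
    and v: "v \<in> R" "\<phi> v = 1"
    and y: "y \<in> W" "\<phi> y = 1" "B v y \<noteq> 0" and z: "z \<in> W" "\<phi> z = 1" "B y z = 0" "B v z = 0"
    and u: "w \<in> W" "u = w + c *s v" "\<phi> u = 1" "p \<in> W" "B u p \<noteq> 0"
  shows "u \<in> R"
proof (cases "c = 0")
  case True
  then have "u \<in> units W" using u unfolding units_def by simp
  then show ?thesis using R by blast
next
  case False
  \<comment> \<open>\<open>d\<close> is chosen so that \<open>B x v = c\<close>. The coefficient
    \<open>1 + d\<close> of the orthogonal unit vector \<open>z\<close> restores norm 1, since d^2 +
    (1 + d)^2 = 1.\<close>
  define d where "d = c / B v y"
  define x where "x = d *s y + (1 + d) *s z"
  have xW: "x \<in> W" unfolding x_def using W y z by (simp add: vec.subspace_add vec.subspace_scale)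
  have "\<phi> x = 1" unfolding x_def using y z B_sym[of z y] by (simp add: phi_add phi_scale bilin square_add add.assoc algebra_simps)
  then have xR: "x \<in> R" using xW R(2) unfolding units_def by blast
  have xv: "B x v = c" unfolding x_def d_def using y z B_sym[of y v] B_sym[of z v] by (simp add: bilin)
  have "refl v x \<in> R" using R(1) v xR unfolding refl_closed_def by blast
  then have u0: "x + c *s v \<in> R" unfolding refl_def xv .
  have phi0: "\<phi> (x + c *s v) = 1" using phi_refl[OF v(2), of x] \<open>\<phi> x = 1\<close> unfolding refl_def xv by simp
  have "B (x + c *s v) y = c * B v y" unfolding x_def using z B_sym[of z y] by (simp add: bilin)
  then have By: "B (x + c *s v) y \<noteq> 0" using False y by simp
  have sum: "u + (x + c *s v) = w + x" unfolding u(2) by (simp add: add_ac)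
  then have "u + (x + c *s v) \<in> W" using vec.subspace_add[OF W u(1) xW] by (simp only: sum)
  moreover have "\<phi> y \<noteq> 0" using y by simp
  ultimately show ?thesis
    using transitive_mod_subspace[OF R W y(1) _ u(3,4,5) u0 phi0 y(1) By] by blast
qed

text \<open>Subtracting a multiple of \<open>u\<close> makes \<open>p\<close> singular without
  destroying its product with \<open>q\<close>. The resulting \<open>z\<close> is orthogonal to
  \<open>u\<close>, while the \<open>u + a *s z\<close> with a \<noteq> 0 pair with \<open>q\<close>
  and so are roots; three of them yield \<open>u\<close> by
  \<open>orthogonal_triple\<close>.\<close>

lemma units_orthogonal_step:
  assumes U: "\<And>u p. u \<in> W' \<Longrightarrow> \<phi> u = 1 \<Longrightarrow> p \<in> W \<Longrightarrow> B u p \<noteq> 0 \<Longrightarrow> u \<in> roots U"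
    and W': "vec.subspace W'" "W \<subseteq> W'" and pq: "p \<in> W" "q \<in> W" "B p q \<noteq> 0"
    and u: "u \<in> W'" "\<phi> u = 1" "\<And>w. w \<in> W \<Longrightarrow> B u w = 0"
  shows "u \<in> roots U"
proof -
  obtain l :: 'a where l: "l \<notin> {0, 1}" using avoid[of "{0, 1}"] by auto
  then have l': "1 + l \<noteq> 0" by (auto simp: add_eq_zero_iff)
  define z where "z = p + rt (\<phi> p) *s u"
  have z: "\<phi> z = 0" "B u z = 0"
    unfolding z_def using u pq B_sym[of p u] by (simp_all add: phi_add phi_scale bilin)
  have "u + a *s z \<in> roots U" if a: "a \<noteq> 0" for a
  proof (rule U)
    show "u + a *s z \<in> W'" unfolding z_def using u W' pq
      by (auto intro!: vec.subspace_add vec.subspace_scale)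
    show "\<phi> (u + a *s z) = 1" using u z by (simp add: phi_add phi_scale bilin)
    show "B (u + a *s z) q \<noteq> 0" unfolding z_def using a u(3) pq by (simp add: bilin)
    show "q \<in> W" by (rule pq)
  qed
  from this[of 1] this[of l] this[of "1 + l"] show ?thesis
    using orthogonal_triple[OF u(2) z, of U l] l l' by simp
qed

text \<open>Read with coefficients on \<open>w1\<close>, \<open>w2\<close>, the Lucas recurrence is
  a reflection of one vector in the next. All these vectors remain in \<open>R\<close>, and full
  rotation says that \<open>u\<close> is among them.\<close>

lemma units_plane:
  assumes R: "refl_closed R" and w: "w1 \<in> R" "w2 \<in> R" "\<phi> w1 = 1" "\<phi> w2 = 1"
    and full: "full_rotation (B w1 w2)" and u: "u = x *s w1 + y *s w2" "\<phi> u = 1"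
  shows "u \<in> R"
proof -
  let ?b = "B w1 w2"
  let ?v = "\<lambda>i. fst (lucas ?b i) *s w1 + snd (lucas ?b i) *s w2"
  have rec: "?v (Suc (Suc i)) = ?v i + ?b *s ?v (Suc i)" for i
    by (simp add: vec_eq_iff algebra_simps)
  have "\<phi> (?v i) = 1 \<and> \<phi> (?v (Suc i)) = 1 \<and> B (?v i) (?v (Suc i)) = ?b \<and> ?v i \<in> R \<and> ?v (Suc i) \<in> R" for i
  proof (induction i)
    case 0 then show ?case using w by simp
  next
    case (Suc i)
    have r: "?v (Suc (Suc i)) = refl (?v (Suc i)) (?v i)"
      unfolding rec refl_def using Suc by simp
    have "?v (Suc (Suc i)) \<in> R" unfolding r using R Suc unfolding refl_closed_def by blast
    moreover have "\<phi> (?v (Suc (Suc i))) = 1" unfolding r using phi_refl Suc by simp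
    moreover have "B (?v (Suc i)) (?v (Suc (Suc i))) = ?b"
      unfolding rec using Suc B_sym[of "?v i" "?v (Suc i)"] by (simp only: bilin B_self) simp
    ultimately show ?case using Suc by blast
  qed
  then have vR: "?v i \<in> R" for i by blast
  have "x * x + ?b * x * y + y * y = 1"
    using u w by (simp add: phi_add phi_scale bilin algebra_simps)
  then obtain i where "(x, y) = lucas ?b i" using full unfolding full_rotation_def by blast
  then have "u = ?v i" unfolding u(1) by (metis fst_conv snd_conv)
  then show ?thesis using vR by simp
qed

text \<open>
  Let \<open>r\<close> span the radical of the three-dimensional span. Unit vectors outside it are the
  \<open>\<nu> *s x + ((1 + \<nu>) / s) *s r\<close> with \<open>x\<close> a unit vector of the plane and \<open>\<nu> \<noteq> 0\<close>. The set \<open>M\<close> of those \<open>\<nu>\<close> that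
  occur in \<open>R\<close> is closed under multiplication by a set \<open>H\<close> containing at least half of the field, so it
  contains every nonzero \<open>\<nu>\<close>, each being a product of two elements of \<open>H\<close>.
\<close>
lemma units_plane_step:
  assumes R: "refl_closed R" and w: "w1 \<in> R" "w2 \<in> R" "\<phi> w1 = 1" "\<phi> w2 = 1"
    and full: "full_rotation (B w1 w2)" and anis: "anisotropic (B w1 w2)"
    and v: "v \<in> R" "\<phi> v = 1" "B v w1 = 0" "B v w2 \<noteq> 0" "B v w2 \<noteq> B w1 w2"
    and u: "u = x *s w1 + y *s w2 + c *s v" "\<phi> u = 1"
    and p: "p = x' *s w1 + y' *s w2" "B u p \<noteq> 0"
  shows "u \<in> R"
proof -
  define b where "b = B w1 w2"
  have b0: "b \<noteq> 0"
  proof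
    assume "b = 0"
    then show False using anis[unfolded anisotropic_def, rule_format, of 1 1] unfolding b_def by simp
  qed
  define W where "W = {x *s w1 + y *s w2 |x y. True}"
  have W: "vec.subspace W"
    unfolding vec.subspace_def
  proof (intro conjI ballI allI)
    have "0 = 0 *s w1 + 0 *s w2" by simp
    then show "0 \<in> W" unfolding W_def by blast
  next
    fix p q assume "p \<in> W" "q \<in> W"
    then obtain a b a' b' where "p = a *s w1 + b *s w2" "q = a' *s w1 + b' *s w2" unfolding W_def by blast
    then have "p + q = (a + a') *s w1 + (b + b') *s w2" by (simp add: vec_eq_iff algebra_simps)
    then show "p + q \<in> W" unfolding W_def by blast
  next
    fix c p assume "p \<in> W"
    then obtain a b where "p = a *s w1 + b *s w2" unfolding W_def by blast
    then have "c *s p = (c * a) *s w1 + (c * b) *s w2" by (simp add: vec_eq_iff algebra_simps)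
    then show "c *s p \<in> W" unfolding W_def by blast
  qed
  have w1W: "w1 \<in> W" unfolding W_def by (rule CollectI, rule exI[of _ 1], rule exI[of _ 0]) simp
  have w2W: "w2 \<in> W" unfolding W_def by (rule CollectI, rule exI[of _ 0], rule exI[of _ 1]) simp
  have phiW: "\<phi> (x *s w1 + y *s w2) = x * x + b * x * y + y * y" for x y
    unfolding b_def using w by (simp add: phi_add phi_scale bilin algebra_simps)
  have anisW: "w = 0" if "w \<in> W" "\<phi> w = 0" for w
  proof -
    obtain x y where xy: "w = x *s w1 + y *s w2" using \<open>w \<in> W\<close> unfolding W_def by blast
    then have "x = 0 \<and> y = 0"
      using anis[unfolded anisotropic_def] phiW \<open>\<phi> w = 0\<close> unfolding b_def by metis
    then show ?thesis using xy by simp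
  qed
  have UW: "units W \<subseteq> R"
    unfolding units_def W_def using units_plane[OF R w full] by blast
  \<comment> \<open>This factor makes \<open>r = v + k *s w1\<close> orthogonal to \<open>w2\<close>
    as well as to \<open>w1\<close>. Its norm is the square of \<open>s = 1 + k\<close>, nonzero
    because the weights of \<open>v\<close> and \<open>w1\<close> at \<open>w2\<close>
    differ.\<close>
  define k where "k = B v w2 / b"
  have k: "k \<noteq> 0" "k \<noteq> 1" unfolding k_def b_def using v b0[unfolded b_def] by auto
  define s where "s = 1 + k"
  have s0: "s \<noteq> 0" unfolding s_def using k by (auto simp: add_eq_zero_iff)
  define r where "r = v + k *s w1"
  have "\<phi> r = 1 + k * k" unfolding r_def using v w by (simp add: phi_add phi_scale bilin)
  then have phir: "\<phi> r = s * s" unfolding s_def by (simp add: square_add)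
  have "B r w1 = 0" "B r w2 = 0" unfolding r_def k_def using v b0 by (simp_all add: bilin b_def)
  then have rW: "B r w = 0" if "w \<in> W" for w using that unfolding W_def by (auto simp: bilin)
  have Wr: "B w r = 0" if "w \<in> W" for w using rW[OF that] B_sym by metis
  \<comment> \<open>The coefficient of \<open>r\<close> gives norm 1, as \<nu>^2 + (1 + \<nu>)^2 =
    1.\<close>
  define el where "el = (\<lambda>\<nu> x. \<nu> *s x + ((1 + \<nu>) / s) *s r)"
  \<comment> \<open>The reflection in \<open>x + x0\<close> exchanges the two plane parts and fixes
    \<open>r\<close>; anisotropy makes it available whenever \<open>x \<noteq> x0\<close>.\<close>
  have el_move: "el \<nu> x \<in> R" if x0: "x0 \<in> units W" and x: "x \<in> units W" and e: "el \<nu> x0 \<in> R" for \<nu> x0 x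
  proof (cases "x = x0")
    case True then show ?thesis using e by simp
  next
    case False
    have xW: "x \<in> W" "x0 \<in> W" "\<phi> x = 1" "\<phi> x0 = 1" using x x0 unfolding units_def by auto
    have yW: "x + x0 \<in> W" using vec.subspace_add[OF W] xW by blast
    have py: "\<phi> (x + x0) = B x0 x" using xW B_sym by (simp add: phi_add)
    have "x + x0 \<noteq> 0" using False by (simp add: vec_add_eq_zero_iff)
    then have py0: "\<phi> (x + x0) \<noteq> 0" using anisW[OF yW] by blast
    have "el \<nu> x0 + (B (el \<nu> x0) (x + x0) / \<phi> (x + x0)) *s (x + x0) \<in> R"
      by (rule refl_closed_scaled[OF R UW W yW py0 e])
    moreover have "B (el \<nu> x0) (x + x0) = \<nu> * \<phi> (x + x0)"
      unfolding el_def py using rW[OF xW(1)] rW[OF xW(2)] by (simp add: bilin)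
    then have "B (el \<nu> x0) (x + x0) / \<phi> (x + x0) = \<nu>" using py0 by simp
    moreover have "el \<nu> x0 + \<nu> *s (x + x0) = el \<nu> x"
      unfolding el_def by (simp add: vec_eq_iff algebra_simps)
    ultimately show ?thesis by simp
  qed
  define M where "M = {\<nu>. \<nu> \<noteq> 0 \<and> (\<forall>x\<in>units W. el \<nu> x \<in> R)}"
  have MI: "\<nu> \<in> M" if "\<nu> \<noteq> 0" "x0 \<in> units W" "el \<nu> x0 \<in> R" for \<nu> x0
    using that el_move unfolding M_def by blast
  have w1u: "w1 \<in> units W" unfolding units_def using w1W w by simp
  have M1: "1 \<in> M"
  proof (rule MI[OF _ w1u])
    show "el 1 w1 \<in> R" unfolding el_def using w by simp
  qed simp
  \<comment> \<open>\<open>v\<close> itself is \<open>el k w1\<close>, the element outside the plane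
    from which the others are produced.\<close>
  have Mk: "k \<in> M"
  proof (rule MI[OF k(1) w1u])
    have "(1 + k) / s = 1" unfolding s_def[symmetric] using s0 by simp
    then have "el k w1 = v" unfolding el_def r_def by (simp add: vec_eq_iff algebra_simps)
    then show "el k w1 \<in> R" using v by simp
  qed
  \<comment> \<open>Reflecting \<open>el \<nu> y\<close> in \<open>el k x\<close> with
    \<open>B y x = l\<close> turns \<open>\<nu>\<close> into \<open>\<nu> * (1 + l * f)\<close>;
    \<open>f\<close> is read off from the norm of the plane part \<open>w''\<close>.\<close>
  define f where "f = k * (1 + k)"
  have f0: "f \<noteq> 0" unfolding f_def using k by (auto simp: add_eq_zero_iff)
  have step: "\<nu> * (1 + l * f) \<noteq> 0 \<and> \<nu> * (1 + l * f) \<in> M"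
    if \<nu>: "\<nu> \<in> M" and xy: "x \<in> units W" "y \<in> units W" and l: "l = B y x" for \<nu> l x y
  proof -
    have xW: "x \<in> W" "y \<in> W" "\<phi> x = 1" "\<phi> y = 1" using xy unfolding units_def by auto
    have \<nu>0: "\<nu> \<noteq> 0" and PQ: "el \<nu> y \<in> R" "el k x \<in> R" using \<nu> Mk xy unfolding M_def by auto
    have phik: "\<phi> (el k x) = 1"
      unfolding el_def using xW Wr[OF xW(1)] s0 phir
      by (simp add: phi_add phi_scale bilin square_add)
    have BPQ: "B (el \<nu> y) (el k x) = \<nu> * k * l + ((1 + \<nu>) / s) * ((1 + k) / s) * B r r"
      unfolding el_def using rW[OF xW(1)] Wr[OF xW(2)] l by (simp add: bilin)
    then have BPQ: "B (el \<nu> y) (el k x) = \<nu> * k * l" by simp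
    define w'' where "w'' = \<nu> *s y + (\<nu> * k * k * l) *s x"
    have w''W: "w'' \<in> W" unfolding w''_def using W xW by (simp add: vec.subspace_add vec.subspace_scale)
    define n where "n = \<nu> * (1 + l * f)"
    have phin: "\<phi> w'' = n * n"
      unfolding w''_def n_def f_def using xW l
      by (simp add: phi_add phi_scale bilin algebra_simps)
    have "w'' \<noteq> 0"
    proof
      assume "w'' = 0"
      then have "B w'' x = 0" by simp
      then have "l = 0" unfolding w''_def using \<nu>0 l by (simp add: bilin)
      then show False using \<open>w'' = 0\<close> xW(4) \<nu>0 unfolding w''_def by auto
    qed
    then have n0: "n \<noteq> 0" using anisW[OF w''W] phin by auto
    have "refl (el k x) (el \<nu> y) \<in> R" using R PQ unfolding refl_closed_def by blast
    moreover have "refl (el k x) (el \<nu> y) = el n ((1 / n) *s w'')"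
    proof -
      have "n * (1 / n) = 1" using n0 by simp
      moreover have "(1 + n) / s = (1 + \<nu>) / s + \<nu> * k * l * ((1 + k) / s)"
        unfolding n_def f_def by (simp add: add_divide_distrib[symmetric] algebra_simps)
      ultimately have "el n ((1 / n) *s w'') = w'' + ((1 + \<nu>) / s + \<nu> * k * l * ((1 + k) / s)) *s r"
        unfolding el_def vector_smult_assoc by simp
      moreover have "refl (el k x) (el \<nu> y) = el \<nu> y + (\<nu> * k * l) *s el k x"
        unfolding refl_def BPQ ..
      ultimately show ?thesis
        unfolding el_def w''_def by (simp add: vec_eq_iff algebra_simps)
    qed
    moreover have "(1 / n) *s w'' \<in> units W"
      unfolding units_def using w''W W n0 phin by (simp add: vec.subspace_scale phi_scale)
    ultimately have "n \<in> M" using MI[OF n0] by simp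
    then show ?thesis using n0 unfolding n_def by simp
  qed
  \<comment> \<open>\<open>q t\<close> normalizes \<open>t *s w1 + w2\<close>, and
    \<open>b / q t\<close> is the product of the resulting unit vector with \<open>w1\<close>. A
    value of \<open>1 + b / q t * f\<close> determines \<open>q t\<close>, hence \<open>t\<close> up
    to the two roots of a quadratic equation.\<close>
  define q where "q = (\<lambda>t. rt (t * t + b * t + 1))"
  have q0: "q t \<noteq> 0" for t
    unfolding q_def using anis[unfolded anisotropic_def, rule_format, of t 1] unfolding b_def by auto
  define H where "H = range (\<lambda>t. 1 + b / q t * f)"
  have Hstep: "\<nu> * h \<noteq> 0 \<and> \<nu> * h \<in> M" if \<nu>: "\<nu> \<in> M" and h: "h \<in> H" for \<nu> h
  proof -
    obtain t where t: "h = 1 + b / q t * f" using h unfolding H_def by blast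
    define x where "x = (1 / q t) *s (t *s w1 + w2)"
    have "t *s w1 + w2 \<in> W" using W w1W w2W by (simp add: vec.subspace_add vec.subspace_scale)
    moreover have "\<phi> (t *s w1 + w2) = q t * q t"
      using phiW[of t 1] unfolding q_def by simp
    ultimately have "x \<in> units W"
      unfolding units_def x_def using W q0[of t] by (simp add: vec.subspace_scale phi_scale)
    moreover have "b / q t = B x w1" unfolding x_def b_def using B_sym[of w2 w1] by (simp add: bilin)
    ultimately show ?thesis using step[OF \<nu> w1u] t by blast
  qed
  have H0: "0 \<notin> H" using Hstep[OF M1] by force
  have "card {t. 1 + b / q t * f = h} \<le> 2" for h
  proof -
    have "{t. 1 + b / q t * f = h} \<subseteq> {t. t * t + b * t = (b * f / (1 + h)) * (b * f / (1 + h)) + 1}"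
    proof
      fix t assume "t \<in> {t. 1 + b / q t * f = h}"
      then have h: "1 + h = b / q t * f" by (auto simp: add_ac)
      then have "1 + h \<noteq> 0" "q t * (1 + h) = b * f" using q0[of t] b0 f0 by simp_all
      then have "q t = b * f / (1 + h)" by (simp add: nonzero_eq_divide_eq)
      then have "(b * f / (1 + h)) * (b * f / (1 + h)) = t * t + b * t + 1" unfolding q_def by (metis rt_square)
      then show "t \<in> {t. t * t + b * t = (b * f / (1 + h)) * (b * f / (1 + h)) + 1}" by simp
    qed
    from card_mono[OF finite this] show ?thesis using quadratic_fibre by (rule le_trans)
  qed
  then have cardH: "CARD('a) \<le> 2 * card H" unfolding H_def by (rule card_le_fibres)
  have Mall: "\<nu> \<in> M" if nz: "\<nu> \<noteq> 0" for \<nu>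
  proof -
    obtain h h' where "h \<in> H" "h' \<in> H" "\<nu> = h * h'" using product_of_two[OF H0 cardH nz] by blast
    then show ?thesis using Hstep[of "1 * h" h'] Hstep[OF M1, of h] by simp
  qed
  \<comment> \<open>Substituting \<open>v = r + k *s w1\<close> splits \<open>u\<close> orthogonally
    into a plane part \<open>w\<close> and a multiple of \<open>r\<close>.
    \<open>B u p \<noteq> 0\<close> makes \<open>w\<close> nonzero, and norm 1 then forces the shape
    \<open>el n\<close>.\<close>
  define w where "w = (x + c * k) *s w1 + y *s w2"
  have wW: "w \<in> W" unfolding w_def W_def by blast
  have uw: "u = w + c *s r" unfolding u(1) w_def r_def by (simp add: vec_eq_iff algebra_simps)
  have pW: "p \<in> W" unfolding p(1) W_def by blast
  have "w \<noteq> 0" using p(2) rW[OF pW] unfolding uw by (auto simp: bilin)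
  define n where "n = rt (\<phi> w)"
  have n0: "n \<noteq> 0" unfolding n_def using anisW[OF wW] \<open>w \<noteq> 0\<close> by auto
  have nn: "n * n = \<phi> w" unfolding n_def by simp
  have "\<phi> u = n * n + c * c * (s * s)" unfolding uw nn using Wr[OF wW] phir by (simp add: phi_add phi_scale bilin)
  then have "n * n + (c * s) * (c * s) = 1" using u(2) by (simp add: mult_ac)
  then have "n * n = 1 + (c * s) * (c * s)" by (metis add.assoc add_self add.right_neutral)
  then have "n * n = (1 + c * s) * (1 + c * s)" by (simp add: square_add)
  then have "n = 1 + c * s" by (rule square_inj)
  then have "c = (1 + n) / s" using s0 by simp
  then have "u = el n ((1 / n) *s w)" unfolding uw el_def using n0 by simp
  moreover have "(1 / n) *s w \<in> units W"
    unfolding units_def using wW W n0 nn[symmetric] by (simp add: vec.subspace_scale phi_scale)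
  ultimately show ?thesis using Mall[OF n0] unfolding M_def by simp
qed

section \<open>Isometries whose displacements lie in a subspace\<close>

lemma grp_mod:
  assumes W: "vec.subspace W" "U \<subseteq> W" and g: "g \<in> grp U"
  shows "g x + x \<in> W"
  using g
proof (induction rule: grp.induct)
  case grp_id then show ?case using vec.subspace_0[OF W(1)] by simp
next
  case (grp_step g u)
  have "(refl u \<circ> g) x + x = (g x + x) + B (g x) u *s u" unfolding refl_def by (simp add: add_ac)
  then show ?case using grp_step W vec.subspace_add vec.subspace_scale by (metis subsetD)
qed

lemma grp_fix:
  assumes "g \<in> grp U" "\<And>u. u \<in> U \<Longrightarrow> B x u = 0" shows "g x = x"
  using assms(1) by (induction rule: grp.induct) (simp_all add: refl_def assms(2))

text \<open>If \<open>B (g e) e \<noteq> 0\<close>, then \<open>g e + e\<close> is a vector of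
  \<open>W\<close> with this norm, and its reflection carries \<open>g e\<close> to
  \<open>e\<close>; if \<open>g e \<noteq> e\<close> but the product is 0, a preliminary reflection
  in \<open>W\<close> makes it nonzero. Since \<open>h \<circ> g\<close> fixes \<open>e\<close> and
  preserves \<open>B\<close>, its displacements are orthogonal to \<open>e\<close>. As
  \<open>e\<close> may be taken outside \<open>W\<close>, this also serves degenerate
  \<open>W\<close>.\<close>

lemma reflect_to_fix:
  assumes g: "g \<in> isometries" and W: "vec.subspace W" and gW: "\<And>x. g x + x \<in> W"
    and w: "w \<in> W" "B e w \<noteq> 0" and r: "r \<in> W" "\<phi> r \<noteq> 0"
  shows "\<exists>h\<in>grp (units W). h (g e) = e \<and> h \<circ> g \<in> isometries \<and> (\<forall>x. h (g x) + x \<in> W \<and> B (h (g x) + x) e = 0)"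
proof -
  have U: "\<And>u. u \<in> units W \<Longrightarrow> \<phi> u = 1" and UW: "units W \<subseteq> W" unfolding units_def by auto
  have direct: "\<exists>h\<in>grp (units W). h e' = e" if e': "e' + e \<in> W" "\<phi> e' = \<phi> e" "B e' e \<noteq> 0" for e'
  proof -
    have p: "\<phi> (e' + e) = B e' e" using e'(2) by (simp add: phi_add)
    let ?u = "(1 / rt (\<phi> (e' + e))) *s (e' + e)"
    have "?u \<in> units W" unfolding units_def using scaled_unit[of "e' + e"] p e' vec.subspace_scale[OF W] by simp
    moreover have "e' + (B e' (e' + e) / \<phi> (e' + e)) *s (e' + e) = e"
      using e'(3) by (simp add: p bilin)
    then have "refl ?u e' = e" by (simp only: refl_scaled)
    ultimately show ?thesis using refl_in_grp by blast
  qed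
  have "\<exists>h\<in>grp (units W). h (g e) = e"
  proof (cases "g e = e")
    case True then show ?thesis using grp_id by (intro bexI[of _ id]) auto
  next
    case False
    show ?thesis
    proof (cases "B (g e) e = 0")
      case False
      then show ?thesis using direct[OF gW] isometriesD(3)[OF g] by blast
    next
      case True
      have gw: "g w \<in> W" using vec.subspace_add[OF W gW[of w] w(1)] by (simp add: add.assoc)
      have "B (g e) (g w) \<noteq> 0" using isometries_B[OF g] w by simp
      then obtain x where x: "x \<in> W" "\<phi> x \<noteq> 0" "B (g e) x \<noteq> 0" "B e x \<noteq> 0"
        using avoid_hyperplanes[OF W r gw _ w] by blast
      let ?u = "(1 / rt (\<phi> x)) *s x"
      have u: "?u \<in> units W" unfolding units_def using scaled_unit x vec.subspace_scale[OF W] by blast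
      have ue: "refl ?u (g e) = g e + (B (g e) x / \<phi> x) *s x" by (rule refl_scaled)
      have "refl ?u (g e) + e = (g e + e) + (B (g e) x / \<phi> x) *s x" unfolding ue by (simp add: add_ac)
      then have "refl ?u (g e) + e \<in> W" using vec.subspace_add[OF W gW vec.subspace_scale[OF W x(1)]] by metis
      moreover have "\<phi> (refl ?u (g e)) = \<phi> e" using phi_refl[OF U[OF u]] isometriesD(3)[OF g] by simp
      moreover have "B (refl ?u (g e)) e \<noteq> 0" unfolding ue using x True B_sym[of x e] by (simp add: bilin)
      ultimately obtain h where "h \<in> grp (units W)" "h (refl ?u (g e)) = e" using direct by blast
      then show ?thesis using grp_comp[OF _ refl_in_grp[OF u]] by (metis comp_apply)
    qed
  qed
  then obtain h where h: "h \<in> grp (units W)" "h (g e) = e" by blast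
  have hg: "h \<circ> g \<in> isometries" using isometries_comp[OF grp_isometries[OF U h(1)] g] by blast
  have "h (g x) + x \<in> W \<and> B (h (g x) + x) e = 0" for x
  proof
    have "h (g x) + x = (h (g x) + g x) + (g x + x)" by (simp add: add.assoc)
    then show "h (g x) + x \<in> W" using vec.subspace_add[OF W grp_mod[OF W UW h(1)] gW] by metis
    have "B (h (g x)) e = B x e" using isometries_B[OF hg, of x e] h(2) by simp
    then show "B (h (g x) + x) e = 0" by (simp add: bilin)
  qed
  then show ?thesis using h hg by blast
qed

end

section \<open>Path bases\<close>

text \<open>The coordinate functions are part of the data, so that spans are given by vanishing
  coordinates and intersect as their index sets do. \<open>nonsingular\<close> allows a radical as
  long as \<open>\<phi>\<close> has no zero on it except 0.\<close>

locale quadratic_path = quadratic_space ty \<phi> B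
  for ty :: "'a::{field,finite} itself" and \<phi> :: "'a^'k \<Rightarrow> 'a" and B :: "'a^'k \<Rightarrow> 'a^'k \<Rightarrow> 'a" +
  fixes v :: "nat \<Rightarrow> 'a^'k" and n :: nat and coord :: "nat \<Rightarrow> 'a^'k \<Rightarrow> 'a"
  assumes n_ge2: "2 \<le> n"
    and unit: "1 \<le> i \<Longrightarrow> i \<le> n \<Longrightarrow> \<phi> (v i) = 1"
    and adjacent: "1 \<le> i \<Longrightarrow> i < n \<Longrightarrow> B (v i) (v (Suc i)) \<noteq> 0"
    and far_orthogonal: "1 \<le> i \<Longrightarrow> i + 2 \<le> j \<Longrightarrow> j \<le> n \<Longrightarrow> B (v i) (v j) = 0"
    and expand: "x = (\<Sum>i=1..n. coord i x *s v i)"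
    and coord_add: "i \<in> {1..n} \<Longrightarrow> coord i (x + y) = coord i x + coord i y"
    and coord_scale: "i \<in> {1..n} \<Longrightarrow> coord i (c *s x) = c * coord i x"
    and coord_v: "i \<in> {1..n} \<Longrightarrow> j \<in> {1..n} \<Longrightarrow> coord i (v j) = (if i = j then 1 else 0)"
    and nonsingular: "(\<And>y. B x y = 0) \<Longrightarrow> \<phi> x = 0 \<Longrightarrow> x = 0"
begin

definition spn :: "nat set \<Rightarrow> ('a^'k) set"
  where "spn I = {x. \<forall>i\<in>{1..n} - I. coord i x = 0}"

lemma coord_zero: "i \<in> {1..n} \<Longrightarrow> coord i 0 = 0"
  using coord_scale[of i 0 0] by simp

lemma spn_subspace: "vec.subspace (spn I)"
  unfolding vec.subspace_def spn_def using coord_zero coord_add coord_scale by auto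

lemma v_in_spn: "i \<in> I \<Longrightarrow> i \<in> {1..n} \<Longrightarrow> v i \<in> spn I"
  unfolding spn_def using coord_v by auto

lemma spn_Int: "x \<in> spn I \<Longrightarrow> x \<in> spn J \<Longrightarrow> x \<in> spn (I \<inter> J)"
  unfolding spn_def by auto

lemma coord_eqI: "(\<And>i. i \<in> {1..n} \<Longrightarrow> coord i x = coord i y) \<Longrightarrow> x = y"
  using expand[of x] expand[of y] by (metis (no_types, lifting) sum.cong)

lemma spn_empty: "x \<in> spn {} \<Longrightarrow> x = 0"
  by (rule coord_eqI) (auto simp: spn_def coord_zero)

lemma B_expand: "B x y = (\<Sum>i=1..n. coord i x * B (v i) y)"
  by (subst expand[of x], subst B_lincomb) simp_all

lemma spn_expand: "x \<in> spn I \<Longrightarrow> I \<subseteq> {1..n} \<Longrightarrow> x = (\<Sum>i\<in>I. coord i x *s v i)"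
proof -
  assume x: "x \<in> spn I" and I: "I \<subseteq> {1..n}"
  have "(\<Sum>i\<in>I. coord i x *s v i) = (\<Sum>i=1..n. coord i x *s v i)"
    by (rule sum.mono_neutral_left) (use x I in \<open>auto simp: spn_def\<close>)
  then show ?thesis using expand by metis
qed

lemma isometry_eqI:
  assumes g: "g \<in> isometries" and h: "h \<in> isometries" and eq: "\<And>i. i \<in> {1..n} \<Longrightarrow> g (v i) = h (v i)"
  shows "g = h"
proof
  fix x
  have lin: "f (\<Sum>i\<in>S. coord i x *s v i) = (\<Sum>i\<in>S. coord i x *s f (v i))"
    if "f \<in> isometries" "finite S" for f S
    using that(2) by (induction S rule: finite_induct) (simp_all add: isometriesD[OF that(1)])
  have "g x = (\<Sum>i=1..n. coord i x *s g (v i))" using lin[OF g, of "{1..n}"] expand[of x] by simp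
  also have "\<dots> = (\<Sum>i=1..n. coord i x *s h (v i))" using eq by simp
  also have "\<dots> = h x" using lin[OF h, of "{1..n}"] expand[of x] by simp
  finally show "g x = h x" .
qed

lemma units_v: "I \<subseteq> {1..n} \<Longrightarrow> u \<in> v ` I \<Longrightarrow> \<phi> u = 1"
  using unit by fastforce

lemma grp_v_isometries: "I \<subseteq> {1..n} \<Longrightarrow> g \<in> grp (v ` I) \<Longrightarrow> g \<in> isometries"
  using grp_isometries[OF units_v] .

lemma grp_v_mod: "I \<subseteq> {1..n} \<Longrightarrow> g \<in> grp (v ` I) \<Longrightarrow> g x + x \<in> spn I"
  using grp_mod[OF spn_subspace, of "v ` I" I] v_in_spn by blast

lemma undo:
  assumes "h \<in> grp U" "\<And>u. u \<in> U \<Longrightarrow> \<phi> u = 1" "h \<circ> g \<in> grp U" shows "g \<in> grp U"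
proof -
  obtain h' where h': "h' \<in> grp U" "h' \<circ> h = id" using grp_left_inverse[OF assms(2,1)] by blast
  then have "h' \<circ> (h \<circ> g) = g" by (metis comp_assoc comp_id fun.map_id id_comp)
  then show ?thesis using grp_comp[OF h'(1) assms(3)] by simp
qed

text \<open>The vector following the interval detects its last coordinate:
  \<open>v (Suc (Suc d))\<close> is orthogonal to all earlier basis vectors except
  \<open>v (Suc d)\<close>. Once reflections in the span make it fixed, the displacements lose the
  coordinate at \<open>Suc d\<close> and the induction continues. This is the reason for
  \<open>d < n\<close>.\<close>

lemma full_interval:
  assumes N: "\<And>d. 2 \<le> d \<Longrightarrow> d < n \<Longrightarrow> units (spn {2..d}) \<subseteq> roots (v ` {2..d})"
    and d: "1 \<le> d" "d < n" and g: "g \<in> isometries" "\<And>x. g x + x \<in> spn {2..d}"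
  shows "g \<in> grp (v ` {2..d})"
  using d g
proof (induction d arbitrary: g)
  case 0 then show ?case by simp
next
  case (Suc d)
  show ?case
  proof (cases "d = 0")
    case True
    then have "g x = x" for x
      using spn_empty[of "g x + x"] Suc.prems(4)[of x] by (simp add: vec_add_eq_zero_iff)
    then have "g = id" by auto
    then show ?thesis using grp_id by (simp only:)
  next
    case False
    define e where "e = v (Suc (Suc d))"
    have vs: "v (Suc d) \<in> spn {2..Suc d}" using v_in_spn False Suc.prems by simp
    have Be: "B e (v (Suc d)) \<noteq> 0" unfolding e_def using adjacent[of "Suc d"] B_sym Suc.prems by simp
    have "\<phi> (v (Suc d)) \<noteq> 0" using unit[of "Suc d"] Suc.prems by simp
    then obtain h where h: "h \<in> grp (units (spn {2..Suc d}))" "h \<circ> g \<in> isometries"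
      "\<And>x. h (g x) + x \<in> spn {2..Suc d}" "\<And>x. B (h (g x) + x) e = 0"
      using reflect_to_fix[OF Suc.prems(3) spn_subspace Suc.prems(4) vs Be vs] by blast
    have mod: "(h \<circ> g) x + x \<in> spn {2..d}" for x
    proof -
      let ?y = "h (g x) + x"
      have "B ?y e = (\<Sum>i\<in>{Suc d}. coord i ?y * B (v i) e)"
        unfolding B_expand[of ?y]
      proof (rule sum.mono_neutral_right)
        show "\<forall>i\<in>{1..n} - {Suc d}. coord i ?y * B (v i) e = 0"
        proof
          fix i assume i: "i \<in> {1..n} - {Suc d}"
          show "coord i ?y * B (v i) e = 0"
          proof (cases "i \<le> d")
            case True
            then show ?thesis unfolding e_def using far_orthogonal[of i "Suc (Suc d)"] i Suc.prems by simp
          next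
            case False
            then show ?thesis using h(3)[of x] i unfolding spn_def by simp
          qed
        qed
      qed (use Suc.prems in auto)
      then have "coord (Suc d) ?y = 0" using h(4)[of x] Be B_sym[of e] by simp
      then have "coord i ?y = 0" if "i \<in> {1..n} - {2..d}" for i
        using h(3)[of x] that unfolding spn_def by (cases "i = Suc d") auto
      then show ?thesis unfolding spn_def comp_def by blast
    qed
    have "h \<circ> g \<in> grp (v ` {2..d})"
      by (rule Suc.IH[OF _ _ h(2) mod]) (use False Suc.prems in auto)
    then have hg: "h \<circ> g \<in> grp (v ` {2..Suc d})" using grp_mono[of "v ` {2..d}" "v ` {2..Suc d}"] by fastforce
    have "grp (units (spn {2..Suc d})) \<subseteq> grp (v ` {2..Suc d})"
      using N[of "Suc d"] False Suc.prems unfolding roots_def by (intro grp_subset) auto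
    then have "h \<in> grp (v ` {2..Suc d})" using h(1) by blast
    then show ?thesis using undo[OF _ _ hg] units_v[of "{2..Suc d}"] Suc.prems by auto
  qed
qed

text \<open>No basis vector is left beyond the whole space. Instead \<open>v 1, v 2, ...\<close> are
  fixed one after the other by reflections in the complement \<open>W\<close> of those already
  fixed; \<open>v (Suc i)\<close> lies in \<open>W\<close> and pairs with
  \<open>v i\<close>.\<close>

lemma full_total:
  assumes N: "units UNIV \<subseteq> roots (v ` {1..n})" and g: "g \<in> isometries"
  shows "g \<in> grp (v ` {1..n})"
proof -
  have U: "\<And>u. u \<in> units UNIV \<Longrightarrow> \<phi> u = 1" unfolding units_def by simp
  have unitsU: "grp (units W) \<subseteq> grp (units UNIV)" for W
    by (rule grp_mono) (auto simp: units_def)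
  have "i \<le> n \<Longrightarrow> 1 \<le> i \<Longrightarrow> g \<in> isometries \<Longrightarrow> (\<And>j. 1 \<le> j \<Longrightarrow> j < i \<Longrightarrow> g (v j) = v j) \<Longrightarrow>
      g \<in> grp (units UNIV)" for i g
  proof (induction i arbitrary: g rule: inc_induct)
    case base
    \<comment> \<open>Only \<open>v n\<close> may still move. Its displacement \<open>z\<close> is
      orthogonal to the other basis vectors and \<open>B (v n) z = \<phi> z\<close>. A singular
      \<open>z\<close> lies in the radical and vanishes; otherwise \<open>g\<close> is the
      reflection in \<open>z\<close>.\<close>
    define z where "z = g (v n) + v n"
    have gn: "g (v n) = v n + z" unfolding z_def by (simp add: add_ac)
    have "B z (v j) = 0" if j: "1 \<le> j" "j < n" for j
      using isometries_B[OF base(2), of "v n" "v j"] base(3)[OF j] unfolding z_def by (simp add: bilin)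
    have "\<phi> (v n) = \<phi> (v n) + \<phi> z + B (v n) z"
      using isometriesD(3)[OF base(2), of "v n"] unfolding gn phi_add by simp
    then have Bz: "B (v n) z = \<phi> z"
      by (metis add.commute add_self_left add_self add.right_neutral)
    have zj: "B (v j) z = 0" if "1 \<le> j" "j < n" for j using \<open>\<And>j. 1 \<le> j \<Longrightarrow> j < n \<Longrightarrow> B z (v j) = 0\<close> that B_sym by metis
    show ?case
    proof (cases "\<phi> z = 0")
      case True
      have "B z y = 0" for y
      proof -
        have "B (v i) z = 0" if "i \<in> {1..n}" for i using zj[of i] Bz True that by (cases "i = n") auto
        then show ?thesis using B_expand[of y z] B_sym[of z y] by simp
      qed
      then have "z = 0" using nonsingular True by blast
      then have "g = id"
        using base gn by (intro isometry_eqI[OF base(2) id_isometry]) (auto simp: le_less)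
      then show ?thesis using grp_id by (simp only:)
    next
      case False
      let ?u = "(1 / rt (\<phi> z)) *s z"
      have u: "?u \<in> units UNIV" unfolding units_def using scaled_unit[OF False] by simp
      have "g = refl ?u"
      proof (rule isometry_eqI[OF base(2) refl_isometry[OF U[OF u]]])
        fix i assume i: "i \<in> {1..n}"
        show "g (v i) = refl ?u (v i)"
        proof (cases "i = n")
          case True then show ?thesis unfolding refl_scaled using gn Bz False by simp
        next
          case False then show ?thesis unfolding refl_scaled using base(3)[of i] zj[of i] i by simp
        qed
      qed
      then show ?thesis using refl_in_grp[OF u] by simp
    qed
  next
    case (step i)
    define W where "W = {x. \<forall>j\<in>{1..<i}. B x (v j) = 0}"
    have W: "vec.subspace W" unfolding vec.subspace_def W_def by (auto simp: bilin)
    have gW: "g x + x \<in> W" for x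
    proof -
      have "B (g x) (v j) = B x (v j)" if "j \<in> {1..<i}" for j
        using isometries_B[OF step.prems(2), of x "v j"] step.prems(3)[of j] that by simp
      then show ?thesis unfolding W_def by (simp add: bilin)
    qed
    have vW: "v (Suc i) \<in> W" unfolding W_def using far_orthogonal B_sym step by auto
    have Be: "B (v i) (v (Suc i)) \<noteq> 0" using adjacent step by simp
    have "\<phi> (v (Suc i)) \<noteq> 0" using unit[of "Suc i"] step by simp
    then obtain h where h: "h \<in> grp (units W)" "h (g (v i)) = v i" "h \<circ> g \<in> isometries"
      using reflect_to_fix[OF step.prems(2) W gW vW Be vW] by blast
    have fixed: "(h \<circ> g) (v j) = v j" if j: "1 \<le> j" "j < Suc i" for j
    proof (cases "j = i")
      case True then show ?thesis using h by simp
    next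
      case False
      then have "h (v j) = v j"
        using grp_fix[OF h(1), of "v j"] j B_sym unfolding units_def W_def by auto
      then show ?thesis using step.prems(3)[of j] False j by simp
    qed
    have "h \<circ> g \<in> grp (units UNIV)"
      by (rule step.IH[OF _ h(3) fixed]) simp_all
    then show ?case using undo[OF _ U] h(1) unitsU by blast
  qed
  from this[of 1 g] have "g \<in> grp (units UNIV)" using n_ge2 g by auto
  moreover have "grp (units UNIV) \<subseteq> grp (v ` {1..n})"
    using N unfolding roots_def by (intro grp_subset) auto
  ultimately show ?thesis by blast
qed

end

section \<open>The intersection property for the path reflections\<close>

locale quadratic_string = quadratic_path ty \<phi> B v n coord
  for ty :: "'a::{field,finite} itself" and \<phi> :: "'a^'k \<Rightarrow> 'a" and B :: "'a^'k \<Rightarrow> 'a^'k \<Rightarrow> 'a"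
    and v :: "nat \<Rightarrow> 'a^'k" and n :: nat and coord :: "nat \<Rightarrow> 'a^'k \<Rightarrow> 'a" +
  assumes weight_one: "3 \<le> i \<Longrightarrow> i < n \<Longrightarrow> B (v i) (v (Suc i)) = 1"
    and units_initial: "2 \<le> d \<Longrightarrow> d < n \<Longrightarrow> units (spn {2..d}) \<subseteq> roots (v ` {2..d})"
    and units_total: "units UNIV \<subseteq> roots (v ` {1..n})"
begin

text \<open>
  For \<open>k \<ge> 3\<close> the reflections in \<open>v k, \<dots>, v n\<close> act on the points \<open>pt k k, \<dots>, pt k (n + 1)\<close> as the
  adjacent transpositions of a symmetric group.
\<close>
definition pt :: "nat \<Rightarrow> nat \<Rightarrow> 'a^'k"
  where "pt k j = (1 / B (v (k - 1)) (v k)) *s v (k - 1) + (\<Sum>i=k..<j. v i)"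

lemma pt_Suc: "k \<le> j \<Longrightarrow> pt k (Suc j) = pt k j + v j"
  unfolding pt_def by (simp add: add.assoc)

lemma B_v:
  assumes "3 \<le> i" "i \<le> n" "3 \<le> j" "j \<le> n"
  shows "B (v i) (v j) = (if j = Suc i \<or> i = Suc j then 1 else 0)"
proof -
  consider "j = i" | "j = Suc i" | "i = Suc j" | "i + 2 \<le> j" | "j + 2 \<le> i" by linarith
  then show ?thesis
    by cases (use assms weight_one[of i] weight_one[of j] far_orthogonal[of i j] far_orthogonal[of j i]
        B_sym[of "v i" "v j"] in auto)
qed

lemma B_pt:
  assumes k: "3 \<le> k" and "k \<le> j" and "j \<le> Suc n" and i: "k \<le> i" "i \<le> n"
  shows "B (pt k j) (v i) = (if i = j \<or> Suc i = j then 1 else 0)"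
  using assms(2,3)
proof (induction j rule: dec_induct)
  case base
  have "Suc (k - 1) = k" using k by simp
  then show ?case unfolding pt_def
    using adjacent[of "k - 1"] far_orthogonal[of "k - 1" i] k i by (auto simp: bilin)
next
  case (step j)
  have "B (v j) (v i) = (if i = Suc j \<or> j = Suc i then 1 else 0)"
    using B_v[of j i] step k i by auto
  then show ?case using step pt_Suc[of k j] by (auto simp: bilin)
qed

lemma refl_pt:
  assumes "3 \<le> k" "k \<le> i" "i \<le> n" "k \<le> j" "j \<le> Suc n"
  shows "refl (v i) (pt k j) = pt k (if j = i then Suc i else if j = Suc i then i else j)"
  unfolding refl_def using B_pt[OF assms(1,4,5,2,3)] assms pt_Suc[of k i] by (auto simp: add.assoc)

lemma coord_pt:
  assumes k: "3 \<le> k" and "k \<le> t" and "t \<le> Suc n" and l: "k \<le> l" "l \<le> n"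
  shows "coord l (pt k t) = (if l < t then 1 else 0)"
  using assms(2,3)
proof (induction t rule: dec_induct)
  case base
  have "l \<in> {1..n}" "k - 1 \<in> {1..n}" "l \<noteq> k - 1" using k l by auto
  then show ?case unfolding pt_def using coord_v[of l "k - 1"] l by (simp add: coord_scale)
next
  case (step t)
  then show ?case using pt_Suc[of k t] k l coord_v[of l t] by (auto simp: coord_add)
qed

lemma pt_inj:
  assumes "3 \<le> k" "k \<le> s" "s \<le> Suc n" "k \<le> t" "t \<le> Suc n" "pt k s = pt k t"
  shows "s = t"
proof -
  have "\<not> s < t" if "k \<le> s" "t \<le> Suc n" "pt k s = pt k t" "k \<le> t" for s t
    using coord_pt[of k s s] coord_pt[of k t s] assms(1) that by auto
  then show ?thesis using assms by (metis linorder_neqE_nat)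
qed

lemma grp_pt:
  assumes "g \<in> grp (v ` {k..n})" and k: "3 \<le> k" and "j \<in> {k..Suc n}"
  shows "\<exists>j'\<in>{k..Suc n}. g (pt k j) = pt k j'"
  using assms(1)
proof (induction rule: grp.induct)
  case grp_id then show ?case using assms by auto
next
  case (grp_step g u)
  then obtain j' i where "j' \<in> {k..Suc n}" "g (pt k j) = pt k j'" "i \<in> {k..n}" "u = v i" by blast
  then show ?case using refl_pt[of k i j'] k by (auto split: if_splits)
qed

text \<open>The adjacent transpositions from \<open>j\<close> to \<open>t - 1\<close>, applied in
  this order, carry the point \<open>j\<close> upwards step by step and touch no point beyond
  \<open>t\<close>.\<close>

lemma move_pt:
  assumes k: "3 \<le> k" "k \<le> j" and "j \<le> t" and "t \<le> Suc n"
  shows "\<exists>h\<in>grp (v ` {j..<t}). h (pt k j) = pt k t \<and> (\<forall>i. t < i \<longrightarrow> i \<le> Suc n \<longrightarrow> h (pt k i) = pt k i)"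
  using assms(3,4)
proof (induction t rule: dec_induct)
  case base
  show ?case using grp_id by (intro bexI[of _ id]) auto
next
  case (step t)
  then obtain h where h: "h \<in> grp (v ` {j..<t})" "h (pt k j) = pt k t"
    "\<And>i. t < i \<Longrightarrow> i \<le> Suc n \<Longrightarrow> h (pt k i) = pt k i" by auto
  have "grp (v ` {j..<t}) \<subseteq> grp (v ` {j..<Suc t})" by (intro grp_mono image_mono) auto
  then have "refl (v t) \<circ> h \<in> grp (v ` {j..<Suc t})" using h(1) step by (intro grp_step) auto
  moreover have "refl (v t) (pt k i) = pt k i" if "Suc t < i" "i \<le> Suc n" for i
    using refl_pt[of k t i] that step k by simp
  moreover have "refl (v t) (pt k t) = pt k (Suc t)" using refl_pt[of k t t] step k by simp
  ultimately show ?case using h by (intro bexI[of _ "refl (v t) \<circ> h"]) auto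
qed

text \<open>The permutation is sorted from the top: if all points above \<open>t\<close> are fixed
  and \<open>g\<close> sends the point \<open>t\<close> to the point \<open>j\<close>, then
  \<open>j \<le> t\<close>, and \<open>move_pt\<close> brings it back. When all points are fixed,
  \<open>g\<close> is the identity, because the points span \<open>v (k - 1), ..., v n\<close> and
  the earlier basis vectors are orthogonal to all reflecting vectors.\<close>

lemma symmetric_interval:
  assumes g: "g \<in> grp (v ` {k..n})" "\<And>x. g x + x \<in> spn {k..d}" and k: "3 \<le> k" and d: "d \<le> n"
  shows "g \<in> grp (v ` {k..d})"
proof -
  have kn: "{k..n} \<subseteq> {1..n}" "{k..d} \<subseteq> {1..n}" using k d by auto
  have "t \<le> Suc n \<Longrightarrow> g \<in> grp (v ` {k..n}) \<Longrightarrow> (\<And>x. g x + x \<in> spn {k..d}) \<Longrightarrow>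
      (\<And>j. t < j \<Longrightarrow> k \<le> j \<Longrightarrow> j \<le> Suc n \<Longrightarrow> g (pt k j) = pt k j) \<Longrightarrow> g \<in> grp (v ` {k..d})" for t g
  proof (induction t arbitrary: g rule: less_induct)
    case (less t)
    have iso: "g \<in> isometries" using grp_v_isometries[OF kn(1) less.prems(2)] .
    show ?case
    proof (cases "t < k")
      case True
      then have fixpt: "g (pt k j) = pt k j" if "k \<le> j" "j \<le> Suc n" for j using less.prems(4) that by auto
      show ?thesis
      proof (cases "k \<le> n")
        case False
        then have "g \<in> grp {}" using less.prems(2) by simp
        then show ?thesis using grp_mono by blast
      next
        case kn': True
        have "g = id"
        proof (rule isometry_eqI[OF iso id_isometry])
          fix i assume i: "i \<in> {1..n}"
          consider "i < k - 1" | "i = k - 1" | "k \<le> i" by linarith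
          then have "g (v i) = v i"
          proof cases
            case 1
            have "B (v i) u = 0" if "u \<in> v ` {k..n}" for u
              using that far_orthogonal[of i] i 1 by auto
            then show ?thesis using grp_fix[OF less.prems(2)] by blast
          next
            case 2
            have "B (v i) (v k) \<noteq> 0" using adjacent[of i] 2 k kn' by simp
            moreover have "pt k k = (1 / B (v i) (v k)) *s v i" unfolding pt_def 2 by simp
            ultimately have "v i = B (v i) (v k) *s pt k k" by simp
            then show ?thesis using isometriesD(2)[OF iso] fixpt[of k] kn' by (metis le_SucI order.refl)
          next
            case 3
            then have "v i = pt k (Suc i) + pt k i" using pt_Suc[of k i] by (simp add: add_ac)
            then show ?thesis using isometriesD(1)[OF iso] fixpt[of i] fixpt[of "Suc i"] 3 i by simp
          qed
          then show "g (v i) = id (v i)" by simp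
        qed
        then show ?thesis using grp_id by (simp only:)
      qed
    next
      case False
      then have t: "k \<le> t" "t \<in> {k..Suc n}" using less.prems(1) by auto
      obtain j where j: "j \<in> {k..Suc n}" "g (pt k t) = pt k j" using grp_pt[OF less.prems(2) k t(2)] by blast
      have "j \<le> t"
      proof (rule ccontr)
        assume "\<not> j \<le> t"
        then have "g (pt k j) = pt k j" using less.prems(4)[of j] j by auto
        then have "g (pt k j) = g (pt k t)" using j by simp
        then have "pt k j = pt k t" using isometriesD(4)[OF iso] by (metis bij_pointE)
        then show False using pt_inj[OF k, of j t] j t \<open>\<not> j \<le> t\<close> by auto
      qed
      then obtain h where h: "h \<in> grp (v ` {j..<t})" "h (pt k j) = pt k t"
        "\<And>i. t < i \<Longrightarrow> i \<le> Suc n \<Longrightarrow> h (pt k i) = pt k i"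
        using move_pt[OF k, of j t] j t by auto
      have "{j..<t} \<subseteq> {k..d}"
      proof
        fix l assume l: "l \<in> {j..<t}"
        then have ln: "k \<le> l" "l \<le> n" using j t by auto
        \<comment> \<open>The displacement of the point \<open>t\<close> is
          \<open>v j + ... + v (t - 1)\<close>. As it lies in the span of \<open>{k..d}\<close>,
          every generator used by \<open>h\<close> is admissible.\<close>
        have "coord l (pt k j + pt k t) = 1"
          using coord_pt[OF k, of j l] coord_pt[OF k, of t l] l ln j t k by (simp add: coord_add)
        moreover have "pt k j + pt k t \<in> spn {k..d}" using less.prems(3)[of "pt k t"] j by simp
        moreover have "l \<in> {1..n}" using ln k by simp
        ultimately show "l \<in> {k..d}" unfolding spn_def by (metis (mono_tags, lifting) DiffI mem_Collect_eq zero_neq_one)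
      qed
      then have hd: "h \<in> grp (v ` {k..d})" using h(1) grp_mono[OF image_mono] by blast
      then have hn: "h \<in> grp (v ` {k..n})" using d grp_mono[OF image_mono[of "{k..d}" "{k..n}" v]] by auto
      have "h \<circ> g \<in> grp (v ` {k..d})"
      proof (rule less.IH[of "t - 1"])
        show "t - 1 < t" "t - 1 \<le> Suc n" using t k by auto
        show "h \<circ> g \<in> grp (v ` {k..n})" using grp_comp[OF hn less.prems(2)] .
        fix x
        have "(h \<circ> g) x + x = (h (g x) + g x) + (g x + x)" by (simp add: add.assoc)
        then show "(h \<circ> g) x + x \<in> spn {k..d}"
          using vec.subspace_add[OF spn_subspace grp_v_mod[OF kn(2) hd] less.prems(3)] by metis
      next
        fix i assume i: "t - 1 < i" "k \<le> i" "i \<le> Suc n"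
        show "(h \<circ> g) (pt k i) = pt k i"
        proof (cases "i = t")
          case True then show ?thesis using j h by simp
        next
          case False
          then show ?thesis using less.prems(4)[of i] h(3)[of i] i by simp
        qed
      qed
      then show ?thesis using undo[OF hd] units_v[OF kn(2)] by blast
    qed
  qed
  from this[of "Suc n"] show ?thesis using g by auto
qed

text \<open>Both memberships together confine the displacements to the span of
  \<open>{i+1..d}\<close>. For \<open>i = 1\<close> fullness on \<open>{2..d}\<close> concludes; for
  \<open>i \<ge> 2\<close> the second group is symmetric. \<open>d = n\<close> is separate because
  \<open>full_interval\<close> needs a vector beyond \<open>d\<close>.\<close>

lemma interval_intersection_grp:
  assumes i: "1 \<le> i" and d: "d \<le> n" and g: "g \<in> grp (v ` {i..d})" "g \<in> grp (v ` {i+1..n})"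
  shows "g \<in> grp (v ` {i+1..d})"
proof (cases "d = n")
  case True then show ?thesis using g by simp
next
  case False
  have sub: "{i..d} \<subseteq> {1..n}" "{i+1..n} \<subseteq> {1..n}" using i d by auto
  have mod: "g x + x \<in> spn {i+1..d}" for x
  proof -
    have "{i..d} \<inter> {i+1..n} = {i+1..d}" using d by auto
    then show ?thesis
      using spn_Int[OF grp_v_mod[OF sub(1) g(1)] grp_v_mod[OF sub(2) g(2)]] by metis
  qed
  show ?thesis
  proof (cases "i = 1")
    case True
    have "d = 0 \<or> 1 \<le> d" by auto
    then show ?thesis
    proof
      assume "d = 0"
      then show ?thesis using g(1) True by (simp add: numeral_2_eq_2)
    next
      assume "1 \<le> d"
      moreover have "d < n" using d \<open>d \<noteq> n\<close> by simp
      moreover have "g x + x \<in> spn {2..d}" for x using mod[of x] True by (simp add: numeral_2_eq_2)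
      ultimately have "g \<in> grp (v ` {2..d})"
        using full_interval[OF units_initial, of d g] grp_v_isometries[OF sub(1) g(1)] by blast
      then show ?thesis using True by (simp add: numeral_2_eq_2)
    qed
  next
    case False
    then show ?thesis using symmetric_interval[OF g(2) mod _ d] i by simp
  qed
qed

end

section \<open>Path reflections as generators of the orthogonal group\<close>

lemma linear_vec_iff:
  fixes g :: "'a::field^'k \<Rightarrow> 'a^'k"
  shows "Vector_Spaces.linear (*s) (*s) g \<longleftrightarrow>
    (\<forall>x y. g (x + y) = g x + g y) \<and> (\<forall>c x. g (c *s x) = c *s g x)"
  by (simp add: Vector_Spaces.linear_iff vec.vector_space_axioms)

lemma Bij_UNIV: "Bij UNIV = {f. bij f}"
  unfolding Bij_def extensional_def by auto

context quadratic_space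
begin

abbreviation "OG \<equiv> orthogonal_group \<phi>"

lemma carrier_OG: "carrier OG = isometries"
  unfolding orthogonal_group_def isometries_def by (auto simp: Bij_UNIV linear_vec_iff)

lemma mult_OG: "g \<in> isometries \<Longrightarrow> h \<in> isometries \<Longrightarrow> g \<otimes>\<^bsub>OG\<^esub> h = g \<circ> h"
  unfolding orthogonal_group_def BijGroup_def isometries_def
  by (simp add: Bij_UNIV compose_def comp_def restrict_UNIV)

lemma one_OG: "\<one>\<^bsub>OG\<^esub> = id"
  unfolding orthogonal_group_def BijGroup_def by auto

lemma inv_isometry:
  assumes g: "g \<in> isometries" shows "inv_into UNIV g \<in> isometries"
proof -
  have b: "bij g" by (rule isometriesD(4)[OF g])
  have gi: "g (inv_into UNIV g x) = x" for x using b by (simp add: bij_is_surj surj_f_inv_f)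
  have ig: "inv_into UNIV g (g x) = x" for x using b by (simp add: bij_is_inj)
  have "inv_into UNIV g (x + y) = inv_into UNIV g x + inv_into UNIV g y" for x y
    by (metis isometriesD(1)[OF g] gi ig)
  moreover have "inv_into UNIV g (c *s x) = c *s inv_into UNIV g x" for c x
    by (metis isometriesD(2)[OF g] gi ig)
  moreover have "\<phi> (inv_into UNIV g x) = \<phi> x" for x by (metis isometriesD(3)[OF g] gi)
  ultimately show ?thesis unfolding isometries_def using bij_imp_bij_inv[OF b] by blast
qed

lemma group_OG: "group OG"
proof (rule groupI)
  fix x assume "x \<in> carrier OG"
  then have x: "x \<in> isometries" by (simp add: carrier_OG)
  then have "inv_into UNIV x \<circ> x = id" using isometriesD(4)[OF x] by (simp add: bij_is_inj)
  then show "\<exists>y\<in>carrier OG. y \<otimes>\<^bsub>OG\<^esub> x = \<one>\<^bsub>OG\<^esub>"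
    using x inv_isometry[OF x] by (auto simp: carrier_OG mult_OG one_OG intro!: bexI[of _ "inv_into UNIV x"])
qed (simp_all add: carrier_OG mult_OG one_OG isometries_comp id_isometry comp_assoc)

lemma generate_eq_grp:
  assumes I: "\<And>i. i \<in> I \<Longrightarrow> \<phi> (w i) = 1"
  shows "generate OG ((\<lambda>i. refl (w i)) ` I) = grp (w ` I)"
proof
  interpret G: group OG by (rule group_OG)
  have iso: "g \<in> isometries" if "g \<in> grp (w ` I)" for g
    by (rule grp_isometries[OF _ that]) (use I in auto)
  have rc: "refl (w i) \<in> carrier OG" if "i \<in> I" for i
    using refl_isometry I that carrier_OG by simp
  show "generate OG ((\<lambda>i. refl (w i)) ` I) \<subseteq> grp (w ` I)"
  proof
    fix g assume "g \<in> generate OG ((\<lambda>i. refl (w i)) ` I)"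
    then show "g \<in> grp (w ` I)"
    proof (induction rule: generate.induct)
      case one show ?case unfolding one_OG by (rule grp_id)
    next
      case (incl h) then show ?case using refl_in_grp by auto
    next
      case (inv h)
      then obtain i where i: "i \<in> I" "h = refl (w i)" by blast
      have "refl (w i) \<otimes>\<^bsub>OG\<^esub> refl (w i) = \<one>\<^bsub>OG\<^esub>"
        using rc[OF i(1)] refl_invol[OF I[OF i(1)]] by (auto simp: carrier_OG mult_OG one_OG)
      then have "inv\<^bsub>OG\<^esub> h = refl (w i)" unfolding i using rc[OF i(1)] G.inv_equality by blast
      then show ?case using refl_in_grp i by auto
    next
      case (eng h1 h2)
      then show ?case
        using grp_comp by (simp only: mult_OG[OF iso iso])
    qed
  qed
  show "grp (w ` I) \<subseteq> generate OG ((\<lambda>i. refl (w i)) ` I)"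
  proof
    fix g assume "g \<in> grp (w ` I)"
    then show "g \<in> generate OG ((\<lambda>i. refl (w i)) ` I)"
    proof (induction rule: grp.induct)
      case grp_id show ?case using generate.one[of OG] by (simp only: one_OG)
    next
      case (grp_step g u)
      then obtain i where i: "i \<in> I" "u = w i" by blast
      have "refl u \<in> generate OG ((\<lambda>i. refl (w i)) ` I)" unfolding i using i by (intro generate.incl) blast
      then have "refl u \<otimes>\<^bsub>OG\<^esub> g \<in> generate OG ((\<lambda>i. refl (w i)) ` I)"
        using grp_step generate.eng by metis
      moreover have "refl u \<in> isometries" using rc[OF i(1)] i carrier_OG by simp
      ultimately show ?case using iso[OF grp_step(1)] by (simp only: mult_OG)
    qed
  qed
qed

end

context quadratic_string
begin

lemma string_C_group: "string_C_group OG (\<lambda>i. refl (v i)) n"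
proof -
  have gen: "generate OG ((\<lambda>i. refl (v i)) ` I) = grp (v ` I)" if "I \<subseteq> {1..n}" for I
    by (rule generate_eq_grp) (use that unit in auto)
  have iso: "refl (v i) \<in> isometries" if "i \<in> {1..n}" for i using refl_isometry unit that by simp
  show ?thesis
  proof (intro string_C_group.intro group_OG string_C_group_axioms.intro)
    show "finite (carrier OG)" by simp
    show "refl (v i) \<in> carrier OG" if "i \<in> {1..n}" for i using iso[OF that] carrier_OG by simp
    show "refl (v i) \<otimes>\<^bsub>OG\<^esub> refl (v i) = \<one>\<^bsub>OG\<^esub>" if "i \<in> {1..n}" for i
      using mult_OG iso that refl_invol[of "v i"] unit[of i] by (auto simp: one_OG)
    show "refl (v i) \<noteq> \<one>\<^bsub>OG\<^esub>" if i: "i \<in> {1..n}" for i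
    proof
      assume "refl (v i) = \<one>\<^bsub>OG\<^esub>"
      then have id: "refl (v i) x = x" for x by (simp add: one_OG)
      obtain j where "B (v j) (v i) \<noteq> 0"
      proof (cases "i = n")
        case True then show ?thesis using that[of "i - 1"] adjacent[of "i - 1"] n_ge2 by simp
      next
        case False then show ?thesis using that[of "Suc i"] adjacent[of i] i B_sym by simp
      qed
      then have "v i = 0" using id[of "v j"] unfolding refl_def by simp
      then show False using unit[of i] i by simp
    qed
    show "refl (v i) \<otimes>\<^bsub>OG\<^esub> refl (v j) = refl (v j) \<otimes>\<^bsub>OG\<^esub> refl (v i)"
      if ij: "1 \<le> i" "i + 2 \<le> j" "j \<le> n" for i j
    proof -
      have "B (v i) (v j) = 0" "B (v j) (v i) = 0" using far_orthogonal[OF ij] B_sym by metis+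
      then have "refl (v i) \<circ> refl (v j) = refl (v j) \<circ> refl (v i)"
        by (auto simp: refl_def bilin add_ac)
      then show ?thesis using mult_OG iso ij by simp
    qed
    show "generate OG ((\<lambda>i. refl (v i)) ` {1..n}) = carrier OG"
      unfolding gen[OF order.refl] carrier_OG
      using full_total[OF units_total] grp_v_isometries[OF order.refl] by blast
    show "generate OG ((\<lambda>i. refl (v i)) ` {i..d}) \<inter> generate OG ((\<lambda>i. refl (v i)) ` {i + 1..n})
        \<subseteq> generate OG ((\<lambda>i. refl (v i)) ` {i + 1..d})" if id: "1 \<le> i" "d \<le> n" for i d
    proof -
      have "{i..d} \<subseteq> {1..n}" "{i+1..n} \<subseteq> {1..n}" "{i+1..d} \<subseteq> {1..n}" using id by auto
      note sub = this
      show ?thesis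
        unfolding gen[OF sub(1)] gen[OF sub(2)] gen[OF sub(3)]
        using interval_intersection_grp[OF id] by (auto simp only: Int_iff)
    qed
  qed
qed

theorem orthogonal_polytope:
  "\<exists>(P :: nat set) leq. abstract_regular_polytope P leq n \<and> polytope_aut P leq \<cong> OG"
  by (rule string_C_group.regular_polytope[OF string_C_group])

end

section \<open>All unit vectors of the growing spans are roots\<close>

context quadratic_space
begin

lemma roots_mono: "U \<subseteq> U' \<Longrightarrow> roots U \<subseteq> roots U'"
  unfolding roots_def using grp_mono by blast

text \<open>Only unit vectors not orthogonal to \<open>W\<close> need a construction, supplied as
  \<open>N\<close>; the others follow by \<open>units_orthogonal_step\<close>.\<close>

lemma units_extend:
  assumes W: "vec.subspace W" and W': "\<And>x. x \<in> W' \<longleftrightarrow> (\<exists>w\<in>W. \<exists>c. x = w + c *s v)"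
    and pq: "p \<in> W" "q \<in> W" "B p q \<noteq> 0"
    and N: "\<And>w c u p. w \<in> W \<Longrightarrow> u = w + c *s v \<Longrightarrow> \<phi> u = 1 \<Longrightarrow> p \<in> W \<Longrightarrow> B u p \<noteq> 0 \<Longrightarrow> u \<in> roots U"
  shows "units W' \<subseteq> roots U"
proof
  fix u assume "u \<in> units W'"
  then have u: "u \<in> W'" "\<phi> u = 1" unfolding units_def by auto
  have sW': "vec.subspace W'"
    unfolding vec.subspace_def
  proof (intro conjI ballI allI)
    have "0 = 0 + 0 *s v" by simp
    then show "0 \<in> W'" using W' vec.subspace_0[OF W] by metis
  next
    fix x y assume "x \<in> W'" "y \<in> W'"
    then obtain w c w' c' where "w \<in> W" "w' \<in> W" "x = w + c *s v" "y = w' + c' *s v" using W' by metis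
    then have "x + y = (w + w') + (c + c') *s v" "w + w' \<in> W"
      using vec.subspace_add[OF W] by (simp_all add: vec_eq_iff algebra_simps)
    then show "x + y \<in> W'" using W' by metis
  next
    fix a x assume "x \<in> W'"
    then obtain w c where "w \<in> W" "x = w + c *s v" using W' by metis
    then have "a *s x = a *s w + (a * c) *s v" "a *s w \<in> W"
      using vec.subspace_scale[OF W] by (simp_all add: vec_eq_iff algebra_simps)
    then show "a *s x \<in> W'" using W' by metis
  qed
  have WW': "W \<subseteq> W'"
  proof
    fix x assume "x \<in> W"
    moreover have "x = x + 0 *s v" by simp
    ultimately show "x \<in> W'" using W' by metis
  qed
  have U: "u \<in> roots U" if "u \<in> W'" "\<phi> u = 1" "p \<in> W" "B u p \<noteq> 0" for u p
    using that N W' by metis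
  show "u \<in> roots U"
  proof (cases "\<exists>p\<in>W. B u p \<noteq> 0")
    case True then show ?thesis using U u by blast
  next
    case False
    then have orth: "\<And>p. p \<in> W \<Longrightarrow> B u p = 0" by blast
    show ?thesis by (rule units_orthogonal_step[OF _ sW' WW' pq u orth]) (rule U)
  qed
qed

end

context quadratic_path
begin

lemma spn_insert_iff:
  assumes "a \<in> {1..n}" "a \<notin> I"
  shows "x \<in> spn (insert a I) \<longleftrightarrow> (\<exists>w\<in>spn I. \<exists>c. x = w + c *s v a)"
proof
  assume x: "x \<in> spn (insert a I)"
  have "x + coord a x *s v a \<in> spn I"
    using x assms unfolding spn_def by (auto simp: coord_add coord_scale coord_v)
  moreover have "x = (x + coord a x *s v a) + coord a x *s v a" by (simp add: add.assoc)
  ultimately show "\<exists>w\<in>spn I. \<exists>c. x = w + c *s v a" by blast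
next
  assume "\<exists>w\<in>spn I. \<exists>c. x = w + c *s v a"
  then show "x \<in> spn (insert a I)"
    using assms unfolding spn_def by (auto simp: coord_add coord_scale coord_v split: if_splits)
qed

lemma spn_pair: "a \<in> {1..n} \<Longrightarrow> b \<in> {1..n} \<Longrightarrow> a \<noteq> b \<Longrightarrow> x \<in> spn {a, b} \<Longrightarrow> \<exists>s t. x = s *s v a + t *s v b"
  using spn_expand[of x "{a, b}"] by auto

text \<open>The span of \<open>v 2\<close> has one unit vector, and \<open>v 2\<close>,
  \<open>v 3\<close> span the plane with full rotation. Passing to \<open>v 4\<close> is the case of
  \<open>units_plane_step\<close>, where the new weight 1 differs from b. From \<open>v 5\<close>
  on, \<open>units_hyperplane_step\<close> applies with \<open>y = v d\<close> and
  \<open>z = v (d - 2)\<close>, which is orthogonal to \<open>v d\<close> and to the new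
  vector.\<close>

lemma units_spn:
  assumes full: "full_rotation (B (v 2) (v 3))" and anis: "anisotropic (B (v 2) (v 3))"
    and b1: "B (v 2) (v 3) \<noteq> 1" and weight_one: "\<And>i. 3 \<le> i \<Longrightarrow> i < n \<Longrightarrow> B (v i) (v (Suc i)) = 1"
    and d: "2 \<le> d" "d \<le> n"
  shows "units (spn {2..d}) \<subseteq> roots (v ` {2..d})"
  using d
proof (induction d rule: dec_induct)
  case base
  show ?case
  proof
    fix u assume u: "u \<in> units (spn {2..2})"
    then have "u = coord 2 u *s v 2" using spn_expand[of u "{2..2}"] n_ge2 unfolding units_def by auto
    moreover from this have "coord 2 u * coord 2 u = 1 * 1"
      using u unit[of 2] n_ge2 unfolding units_def by (metis (mono_tags, lifting) mem_Collect_eq mult.right_neutral one_le_numeral phi_scale)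
    then have "coord 2 u = 1" by (rule square_inj)
    ultimately have "u = v 2" by simp
    then show "u \<in> roots (v ` {2..2})" using roots_superset[of "v ` {2..2}"] unit[of 2] n_ge2 by auto
  qed
next
  case (step d)
  have U: "\<And>u. u \<in> v ` {2..Suc d} \<Longrightarrow> \<phi> u = 1" using units_v[of "{2..Suc d}"] step by auto
  have vR: "v i \<in> roots (v ` {2..Suc d})" if "i \<in> {2..Suc d}" for i
    using roots_superset[OF U] that by blast
  note R = refl_closed_roots[of "v ` {2..Suc d}"]
  have "units (spn {2..d}) \<subseteq> roots (v ` {2..d})" using step by simp
  also have "\<dots> \<subseteq> roots (v ` {2..Suc d})" by (intro roots_mono image_mono) auto
  finally have UW: "units (spn {2..d}) \<subseteq> roots (v ` {2..Suc d})" .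
  have ins: "{2..Suc d} = insert (Suc d) {2..d}" using step by auto
  have ph: "\<phi> (v i) = 1" if "i \<in> {2..Suc d}" for i using unit[of i] that step by simp
  show ?case
  proof (cases "d = 2")
    case True
    have e: "{2..Suc d} = {2, 3}" using True by auto
    show ?thesis
    proof
      fix u assume "u \<in> units (spn {2..Suc d})"
      then have u: "u \<in> spn {2, 3}" "\<phi> u = 1" unfolding units_def e by auto
      have "2 \<in> {1..n}" "3 \<in> {1..n}" using True step by auto
      then obtain x y where "u = x *s v 2 + y *s v 3" using spn_pair[of 2 3 u] u(1) by auto
      then show "u \<in> roots (v ` {2..Suc d})"
        using units_plane[OF R vR vR ph ph full _ u(2)] True by auto
    qed
  next
    case False
    then have d3: "3 \<le> d" using step by simp
    have vs: "v i \<in> spn {2..d}" if "i \<in> {2..d}" for i using v_in_spn that step by auto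
    have "B (v 2) (v 3) \<noteq> 0" using adjacent[of 2] d3 step by (simp add: numeral_3_eq_3)
    then show ?thesis
    proof (intro units_extend[OF spn_subspace spn_insert_iff[of "Suc d" "{2..d}", folded ins] vs vs])
      fix w c u p
      assume w: "w \<in> spn {2..d}" and u: "u = w + c *s v (Suc d)" "\<phi> u = 1" and p: "p \<in> spn {2..d}" "B u p \<noteq> 0"
      have w1: "B (v (Suc d)) (v d) = 1" using weight_one[of d] B_sym d3 step by simp
      show "u \<in> roots (v ` {2..Suc d})"
      proof (cases "d = 3")
        case True
        have "{2..d} = {2, 3}" using True by auto
        then obtain x y x' y' where xy: "w = x *s v 2 + y *s v 3" "p = x' *s v 2 + y' *s v 3"
          using spn_pair[of 2 3 w] spn_pair[of 2 3 p] w p(1) True step(3,4) by auto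
        have "B (v (Suc d)) (v 2) = 0" using far_orthogonal[of 2 "Suc d"] B_sym True step by simp
        then show ?thesis
          using units_plane_step[OF R vR vR ph ph full anis vR ph _ _ _ u(1)[unfolded xy(1)] u(2) xy(2) p(2)]
            w1 b1 True by simp
      next
        case False
        then have d4: "4 \<le> d" using d3 by simp
        have "B (v d) (v (d - 2)) = 0" "B (v (Suc d)) (v (d - 2)) = 0"
          using far_orthogonal[of "d - 2" d] far_orthogonal[of "d - 2" "Suc d"] B_sym d4 step by auto
        then show ?thesis
          using units_hyperplane_step[OF R UW spn_subspace vR ph vs[of d] ph _ vs[of "d - 2"] ph _ _ w u p]
            w1 d4 by simp
      qed
    qed (use d3 step in auto)
  qed
qed

text \<open>The remaining vector is attached at the front: \<open>y = v 2\<close> and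
  \<open>z = v 4\<close> serve for \<open>n \<ge> 4\<close>. For \<open>n = 3\<close> there is no
  such \<open>z\<close>, and \<open>units_plane_step\<close> is applied to the plane read backwards
  as \<open>v 3\<close>, \<open>v 2\<close>; its condition on the weights becomes
  \<open>ab\<close>.\<close>

lemma units_UNIV:
  assumes full: "full_rotation (B (v 2) (v 3))" and anis: "anisotropic (B (v 2) (v 3))"
    and b1: "B (v 2) (v 3) \<noteq> 1" and weight_one: "\<And>i. 3 \<le> i \<Longrightarrow> i < n \<Longrightarrow> B (v i) (v (Suc i)) = 1"
    and n3: "3 \<le> n" and ab: "n = 3 \<Longrightarrow> B (v 1) (v 2) \<noteq> B (v 2) (v 3)"
  shows "units UNIV \<subseteq> roots (v ` {1..n})"
proof -
  have U: "\<And>u. u \<in> v ` {1..n} \<Longrightarrow> \<phi> u = 1" using units_v[of "{1..n}"] by auto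
  have vR: "v i \<in> roots (v ` {1..n})" if "i \<in> {1..n}" for i
    using roots_superset[OF U] that by blast
  note R = refl_closed_roots[of "v ` {1..n}"]
  have "units (spn {2..n}) \<subseteq> roots (v ` {2..n})"
    by (rule units_spn[OF full anis b1 weight_one]) (use n3 in auto)
  also have "\<dots> \<subseteq> roots (v ` {1..n})" by (intro roots_mono image_mono) auto
  finally have UW: "units (spn {2..n}) \<subseteq> roots (v ` {1..n})" .
  have ins: "insert 1 {2..n} = {1..n}" using n3 by auto
  have ph: "\<phi> (v i) = 1" if "i \<in> {1..n}" for i using unit[of i] that by simp
  have vs: "v i \<in> spn {2..n}" if "i \<in> {2..n}" for i using v_in_spn that by auto
  have all: "x \<in> UNIV \<longleftrightarrow> (\<exists>w\<in>spn {2..n}. \<exists>c. x = w + c *s v 1)" for x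
    using spn_insert_iff[of 1 "{2..n}" x] n3 unfolding ins by (auto simp: spn_def)
  have b0: "B (v 2) (v 3) \<noteq> 0" "B (v 1) (v 2) \<noteq> 0"
    using adjacent[of 2] adjacent[of 1] n3 by (simp_all add: numeral_3_eq_3 numeral_2_eq_2)
  show ?thesis
  proof (rule units_extend[OF spn_subspace all vs vs b0(1)])
    fix w c u p
    assume w: "w \<in> spn {2..n}" and u: "u = w + c *s v 1" "\<phi> u = 1" and p: "p \<in> spn {2..n}" "B u p \<noteq> 0"
    show "u \<in> roots (v ` {1..n})"
    proof (cases "n = 3")
      case True
      have "{2..n} = {3, 2}" using True by auto
      then obtain x y x' y' where xy: "w = x *s v 3 + y *s v 2" "p = x' *s v 3 + y' *s v 2"
        using spn_pair[of 3 2 w] spn_pair[of 3 2 p] w p(1) True by auto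
      have "B (v 1) (v 3) = 0" using far_orthogonal[of 1 3] True by simp
      then show ?thesis
        using units_plane_step[OF R vR vR ph ph full[unfolded B_sym[of "v 2"]] anis[unfolded B_sym[of "v 2"]]
            vR ph _ _ _ u(1)[unfolded xy(1)] u(2) xy(2) p(2)]
          ab b0 True B_sym[of "v 2" "v 3"] by simp
    next
      case False
      have "B (v 2) (v 4) = 0" "B (v 1) (v 4) = 0"
        using far_orthogonal[of 2 4] far_orthogonal[of 1 4] False n3 by auto
      then show ?thesis
        using units_hyperplane_step[OF R UW spn_subspace vR ph vs[of 2] ph _ vs[of 4] ph _ _ w u p]
          b0 False n3 by simp
    qed
  qed (use n3 in auto)
qed

end

section \<open>Rotations of a plane\<close>

text \<open>Cyclicity of the multiplicative group for explicitly given operations, so that it serves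
  both the field itself and the extension on pairs. Powers are written as iterated right
  multiplication.\<close>

lemma field_cyclic:
  fixes add mul :: "'b::finite \<Rightarrow> 'b \<Rightarrow> 'b"
  assumes "field \<lparr>carrier = UNIV, monoid.mult = mul, one = e, ring.zero = z, add = add\<rparr>" (is "field ?R")
  shows "\<exists>g. g \<noteq> z \<and> (\<forall>x. x \<noteq> z \<longrightarrow> (\<exists>i. x = ((\<lambda>x. mul x g) ^^ i) e))"
proof -
  interpret field ?R by (rule assms)
  have pow: "g [^]\<^bsub>?R\<^esub> (i::nat) = ((\<lambda>x. mul x g) ^^ i) e" for g i
    by (induction i) (simp_all add: nat_pow_def)
  obtain g where "g \<in> carrier (mult_of ?R)" "carrier (mult_of ?R) = {g [^]\<^bsub>?R\<^esub> i |i::nat. i \<in> UNIV}"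
    using finite_field_mult_group_has_gen by auto
  then have "g \<noteq> z" "UNIV - {z} = {((\<lambda>x. mul x g) ^^ i) e |i. True}" unfolding pow by simp_all
  then show ?thesis by blast
qed

context char2_field
begin

lemma multiplicative_generator: "\<exists>l::'a. l \<noteq> 0 \<and> (\<forall>x. x \<noteq> 0 \<longrightarrow> (\<exists>i. x = l ^ i))"
proof -
  let ?R = "\<lparr>carrier = UNIV, monoid.mult = (*), one = 1, ring.zero = 0, add = (+)\<rparr> :: 'a ring"
  have ex: "\<exists>y. y + x = 0" "\<exists>y. x + y = 0" for x :: 'a by (rule exI[of _ x], simp)+
  interpret cring ?R
    by (intro cringI abelian_groupI comm_monoidI) (auto simp: algebra_simps ex)
  have "field ?R"
  proof (rule cring_fieldI)
    show "Units ?R = carrier ?R - {\<zero>\<^bsub>?R\<^esub>}"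
      unfolding Units_def by (auto intro: exI[of _ "1 / _"])
  qed
  then obtain l :: 'a where l: "l \<noteq> 0" "\<And>x. x \<noteq> 0 \<Longrightarrow> \<exists>i. x = ((\<lambda>x. x * l) ^^ i) 1"
    using field_cyclic by blast
  have "((\<lambda>x. x * l) ^^ i) 1 = l ^ i" for i by (induction i) (simp_all add: mult.commute)
  then show ?thesis using l by auto
qed

text \<open>\<open>c\<close> is a root of X^2 + b X + 1, whose powers satisfy the recurrence of
  \<open>lucas\<close>; evaluation at \<open>c\<close> thus turns Lucas vectors into powers.\<close>

lemma lucas_eval:
  assumes c: "b * c = c * c + 1"
  shows "fst (lucas b i) + snd (lucas b i) * c = c ^ i"
proof (induction i rule: induct_nat_012)
  case (ge2 i)
  have "fst (lucas b (Suc (Suc i))) + snd (lucas b (Suc (Suc i))) * c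
      = (fst (lucas b i) + snd (lucas b i) * c) + b * (fst (lucas b (Suc i)) + snd (lucas b (Suc i)) * c)"
    by (simp add: algebra_simps)
  also have "\<dots> = c ^ i + c ^ i * (b * c)" unfolding ge2 by (simp add: algebra_simps)
  also have "\<dots> = c ^ Suc (Suc i)" unfolding c by (simp add: algebra_simps)
  finally show ?case .
qed simp_all

text \<open>With b = l + 1/l the form factors as (x + y l)(x + y/l). For norm 1 the factors are
  inverse to each other and the first is a power of the generator \<open>l\<close>; together they
  determine \<open>x\<close> and \<open>y\<close>, since l and 1/l differ.\<close>

lemma split_rotation: "\<exists>l::'a. l \<noteq> 0 \<and> l * l \<noteq> 1 \<and> full_rotation (l + 1 / l)"
proof -
  obtain l :: 'a where l: "l \<noteq> 0" "\<And>x. x \<noteq> 0 \<Longrightarrow> \<exists>i. x = l ^ i" using multiplicative_generator by blast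
  obtain t :: 'a where t: "t \<notin> {0, 1}" using avoid[of "{0, 1}"] by auto
  have l1: "l \<noteq> 1" using l(2)[of t] t by auto
  have ll: "l * l \<noteq> 1" using square_inj[of l 1] l1 by auto
  let ?b = "l + 1 / l"
  have bl: "?b * l = l * l + 1" "?b * (1 / l) = 1 + (1 / l) * (1 / l)" using l(1) by (simp_all add: algebra_simps)
  have "full_rotation ?b"
    unfolding full_rotation_def
  proof (intro allI impI)
    fix x y assume "x * x + ?b * x * y + y * y = 1"
    moreover have "(x + y * l) * (x + y * (1 / l)) = x * x + ?b * x * y + y * y"
      using l(1) by (simp add: algebra_simps)
    ultimately have prod: "(x + y * l) * (x + y * (1 / l)) = 1" by simp
    then have "x + y * l \<noteq> 0" by auto
    then obtain i where i: "x + y * l = l ^ i" using l(2) by blast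
    have inv: "(1 / l) ^ i * l ^ i = 1" using l(1) by (simp add: power_divide)
    have "x + y * (1 / l) = ((1 / l) ^ i * l ^ i) * (x + y * (1 / l))" unfolding inv by simp
    also have "\<dots> = (1 / l) ^ i * (l ^ i * (x + y * (1 / l)))" by (simp only: mult.assoc)
    also have "\<dots> = (1 / l) ^ i" using prod unfolding i by simp
    finally have i': "x + y * (1 / l) = (1 / l) ^ i" .
    obtain p q where pq: "lucas ?b i = (p, q)" by force
    have e: "p + q * l = x + y * l" "p + q * (1 / l) = x + y * (1 / l)"
      using lucas_eval[of ?b l i] lucas_eval[of ?b "1 / l" i] bl i i' pq by (simp_all add: add_ac)
    have "(q + y) * (l + 1 / l) = (p + q * l) + (p + q * (1 / l)) + ((x + y * l) + (x + y * (1 / l)))"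
      by (simp add: algebra_simps add_divide_distrib)
    then have "(q + y) * (l + 1 / l) = 0" unfolding e by simp
    moreover have "l + 1 / l \<noteq> 0" using ll l(1) by (auto simp: add_eq_zero_iff field_simps)
    ultimately have "q = y" by (simp add: add_eq_zero_iff)
    moreover from this have "p = x" using e(1) by simp
    ultimately have "(x, y) = lucas ?b i" using pq by simp
    then show "\<exists>i. (x, y) = lucas ?b i" ..
  qed
  then show ?thesis using l(1) ll by blast
qed

text \<open>The map s^2 + s takes the same value at 0 and 1, so on a finite field it is not
  onto.\<close>

lemma irreducible_exists: "\<exists>d::'a. \<forall>s. s * s + s \<noteq> d"
proof (rule ccontr)
  assume "\<not> ?thesis"
  then have "\<exists>s. d = s * s + s" for d :: 'a by metis
  then have "surj (\<lambda>s::'a. s * s + s)" unfolding surj_def by blast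
  then have "inj (\<lambda>s::'a. s * s + s)" by (rule finite_UNIV_surj_inj[OF finite])
  then show False using injD[of "\<lambda>s::'a. s * s + s" 0 1] by simp
qed

text \<open>For b = 1 the Lucas vectors repeat with period 3, but the normalized
  \<open>(t, 1)\<close> with \<open>t\<close> different from 0 and 1 is a fourth unit
  vector.\<close>

lemma full_anisotropic_neq_one: "full_rotation b \<Longrightarrow> anisotropic b \<Longrightarrow> b \<noteq> (1::'a)"
proof
  assume full: "full_rotation b" and anis: "anisotropic b" and b: "b = 1"
  obtain t :: 'a where t: "t \<notin> {0, 1}" using avoid[of "{0, 1}"] by auto
  define n where "n = rt (t * t + t + 1)"
  have "t * t + b * t * 1 + 1 * 1 \<noteq> 0" using anis[unfolded anisotropic_def, rule_format, of t 1] by auto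
  then have n0: "n \<noteq> 0" and nn: "n * n = t * t + t + 1" unfolding n_def b by auto
  have "(t / n) * (t / n) + b * (t / n) * (1 / n) + (1 / n) * (1 / n) = (t * t + t + 1) / (n * n)"
    unfolding b by (simp add: add_divide_distrib)
  also have "\<dots> = 1" unfolding nn[symmetric] using n0 by simp
  finally have "(t / n) * (t / n) + b * (t / n) * (1 / n) + (1 / n) * (1 / n) = 1" .
  then obtain i where i: "(t / n, 1 / n) = lucas b i" using full unfolding full_rotation_def by blast
  have per: "lucas b (i + 3) = lucas b i" for i
    unfolding b by (simp add: numeral_3_eq_3 prod_eq_iff add_ac)
  have "lucas b (i + 3 * k) = lucas b i" for i k
  proof (induction k)
    case (Suc k)
    have "i + 3 * Suc k = (i + 3 * k) + 3" by simp
    then show ?case using per Suc by metis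
  qed simp
  then have "lucas b i = lucas b (i mod 3)" by (metis mod_mult_div_eq)
  moreover have "i mod 3 = 0 \<or> i mod 3 = 1 \<or> i mod 3 = 2" by linarith
  ultimately have "(t / n, 1 / n) \<in> {(1, 0), (0, 1), (1, 1)}"
    using i unfolding b by (auto simp: numeral_2_eq_2)
  then show False using t n0 by auto
qed

text \<open>
  The plane is the quadratic extension \<open>{x + y * \<theta>}\<close>, \<open>\<theta>\<^sup>2 = \<theta> + d\<close>, with its norm form; the elements of norm 1
  form a subgroup of the cyclic multiplicative group.
\<close>
lemma nonsplit_rotation:
  fixes d :: 'a
  assumes irr: "\<And>s. s * s + s \<noteq> d"
  shows "\<exists>x y. x * x + x * y + d * y * y = 1 \<and> y \<noteq> 0 \<and> full_rotation y \<and> anisotropic y"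
proof -
  define mul :: "'a \<times> 'a \<Rightarrow> 'a \<times> 'a \<Rightarrow> 'a \<times> 'a" where
    "mul = (\<lambda>(x, y) (x', y'). (x * x' + d * y * y', x * y' + x' * y + y * y'))"
  define N :: "'a \<times> 'a \<Rightarrow> 'a" where "N = (\<lambda>(x, y). x * x + x * y + d * y * y)"
  have mul: "mul (x, y) (x', y') = (x * x' + d * y * y', x * y' + x' * y + y * y')" for x y x' y'
    unfolding mul_def by simp
  have N: "N (x, y) = x * x + x * y + d * y * y" for x y unfolding N_def by simp
  have Nmul: "N (mul a b) = N a * N b" for a b
    by (cases a; cases b) (simp add: mul N algebra_simps)
  have N0: "a = (0, 0)" if "N a = 0" for a
  proof (cases a)
    case (Pair x y)
    show ?thesis
    proof (cases "y = 0")
      case True then show ?thesis using that Pair N by simp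
    next
      case False
      have "x * x + x * y = d * y * y" using that Pair N by (simp add: add_eq_zero_iff)
      then have "(x / y) * (x / y) + x / y = d" using False by (simp add: field_simps)
      then show ?thesis using irr by blast
    qed
  qed
  let ?R = "\<lparr>carrier = UNIV, monoid.mult = mul, one = (1, 0), ring.zero = (0, 0), add = (+)\<rparr> :: ('a \<times> 'a) ring"
  have ex: "\<exists>y. y + x = 0" "\<exists>y. x + y = 0" for x :: 'a by (rule exI[of _ x], simp)+
  interpret cring ?R
  proof (intro cringI abelian_groupI comm_monoidI)
  qed (auto simp: mul ex algebra_simps plus_prod_def split: prod.splits)
  have inv: "\<exists>b. mul a b = (1, 0) \<and> mul b a = (1, 0)" if "a \<noteq> (0, 0)" for a
  proof (cases a)
    case (Pair x y)
    have n: "N a \<noteq> 0" using N0 that by blast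
    \<comment> \<open>The conjugate of \<open>x + y * \<theta>\<close> is
      \<open>(x + y) + y * \<theta>\<close>; dividing it by the norm gives the inverse.\<close>
    have "mul a ((x + y) / N a, y / N a) = ((x * x + x * y + d * y * y) / N a, 0)"
      unfolding Pair mul by (simp add: add_divide_distrib[symmetric] algebra_simps)
    then have "mul a ((x + y) / N a, y / N a) = (1, 0)" using n unfolding Pair N by simp
    moreover have "mul ((x + y) / N a, y / N a) a = mul a ((x + y) / N a, y / N a)"
      unfolding Pair mul by (simp add: algebra_simps)
    ultimately show ?thesis by metis
  qed
  have "field ?R"
  proof (rule cring_fieldI)
    have "mul a (0, 0) = (0, 0)" for a by (cases a) (simp add: mul)
    moreover have "mul b a = mul a b" for a b using m_comm[of a b] by simp
    ultimately have "(\<exists>b. mul b a = (1, 0) \<and> mul a b = (1, 0)) \<longleftrightarrow> a \<noteq> (0, 0)" for a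
      using inv[of a] by (metis prod.inject zero_neq_one)
    then show "Units ?R = carrier ?R - {\<zero>\<^bsub>?R\<^esub>}"
      unfolding Units_def by (simp add: set_eq_iff)
  qed
  then obtain g where g: "g \<noteq> (0, 0)" "\<And>a. a \<noteq> (0, 0) \<Longrightarrow> \<exists>i. a = ((\<lambda>x. mul x g) ^^ i) (1, 0)"
    using field_cyclic by blast
  define pw where "pw h i = ((\<lambda>x. mul x h) ^^ i) (1, 0)" for h and i :: nat
  have pw0: "pw h 0 = (1, 0)" and pwS: "pw h (Suc i) = mul (pw h i) h" for h i unfolding pw_def by simp_all
  have assoc: "mul (mul a b) c = mul a (mul b c)" for a b c using m_assoc[of a b c] by simp
  have comm: "mul a b = mul b a" for a b using m_comm[of a b] by simp
  have one: "mul a (1, 0) = a" "mul (1, 0) a = a" for a by (cases a, simp add: mul)+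
  have pw_add: "pw h (i + j) = mul (pw h i) (pw h j)" for h i j
    by (induction j) (simp_all add: pw0 pwS one assoc)
  have pw_mult: "pw h (i * j) = pw (pw h i) j" for h i j
    by (induction j) (simp_all add: pw0 pwS pw_add comm)
  have Npw: "N (pw h i) = N h ^ i" for h i
    by (induction i) (simp_all add: pw0 pwS Nmul N mult.commute)
  have gen: "\<exists>i. a = pw g i" if "a \<noteq> (0, 0)" for a using g(2)[OF that] unfolding pw_def .
  have "\<exists>i>0. N (pw g i) = 1"
  proof -
    obtain h where h: "mul h g = (1, 0)" using inv[OF g(1)] by blast
    have "h \<noteq> (0, 0)" using h by (cases g) (auto simp: mul)
    then obtain i where "h = pw g i" using gen by blast
    then have "pw g (Suc i) = (1, 0)" using h by (simp add: pwS)
    then show ?thesis using N by (intro exI[of _ "Suc i"]) simp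
  qed
  then have ex: "\<exists>i. 0 < i \<and> N (pw g i) = 1" by blast
  \<comment> \<open>The exponents of \<open>g\<close> with norm 1 are the multiples of the least
    positive one, by division with remainder. So \<open>c\<close> generates the group of norm
    1.\<close>
  define i0 where "i0 = (LEAST i. 0 < i \<and> N (pw g i) = 1)"
  have i0: "0 < i0" "N (pw g i0) = 1" using LeastI_ex[OF ex] unfolding i0_def by auto
  define c where "c = pw g i0"
  have Cgen: "\<exists>t. a = pw c t" if a: "N a = 1" for a
  proof -
    have "a \<noteq> (0, 0)" using a by (auto simp: N)
    then obtain i where i: "a = pw g i" using gen by blast
    have "i = i0 * (i div i0) + i mod i0" by simp
    then have ai: "a = mul (pw c (i div i0)) (pw g (i mod i0))"
      unfolding i c_def pw_mult[symmetric] pw_add[symmetric] by simp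
    have "N c = 1" using i0(2) unfolding c_def .
    moreover have "N a = N c ^ (i div i0) * N (pw g (i mod i0))"
      using arg_cong[OF ai, of N] by (simp only: Nmul Npw[of c])
    ultimately have "N (pw g (i mod i0)) = 1" using a by simp
    then have "i mod i0 = 0"
      using not_less_Least[of "i mod i0" "\<lambda>i. 0 < i \<and> N (pw g i) = 1"] i0(1) unfolding i0_def[symmetric] by auto
    then show ?thesis using ai by (auto simp: pw0 one)
  qed
  obtain x y where c: "c = (x, y)" by force
  have Nc: "x * x + x * y + d * y * y = 1" using i0(2) unfolding c_def[symmetric] c N .
  have y0: "y \<noteq> 0"
  proof
    assume "y = 0"
    then have "x * x = 1 * 1" using Nc by simp
    then have "x = 1" by (rule square_inj)
    then have "c = (1, 0)" using c \<open>y = 0\<close> by simp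
    then have "pw c t = (1, 0)" for t by (induction t) (simp_all add: pw0 pwS one)
    then have C1: "a = (1, 0)" if "N a = 1" for a using Cgen[OF that] by auto
    have "d \<noteq> 0" using irr[of 0] by auto
    \<comment> \<open>If \<open>y\<close> were 0, then \<open>c\<close> would be 1 and the group of
      norm 1 trivial; this element contradicts that.\<close>
    then have "N (1, 1 / d) = 1" by (simp add: N)
    then have "(1 :: 'a, 1 / d) = (1, 0)" by (rule C1)
    then show False using \<open>d \<noteq> 0\<close> by simp
  qed
  \<comment> \<open>\<open>comb (p, q)\<close> is p + q c. As \<open>c\<close> has norm 1 and trace
    \<open>y\<close>, the norm in these coordinates is p^2 + y p q + q^2.\<close>
  define comb where "comb = (\<lambda>(p, q). (p + q * x, q * y))"
  have comb: "comb (p, q) = (p + q * x, q * y)" for p q unfolding comb_def by simp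
  have comb_inj: "a = a'" if "comb a = comb a'" for a a'
    using that y0 by (cases a; cases a') (auto simp: comb)
  have Ncomb: "N (comb (p, q)) = p * p + y * p * q + q * q" for p q
  proof -
    have "N (comb (p, q)) = p * p + y * p * q + q * q * (x * x + x * y + d * y * y)"
      unfolding comb N by (simp add: algebra_simps)
    then show ?thesis using Nc by simp
  qed
  \<comment> \<open>The quadratic equation c^2 = y c + 1, which makes the powers of \<open>c\<close>
    follow the Lucas recurrence.\<close>
  have cc: "mul c c = (y * x + 1, y * y)"
  proof -
    have "x * x + d * y * y = 1 + x * y"
      using Nc by (metis add.commute add.left_commute add_self_left)
    then show ?thesis unfolding c mul by (simp add: mult.commute add.commute)
  qed
  have pwl: "pw c i = comb (lucas y i)" for i
  proof (induction i rule: induct_nat_012)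
    case (ge2 i)
    have "pw c (Suc (Suc i)) = mul (pw c i) (mul c c)" by (simp add: pwS assoc)
    moreover have "pw c (Suc i) = mul (pw c i) c" by (simp add: pwS)
    moreover have "mul a (y * x + 1, y * y) = (fst a + y * fst (mul a c), snd a + y * snd (mul a c))" for a
      unfolding c by (cases a) (simp add: mul algebra_simps)
    ultimately have "pw c (Suc (Suc i)) = (fst (pw c i) + y * fst (pw c (Suc i)), snd (pw c i) + y * snd (pw c (Suc i)))"
      unfolding cc by simp
    then show ?case unfolding ge2 by (simp add: comb_def algebra_simps split: prod.splits)
  qed (simp_all add: pw0 pwS one comb c)
  have "full_rotation y"
    unfolding full_rotation_def
  proof (intro allI impI)
    fix p q assume "p * p + y * p * q + q * q = 1"
    then have "N (comb (p, q)) = 1" by (simp add: Ncomb)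
    then obtain i where "comb (p, q) = comb (lucas y i)" using Cgen pwl by metis
    then show "\<exists>i. (p, q) = lucas y i" using comb_inj by blast
  qed
  moreover have "anisotropic y"
    unfolding anisotropic_def
  proof (intro allI impI)
    fix p q assume "p * p + y * p * q + q * q = 0"
    then have "comb (p, q) = (0, 0)" using N0 Ncomb by metis
    then show "p = 0 \<and> q = 0" using y0 by (auto simp: comb)
  qed
  ultimately show ?thesis using Nc y0 by blast
qed

lemma anisotropic_rotation: "\<exists>b::'a. b \<noteq> 0 \<and> b \<noteq> 1 \<and> full_rotation b \<and> anisotropic b"
  using irreducible_exists nonsplit_rotation full_anisotropic_neq_one by metis

end

context quadratic_space
begin

text \<open>If a singular vector exists, a hyperbolic pair \<open>z\<close>, \<open>f\<close> is
  completed and \<open>split_rotation\<close> applies. Otherwise a unit vector \<open>p\<close> and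
  a partner \<open>u\<close> span an anisotropic plane: a solution of s^2 + s = \<phi> u would make
  \<open>s *s p + u\<close> singular, so \<open>nonsplit_rotation\<close> applies with
  \<open>d = \<phi> u\<close>.\<close>

lemma rotation_plane:
  assumes nondeg: "\<And>x. (\<And>y. B x y = 0) \<Longrightarrow> x = 0" and ne: "\<exists>x::'a^'k. x \<noteq> 0"
  shows "\<exists>v1 v2. \<phi> v1 = 1 \<and> \<phi> v2 = 1 \<and> B v1 v2 \<noteq> 0 \<and> full_rotation (B v1 v2)"
proof -
  have partner: "\<exists>y. B x y = 1" if x: "x \<noteq> 0" for x
  proof -
    obtain y where "B x y \<noteq> 0" using nondeg x by blast
    then have "B x ((1 / B x y) *s y) = 1" by (simp add: bilin)
    then show ?thesis by blast
  qed
  show ?thesis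
  proof (cases "\<exists>z. z \<noteq> 0 \<and> \<phi> z = 0")
    case True
    then obtain z where z: "z \<noteq> 0" "\<phi> z = 0" by blast
    obtain y where y: "B z y = 1" using partner[OF z(1)] by blast
    define f where "f = y + \<phi> y *s z"
    have f: "\<phi> f = 0" "B z f = 1" "B f z = 1"
      unfolding f_def using z y B_sym[of y z] by (simp_all add: phi_add phi_scale bilin)
    obtain l :: 'a where l: "l \<noteq> 0" "l * l \<noteq> 1" "full_rotation (l + 1 / l)" using split_rotation by blast
    let ?v1 = "z + f" and ?v2 = "l *s z + (1 / l) *s f"
    have "\<phi> ?v1 = 1" "\<phi> ?v2 = 1" using z f l by (simp_all add: phi_add phi_scale bilin)
    moreover have "B ?v1 ?v2 = l + 1 / l" using f by (simp add: bilin add.commute)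
    moreover have "l + 1 / l \<noteq> 0" using l by (auto simp: add_eq_zero_iff field_simps)
    ultimately show ?thesis using l(3) by metis
  next
    case False
    obtain x :: "'a^'k" where x: "x \<noteq> 0" using ne by blast
    define p where "p = (1 / rt (\<phi> x)) *s x"
    have p: "\<phi> p = 1" unfolding p_def using scaled_unit False x by blast
    then have "p \<noteq> 0" by auto
    then obtain u where u: "B p u = 1" using partner by blast
    have irr: "s * s + s \<noteq> \<phi> u" for s
    proof
      assume "s * s + s = \<phi> u"
      moreover have "\<phi> (s *s p + u) = (s * s + s) + \<phi> u"
        using p u B_sym[of u p] by (simp add: phi_add phi_scale bilin add_ac)
      ultimately have "\<phi> (s *s p + u) = 0" by simp
      moreover have "s *s p + u \<noteq> 0" using u B_zero(2)[of p] by (auto simp: bilin dest!: arg_cong[of _ _ "B p"])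
      ultimately show False using False by blast
    qed
    obtain x y where xy: "x * x + x * y + \<phi> u * y * y = 1" "y \<noteq> 0" "full_rotation y"
      using nonsplit_rotation[of "\<phi> u"] irr by blast
    have "\<phi> (x *s p + y *s u) = 1" using p u xy(1) by (simp add: phi_add phi_scale bilin algebra_simps)
    moreover have "B p (x *s p + y *s u) = y" using u by (simp add: bilin)
    ultimately show ?thesis using p xy by metis
  qed
qed

end

section \<open>Construction of path bases\<close>

text \<open>Independence makes \<open>L\<close> injective on coefficient families; there are as many
  of them as vectors, so \<open>L\<close> is onto.\<close>

lemma basis_coordinates:
  fixes v :: "nat \<Rightarrow> 'a::{field,finite}^'k"
  assumes indep: "\<And>c. (\<Sum>i=1..CARD('k). c i *s v i) = 0 \<Longrightarrow> \<forall>i\<in>{1..CARD('k)}. c i = 0"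
  obtains coord where
    "\<And>x. x = (\<Sum>i=1..CARD('k). coord i x *s v i)"
    "\<And>i x y. i \<in> {1..CARD('k)} \<Longrightarrow> coord i (x + y) = coord i x + coord i y"
    "\<And>i c x. i \<in> {1..CARD('k)} \<Longrightarrow> coord i (c *s x) = c * coord i x"
    "\<And>i j. i \<in> {1..CARD('k)} \<Longrightarrow> j \<in> {1..CARD('k)} \<Longrightarrow> coord i (v j) = (if i = j then 1 else 0)"
proof -
  let ?I = "{1..CARD('k)}"
  define L where "L c = (\<Sum>i\<in>?I. c i *s v i)" for c
  have uniq: "c i = d i" if "L c = L d" "i \<in> ?I" for c d i
  proof -
    have "(\<Sum>i\<in>?I. (c i - d i) *s v i) = L c - L d"
      unfolding L_def by (simp add: sum_subtractf vec.scale_left_diff_distrib)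
    then show ?thesis using indep[of "\<lambda>i. c i - d i"] that by auto
  qed
  have inj: "inj_on L (?I \<rightarrow>\<^sub>E UNIV)" using uniq by (intro inj_onI PiE_ext) auto
  have "card (L ` (?I \<rightarrow>\<^sub>E UNIV)) = CARD('a^'k)"
    unfolding card_image[OF inj] by (simp add: card_PiE)
  then have surj: "L ` (?I \<rightarrow>\<^sub>E UNIV) = UNIV" by (intro card_subset_eq) auto
  define coord where "coord i x = (SOME c. L c = x) i" for i x
  have expand: "L (\<lambda>i. coord i x) = x" for x
  proof -
    have "\<exists>c. L c = x" using surj by (metis UNIV_I imageE)
    then show ?thesis unfolding coord_def by (rule someI_ex)
  qed
  show thesis
  proof (rule that[of coord])
    show "x = (\<Sum>i=1..CARD('k). coord i x *s v i)" for x using expand[of x] unfolding L_def by simp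
    show "coord i (x + y) = coord i x + coord i y" if "i \<in> ?I" for i x y
    proof (rule uniq[OF _ that])
      have "L (\<lambda>i. coord i x + coord i y) = L (\<lambda>i. coord i x) + L (\<lambda>i. coord i y)"
        unfolding L_def by (simp add: vec.scale_left_distrib sum.distrib)
      then show "L (\<lambda>i. coord i (x + y)) = L (\<lambda>i. coord i x + coord i y)" unfolding expand by simp
    qed
    show "coord i (c *s x) = c * coord i x" if "i \<in> ?I" for i c x
    proof (rule uniq[OF _ that])
      have "L (\<lambda>i. c * coord i x) = c *s L (\<lambda>i. coord i x)"
        unfolding L_def by (simp add: vec.scale_sum_right vector_smult_assoc)
      then show "L (\<lambda>i. coord i (c *s x)) = L (\<lambda>i. c * coord i x)" unfolding expand by simp
    qed
    show "coord i (v j) = (if i = j then 1 else 0)" if i: "i \<in> ?I" and j: "j \<in> ?I" for i j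
    proof (rule uniq[OF _ i])
      have "L (\<lambda>i. if i = j then 1 else 0) = (\<Sum>i\<in>?I. if i = j then v i else 0)"
        unfolding L_def by (rule sum.cong) auto
      then show "L (\<lambda>i. coord i (v j)) = L (\<lambda>i. if i = j then 1 else 0)" unfolding expand using j by simp
    qed
  qed
qed

section \<open>Linear independence of path vectors\<close>

context char2_field
begin

lemma of_nat_cases: "(of_nat m :: 'a) = 0 \<or> (of_nat m :: 'a) = 1"
  by (induction m) auto

end

context quadratic_space
begin

lemma B_sum_right: "finite S \<Longrightarrow> B y (\<Sum>i\<in>S. w i) = (\<Sum>i\<in>S. B y (w i))"
  by (induction S rule: finite_induct) (simp_all add: bilin)

text \<open>Pairing the relation with \<open>v j\<close> leaves only the two neighbours of
  \<open>j\<close>; the conditionals cover the ends of the path.\<close>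

lemma path_pairing:
  assumes far: "\<And>i j. 1 \<le> i \<Longrightarrow> i + 2 \<le> j \<Longrightarrow> j \<le> n \<Longrightarrow> B (v i) (v j) = 0"
    and zero: "(\<Sum>i=1..n. c i *s v i) = 0" and j: "1 \<le> j" "j \<le> n"
  shows "(if 1 < j then c (j - 1) * B (v (j - 1)) (v j) else 0) + (if j < n then c (Suc j) * B (v j) (v (Suc j)) else 0) = 0"
proof -
  have far': "B (v i) (v j) = 0" if i: "i \<in> {1..n}" "i \<noteq> j - 1" "i \<noteq> Suc j" for i
  proof -
    consider "i = j" | "i + 2 \<le> j" | "j + 2 \<le> i" using i by linarith
    then show ?thesis using far[of i j] far[of j i] i j B_sym[of "v i"] by cases auto
  qed
  have "0 = (\<Sum>i=1..n. c i * B (v i) (v j))" using B_lincomb[of "{1..n}" c v "v j"] zero by simp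
  also have "\<dots> = (\<Sum>i\<in>{j - 1, Suc j} \<inter> {1..n}. c i * B (v i) (v j))"
  proof (rule sum.mono_neutral_right)
    show "\<forall>i\<in>{1..n} - {j - 1, Suc j} \<inter> {1..n}. c i * B (v i) (v j) = 0"
    proof
      fix i assume "i \<in> {1..n} - {j - 1, Suc j} \<inter> {1..n}"
      then have "B (v i) (v j) = 0" by (intro far') auto
      then show "c i * B (v i) (v j) = 0" by simp
    qed
  qed auto
  also have "{j - 1, Suc j} \<inter> {1..n} = (if 1 < j then {j - 1} else {}) \<union> (if j < n then {Suc j} else {})"
    using j by auto
  also have "(\<Sum>i\<in>\<dots>. c i * B (v i) (v j)) =
      (if 1 < j then c (j - 1) * B (v (j - 1)) (v j) else 0) + (if j < n then c (Suc j) * B (v j) (v (Suc j)) else 0)"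
    using B_sym[of "v j"] by auto
  finally show ?thesis by simp
qed

text \<open>Pairing with \<open>v 1\<close> leaves only \<open>c 2\<close>; pairing with
  \<open>v 3, v 5, ...\<close> passes the vanishing on by two indices each time.\<close>

lemma path_even_zero:
  assumes far: "\<And>i j. 1 \<le> i \<Longrightarrow> i + 2 \<le> j \<Longrightarrow> j \<le> n \<Longrightarrow> B (v i) (v j) = 0"
    and adj: "\<And>i. 1 \<le> i \<Longrightarrow> i < n \<Longrightarrow> B (v i) (v (Suc i)) \<noteq> 0"
    and zero: "(\<Sum>i=1..n. c i *s v i) = 0"
  shows "2 * i + 2 \<le> n \<Longrightarrow> c (2 * i + 2) = 0"
proof (induction i)
  case 0
  then show ?case using path_pairing[OF far zero, of 1] adj[of 1] by (simp add: numeral_2_eq_2)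
next
  case (Suc i)
  have "c (2 * i + 2) = 0" using Suc by simp
  then show ?case using path_pairing[OF far zero, of "2 * i + 3"] adj[of "2 * i + 3"] Suc.prems
    by (simp add: numeral_eq_Suc)
qed

text \<open>The odd coefficients are treated from the other end: as \<open>n\<close> is even,
  pairing with \<open>v n\<close> starts at the odd index \<open>n - 1\<close>.\<close>

lemma even_path_independent:
  assumes far: "\<And>i j. 1 \<le> i \<Longrightarrow> i + 2 \<le> j \<Longrightarrow> j \<le> n \<Longrightarrow> B (v i) (v j) = 0"
    and adj: "\<And>i. 1 \<le> i \<Longrightarrow> i < n \<Longrightarrow> B (v i) (v (Suc i)) \<noteq> 0"
    and zero: "(\<Sum>i=1..n. c i *s v i) = 0" and even: "n = 2 * m"
  shows "\<forall>i\<in>{1..n}. c i = 0"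
proof
  have odd: "2 * i + 1 \<le> n \<Longrightarrow> c (n - (2 * i + 1)) = 0" for i
  proof (induction i)
    case 0
    then show ?case using path_pairing[OF far zero, of n] adj[of "n - 1"] even by (cases m) auto
  next
    case (Suc i)
    let ?j = "n - (2 * i + 2)"
    have im: "i + 2 \<le> m" using Suc.prems even by presburger
    have e: "?j - 1 = n - (2 * Suc i + 1)" "Suc ?j = n - (2 * i + 1)" "1 < ?j" "?j < n"
      using Suc.prems im even by auto
    have "c (Suc ?j) = 0" using Suc e by simp
    then have "c (?j - 1) * B (v (?j - 1)) (v ?j) = 0" using path_pairing[OF far zero, of ?j] e by simp
    moreover have "Suc (?j - 1) = ?j" using e by simp
    then have "B (v (?j - 1)) (v ?j) \<noteq> 0" using adj[of "?j - 1"] e by simp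
    ultimately show ?case unfolding e(1)[symmetric] by simp
  qed
  fix i assume i: "i \<in> {1..n}"
  show "c i = 0"
  proof (cases "even i")
    case True
    then obtain k where "i = 2 * k" by (rule evenE)
    then show ?thesis using path_even_zero[OF far adj zero, of "k - 1"] i by (cases k) auto
  next
    case False
    then obtain k where k: "i = 2 * k + 1" by (rule oddE)
    have "n - (2 * (m - k - 1) + 1) = i" "2 * (m - k - 1) + 1 \<le> n" using i even k by auto
    then show ?thesis using odd[of "m - k - 1"] by simp
  qed
qed

text \<open>On a path of odd length the products alone do not exclude a relation: pairing leaves
  \<open>c 1 = c 3 * b\<close> and all other odd coefficients equal to \<open>c 3\<close>. Applying
  \<open>\<phi>\<close> to what remains gives c3^2 (b^2 + m) = 0, where \<open>m\<close> counts as 0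
  or 1 and b is neither.\<close>

lemma odd_path_independent:
  assumes far: "\<And>i j. 1 \<le> i \<Longrightarrow> i + 2 \<le> j \<Longrightarrow> j \<le> n \<Longrightarrow> B (v i) (v j) = 0"
    and unit: "\<And>i. 1 \<le> i \<Longrightarrow> i \<le> n \<Longrightarrow> \<phi> (v i) = 1"
    and b: "B (v 1) (v 2) = 1" "B (v 2) (v 3) = b" "b \<noteq> 0" "b \<noteq> 1"
    and one: "\<And>i. 3 \<le> i \<Longrightarrow> i < n \<Longrightarrow> B (v i) (v (Suc i)) = 1"
    and zero: "(\<Sum>i=1..n. c i *s v i) = 0" and n: "n = 2 * m + 1" "1 \<le> m"
  shows "\<forall>i\<in>{1..n}. c i = 0"
proof -
  have adj: "B (v i) (v (Suc i)) \<noteq> 0" if i: "1 \<le> i" "i < n" for i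
  proof -
    consider "i = 1" | "i = 2" | "3 \<le> i" using i by linarith
    then show ?thesis using b one[of i] i by cases (auto simp: numeral_eq_Suc)
  qed
  have ev: "c (2 * i + 2) = 0" if "2 * i + 2 \<le> n" for i
    by (rule path_even_zero[OF far adj zero that])
  have c3: "c 1 = c 3 * b" using path_pairing[OF far zero, of 2] b n
    by (simp add: numeral_eq_Suc add_eq_zero_iff)
  have od: "2 * i + 3 \<le> n \<Longrightarrow> c (2 * i + 3) = c 3" for i
  proof (induction i)
    case (Suc i)
    have "c (2 * i + 3) + c (2 * i + 5) = 0"
      using path_pairing[OF far zero, of "2 * i + 4"] one[of "2 * i + 3"] one[of "2 * i + 4"] Suc.prems
      by (simp add: numeral_eq_Suc)
    then show ?case using Suc by (simp add: add_eq_zero_iff numeral_eq_Suc)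
  qed simp
  define S where "S k = (\<Sum>i=1..k. v (2 * i + 1))" for k
  have part: "2 * k + 1 \<le> n \<Longrightarrow> (\<Sum>i=1..2 * k + 1. c i *s v i) = c 1 *s v 1 + c 3 *s S k" for k
  proof (induction k)
    case 0 then show ?case unfolding S_def by simp
  next
    case (Suc k)
    have "c (2 * k + 2) = 0" "c (2 * k + 3) = c 3" using ev[of k] od[of k] Suc.prems by auto
    then show ?case using Suc unfolding S_def by (simp add: vector_add_ldistrib add.assoc numeral_eq_Suc)
  qed
  have BS: "B (v j) (S k) = 0" if "odd j" "1 \<le> j" "j \<le> n" "2 * k + 1 \<le> n" for j k
    unfolding S_def
  proof (subst B_sum_right, simp, rule sum.neutral, rule ballI)
    fix i assume i: "i \<in> {1..k}"
    have "j = 2 * i + 1 \<or> j + 2 \<le> 2 * i + 1 \<or> 2 * i + 1 + 2 \<le> j" using that(1) by presburger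
    then show "B (v j) (v (2 * i + 1)) = 0"
      using far[of j "2 * i + 1"] far[of "2 * i + 1" j] B_sym[of "v j"] i that by auto
  qed
  have "2 * k + 1 \<le> n \<Longrightarrow> \<phi> (S k) = of_nat k" for k
  proof (induction k)
    case 0 then show ?case unfolding S_def by simp
  next
    case (Suc k)
    have "S (Suc k) = v (2 * k + 3) + S k" unfolding S_def by (simp add: add.commute numeral_eq_Suc)
    then show ?case using Suc BS[of "2 * k + 3" k] unit[of "2 * k + 3"] by (simp add: phi_add)
  qed
  then have pS: "\<phi> (S m) = of_nat m" using n by simp
  have "c 1 *s v 1 + c 3 *s S m = 0" using part[of m] zero n by simp
  then have "\<phi> (c 1 *s v 1 + c 3 *s S m) = 0" by simp
  then have "c 1 * c 1 + c 3 * c 3 * of_nat m = 0"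
    using pS BS[of 1 m] unit[of 1] n by (simp add: phi_add phi_scale bilin)
  then have "c 3 * c 3 * (b * b + of_nat m) = 0" unfolding c3 by (simp add: algebra_simps)
  moreover have "b * b + of_nat m \<noteq> 0"
    using of_nat_cases[of m] b(3,4) square_inj[of b 1] by (auto simp: add_eq_zero_iff)
  ultimately have z: "c 3 = 0" by simp
  show ?thesis
  proof
    fix i assume i: "i \<in> {1..n}"
    consider k where "i = 2 * k + 2" | "i = 1" | k where "i = 2 * k + 3"
    proof (cases "even i")
      case True
      then obtain k where "i = 2 * k" by (rule evenE)
      then show ?thesis using that(1)[of "k - 1"] i by (cases k) auto
    next
      case False
      then obtain k where "i = 2 * k + 1" by (rule oddE)
      then show ?thesis using that(2) that(3)[of "k - 1"] by (cases k) auto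
    qed
    then show "c i = 0" using ev od z c3 i by cases auto
  qed
qed

section \<open>Hyperbolic systems and the paths built from them\<close>

definition hyperbolic :: "nat \<Rightarrow> (nat \<Rightarrow> 'a^'k) \<Rightarrow> (nat \<Rightarrow> 'a^'k) \<Rightarrow> bool"
  where "hyperbolic m e f \<longleftrightarrow> (\<forall>i<m. \<forall>j<m. B (e i) (e j) = 0 \<and> B (f i) (f j) = 0 \<and>
    B (e i) (f j) = (if i = j then 1 else 0))"

text \<open>There are more vectors than \<open>k\<close>-tuples of products, so two vectors have the
  same products with all \<open>y i\<close>, and their sum is orthogonal to them.\<close>

lemma common_perp:
  fixes y :: "nat \<Rightarrow> 'a^'k"
  assumes "k < CARD('k)"
  shows "\<exists>x. x \<noteq> 0 \<and> (\<forall>i<k. B x (y i) = 0)"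
proof -
  let ?h = "\<lambda>x. restrict (\<lambda>i. B x (y i)) {..<k}"
  have "card ({..<k} \<rightarrow>\<^sub>E (UNIV::'a set)) < CARD('a^'k)"
    using assms card_ge4 by (simp add: card_PiE)
  moreover have "?h ` UNIV \<subseteq> {..<k} \<rightarrow>\<^sub>E UNIV" by (auto split: if_splits)
  then have "card (range ?h) \<le> card ({..<k} \<rightarrow>\<^sub>E (UNIV::'a set))" by (intro card_mono finite_PiE) auto
  ultimately have "\<not> inj ?h" using card_image[of ?h UNIV] by auto
  then obtain x x' where x: "x \<noteq> x'" "?h x = ?h x'" unfolding inj_def by blast
  have "B (x + x') (y i) = 0" if "i < k" for i
    using fun_cong[OF x(2), of i] that by (simp add: bilin)
  then show ?thesis using x(1) by (intro exI[of _ "x + x'"]) (simp add: vec_add_eq_zero_iff)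
qed

text \<open>The projection to the orthogonal complement of a hyperbolic system, without signs in
  characteristic 2.\<close>

definition perp_part :: "nat \<Rightarrow> (nat \<Rightarrow> 'a^'k) \<Rightarrow> (nat \<Rightarrow> 'a^'k) \<Rightarrow> 'a^'k \<Rightarrow> 'a^'k"
  where "perp_part m e f y = y + (\<Sum>i<m. B y (f i) *s e i + B y (e i) *s f i)"

lemma perp_part:
  assumes h: "hyperbolic m e f" and j: "j < m"
  shows "B (perp_part m e f y) (e j) = 0" "B (perp_part m e f y) (f j) = 0"
proof -
  have fe: "B (f j) (e i) = (if i = j then 1 else 0)" if "i < m" for i
    using h j that B_sym[of "f j"] unfolding hyperbolic_def by auto
  have "B (\<Sum>i<m. B y (f i) *s e i + B y (e i) *s f i) (e j)
      = (\<Sum>i<m. B (e j) (B y (f i) *s e i + B y (e i) *s f i))"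
    by (subst B_sym) (simp add: B_sum_right)
  also have "\<dots> = (\<Sum>i<m. if i = j then B y (e i) else 0)"
    by (rule sum.cong) (use h j fe in \<open>auto simp: bilin hyperbolic_def\<close>)
  finally show "B (perp_part m e f y) (e j) = 0" unfolding perp_part_def using j by (simp add: bilin)
  have "B (\<Sum>i<m. B y (f i) *s e i + B y (e i) *s f i) (f j)
      = (\<Sum>i<m. B (f j) (B y (f i) *s e i + B y (e i) *s f i))"
    by (subst B_sym) (simp add: B_sum_right)
  also have "\<dots> = (\<Sum>i<m. if i = j then B y (f i) else 0)"
    by (rule sum.cong) (use h j fe in \<open>auto simp: bilin hyperbolic_def\<close>)
  finally show "B (perp_part m e f y) (f j) = 0" unfolding perp_part_def using j by (simp add: bilin)
qed

lemma B_perp_part: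
  assumes "\<And>i. i < m \<Longrightarrow> B x (e i) = 0" "\<And>i. i < m \<Longrightarrow> B x (f i) = 0"
  shows "B x (perp_part m e f y) = B x y"
  unfolding perp_part_def by (simp add: bilin B_sum_right assms)

text \<open>The new \<open>x\<close> is orthogonal to the pairs found so far; its partner is
  projected to their complement, which keeps the product with \<open>x\<close>. Nothing is asked of
  \<open>\<phi>\<close> here.\<close>

lemma hyperbolic_exists:
  assumes nondeg: "\<And>x. (\<And>y. B x y = 0) \<Longrightarrow> x = 0" and m: "2 * m \<le> CARD('k)"
  shows "\<exists>e f. hyperbolic m e f"
  using m
proof (induction m)
  case 0 then show ?case unfolding hyperbolic_def by simp
next
  case (Suc m)
  then obtain e f where h: "hyperbolic m e f" by auto
  obtain x where x: "x \<noteq> 0" "\<And>i. i < 2 * m \<Longrightarrow> B x (if i < m then e i else f (i - m)) = 0"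
    using common_perp[of "2 * m" "\<lambda>i. if i < m then e i else f (i - m)"] Suc.prems by auto
  have xe: "B x (e i) = 0" "B x (f i) = 0" if "i < m" for i
    using x(2)[of i] x(2)[of "i + m"] that by auto
  obtain y where "B x y \<noteq> 0" using nondeg x(1) by blast
  define y' where "y' = perp_part m e f ((1 / B x y) *s y)"
  have y': "B x y' = 1" unfolding y'_def using B_perp_part[of m x e f] xe \<open>B x y \<noteq> 0\<close> by (simp add: bilin)
  have pe: "B y' (e i) = 0" "B y' (f i) = 0" if "i < m" for i
    unfolding y'_def using perp_part[OF h that] by auto
  have sym: "B (e i) x = 0" "B (f i) x = 0" "B (e i) y' = 0" "B (f i) y' = 0" if "i < m" for i
    using xe pe that B_sym by metis+
  have old: "B (e i) (e j) = 0" "B (f i) (f j) = 0" "B (e i) (f j) = (if i = j then 1 else 0)"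
    if "i < m" "j < m" for i j
    using h that unfolding hyperbolic_def by auto
  have "hyperbolic (Suc m) (e(m := x)) (f(m := y'))"
    unfolding hyperbolic_def
  proof (intro allI impI)
    fix i j assume "i < Suc m" "j < Suc m"
    then have "i = m \<or> i < m" "j = m \<or> j < m" by auto
    then show "B ((e(m := x)) i) ((e(m := x)) j) = 0 \<and> B ((f(m := y')) i) ((f(m := y')) j) = 0 \<and>
        B ((e(m := x)) i) ((f(m := y')) j) = (if i = j then 1 else 0)"
      by (elim disjE) (simp_all add: old xe pe sym y')
  qed
  then show ?case by blast
qed

text \<open>The sequence e0, f0, e0 + e1, f1, e1 + e2, f2, ...: neighbours have product 1, all other
  pairs are orthogonal.\<close>

fun pth :: "(nat \<Rightarrow> 'a^'k) \<Rightarrow> (nat \<Rightarrow> 'a^'k) \<Rightarrow> nat \<Rightarrow> 'a^'k"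
  where "pth e f j = (if odd j then f (j div 2) else if j = 0 then e 0 else e (j div 2 - 1) + e (j div 2))"

lemma B_pth:
  assumes h: "hyperbolic m e f" and ij: "i < j" "j < 2 * m"
  shows "B (pth e f i) (pth e f j) = (if j = Suc i then 1 else 0)"
proof -
  have H: "B (e a) (e b) = 0" "B (f a) (f b) = 0" "B (e a) (f b) = (if a = b then 1 else 0)"
    "B (f b) (e a) = (if a = b then 1 else 0)" if "a < m" "b < m" for a b
    using h that B_sym[of "f b"] unfolding hyperbolic_def by auto
  have ev: "pth e f (2 * a) = (if a = 0 then e 0 else e (a - 1) + e a)" and od: "pth e f (2 * a + 1) = f a" for a
    by auto
  show ?thesis
  proof (cases "even i")
    case True
    then obtain a where a: "i = 2 * a" by (rule evenE)
    have am: "a < m" "a - 1 < m" using ij a by auto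
    show ?thesis
    proof (cases "even j")
      case True
      then obtain b where b: "j = 2 * b" by (rule evenE)
      have bm: "b < m" "b - 1 < m" using ij b by auto
      have "j \<noteq> Suc i" unfolding a b by presburger
      then show ?thesis unfolding a b ev using H(1) am bm by (simp add: bilin)
    next
      case False
      then obtain b where b: "j = 2 * b + 1" by (rule oddE)
      have bm: "b < m" using ij b by auto
      have "a \<le> b" using ij a b by simp
      then show ?thesis unfolding a b ev od using H(3)[OF am(1) bm] H(3)[OF am(2) bm] by (auto simp: bilin)
    qed
  next
    case False
    then obtain a where a: "i = 2 * a + 1" by (rule oddE)
    have am: "a < m" using ij a by auto
    show ?thesis
    proof (cases "even j")
      case True
      then obtain b where b: "j = 2 * b" by (rule evenE)
      have bm: "b < m" "b - 1 < m" using ij b by auto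
      have "a < b" using ij a b by simp
      then show ?thesis unfolding a b ev od using H(4)[OF bm(1) am] H(4)[OF bm(2) am] by (auto simp: bilin)
    next
      case False
      then obtain b where b: "j = 2 * b + 1" by (rule oddE)
      have "b < m" using ij b by auto
      moreover have "2 * b + 1 \<noteq> Suc (2 * a + 1)" by presburger
      ultimately show ?thesis unfolding a b od using H(2) am by simp
    qed
  qed
qed

text \<open>The sum of the \<open>f i\<close> has product 1 with every \<open>e i\<close>; this
  cancels in \<open>e (i - 1) + e i\<close> and survives only at \<open>e 0\<close>. So the sum can
  be placed in front of the path.\<close>

lemma B_pth_f:
  assumes h: "hyperbolic m e f" and j: "j < 2 * m"
  shows "B (\<Sum>i<m. f i) (pth e f j) = (if j = 0 then 1 else 0)"
proof -
  have e: "B (e a) (\<Sum>i<m. f i) = 1" "B (f a) (\<Sum>i<m. f i) = 0" if "a < m" for a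
  proof -
    have "B (e a) (\<Sum>i<m. f i) = (\<Sum>i<m. if i = a then 1 else 0)"
      using h that by (subst B_sum_right) (auto simp: hyperbolic_def intro!: sum.cong)
    then show "B (e a) (\<Sum>i<m. f i) = 1" using that by simp
    show "B (f a) (\<Sum>i<m. f i) = 0" using h that by (subst B_sum_right) (auto simp: hyperbolic_def)
  qed
  have "j div 2 < m" "j div 2 - 1 < m" using j by auto
  then show ?thesis using e B_sym[of "\<Sum>i<m. f i"] j by (auto simp: bilin)
qed

lemma phi_sum_f:
  assumes "hyperbolic m e f" "\<And>i. i < m \<Longrightarrow> \<phi> (f i) = 1" "k \<le> m"
  shows "\<phi> (\<Sum>i<k. f i) = of_nat k"
  using assms(3)
proof (induction k)
  case (Suc k)
  have "B (f k) (\<Sum>i<k. f i) = 0"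
    using assms(1) Suc.prems by (subst B_sum_right) (auto simp: hyperbolic_def)
  then show ?case using Suc assms(2) B_sym[of "f k"] by (simp add: phi_add add.commute)
qed simp

text \<open>
  Adding multiples of a unit vector orthogonal to a hyperbolic system changes the norms
  arbitrarily and the bilinear form not at all; these norms make all vectors of \<open>pth\<close> unit vectors.
\<close>
lemma hyperbolic_lift:
  assumes h: "hyperbolic m e f" and p: "\<phi> p = 1" "\<And>i. i < m \<Longrightarrow> B p (e i) = 0 \<and> B p (f i) = 0"
  shows "\<exists>e' f'. hyperbolic m e' f' \<and> (\<forall>i<m. B p (e' i) = 0 \<and> B p (f' i) = 0 \<and>
    \<phi> (f' i) = 1 \<and> \<phi> (e' i) = (if even i then 1 else 0))"
proof -
  let ?e = "\<lambda>i. e i + rt (\<phi> (e i) + (if even i then 1 else 0)) *s p"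
  let ?f = "\<lambda>i. f i + rt (\<phi> (f i) + 1) *s p"
  have p': "B (e i) p = 0" "B (f i) p = 0" if "i < m" for i using p(2)[OF that] B_sym by metis+
  have "hyperbolic m ?e ?f" using h p(2) p' unfolding hyperbolic_def by (auto simp: bilin)
  moreover have "\<forall>i<m. B p (?e i) = 0 \<and> B p (?f i) = 0 \<and> \<phi> (?f i) = 1 \<and> \<phi> (?e i) = (if even i then 1 else 0)"
    using p p' by (auto simp: bilin phi_add phi_scale)
  ultimately show ?thesis by blast
qed

text \<open>Neighbouring \<open>e i\<close> are orthogonal with norms 1 and 0 in some order, so
  their sum has norm 1. The even indices carry norm 1 because \<open>e 0\<close> occurs
  alone.\<close>

lemma phi_pth:
  assumes h: "hyperbolic m e f"
    and n: "\<And>i. i < m \<Longrightarrow> \<phi> (f i) = 1 \<and> \<phi> (e i) = (if even i then 1 else 0)" and j: "j < 2 * m"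
  shows "\<phi> (pth e f j) = 1"
proof -
  have d: "j div 2 < m" "j div 2 - 1 < m" using j by auto
  then have "B (e (j div 2 - 1)) (e (j div 2)) = 0" using h unfolding hyperbolic_def by blast
  then show ?thesis using n[OF d(1)] n[OF d(2)] by (auto simp: phi_add)
qed

section \<open>Polytopes from path bases\<close>

lemma path_polytope:
  fixes v :: "nat \<Rightarrow> 'a^'k"
  assumes n: "n = CARD('k)" "3 \<le> n"
    and unit: "\<And>i. 1 \<le> i \<Longrightarrow> i \<le> n \<Longrightarrow> \<phi> (v i) = 1"
    and far: "\<And>i j. 1 \<le> i \<Longrightarrow> i + 2 \<le> j \<Longrightarrow> j \<le> n \<Longrightarrow> B (v i) (v j) = 0"
    and a: "B (v 1) (v 2) \<noteq> 0" and b: "B (v 2) (v 3) = b" "full_rotation b" "anisotropic b" "b \<noteq> 0" "b \<noteq> 1"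
    and one: "\<And>i. 3 \<le> i \<Longrightarrow> i < n \<Longrightarrow> B (v i) (v (Suc i)) = 1"
    and ab: "n = 3 \<Longrightarrow> B (v 1) (v 2) \<noteq> b"
    and indep: "\<And>c. (\<Sum>i=1..n. c i *s v i) = 0 \<Longrightarrow> \<forall>i\<in>{1..n}. c i = 0"
    and nonsingular: "\<And>x. (\<And>y. B x y = 0) \<Longrightarrow> \<phi> x = 0 \<Longrightarrow> x = 0"
  shows "\<exists>(P :: nat set) leq. abstract_regular_polytope P leq n \<and> polytope_aut P leq \<cong> orthogonal_group \<phi>"
proof -
  obtain coord where coord:
    "\<And>x. x = (\<Sum>i=1..n. coord i x *s v i)"
    "\<And>i x y. i \<in> {1..n} \<Longrightarrow> coord i (x + y) = coord i x + coord i y"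
    "\<And>i c x. i \<in> {1..n} \<Longrightarrow> coord i (c *s x) = c * coord i x"
    "\<And>i j. i \<in> {1..n} \<Longrightarrow> j \<in> {1..n} \<Longrightarrow> coord i (v j) = (if i = j then 1 else 0)"
    using basis_coordinates[of v] indep unfolding n(1) by blast
  have adj: "B (v i) (v (Suc i)) \<noteq> 0" if i: "1 \<le> i" "i < n" for i
  proof -
    consider "i = 1" | "i = 2" | "3 \<le> i" using i by linarith
    then show ?thesis using a b(1,4) one[of i] i by cases (auto simp: numeral_eq_Suc)
  qed
  interpret quadratic_path ty \<phi> B v n coord
    by unfold_locales (use n unit far adj coord nonsingular in auto)
  interpret quadratic_string ty \<phi> B v n coord
  proof unfold_locales
    show "units (spn {2..d}) \<subseteq> roots (v ` {2..d})" if "2 \<le> d" "d < n" for d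
      by (rule units_spn) (use b one that in auto)
    show "units UNIV \<subseteq> roots (v ` {1..n})"
      by (rule units_UNIV) (use b one n ab in auto)
  qed (rule one)
  show ?thesis by (rule orthogonal_polytope)
qed

lemma B_perp_pth:
  assumes "\<And>i. i < m \<Longrightarrow> B x (e i) = 0 \<and> B x (f i) = 0" "j < 2 * m"
  shows "B x (pth e f j) = 0"
proof -
  have "j div 2 < m" "j div 2 - 1 < m" using assms(2) by auto
  then show ?thesis using assms(1) by (auto simp: bilin)
qed

lemma B_perp_sum:
  fixes m :: nat
  assumes "\<And>i. i < m \<Longrightarrow> B x (e i) = 0 \<and> B x (f i) = 0"
  shows "B x (\<Sum>i<m. f i) = 0"
  using assms by (simp add: B_sum_right)

lemma one_plus_square_neq_zero: "b \<noteq> (1::'a) \<Longrightarrow> 1 + b * b * of_nat k \<noteq> 0"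
  using of_nat_cases[of k] square_inj[of b 1] by (auto simp: add_eq_zero_iff)

lemma plane_polytope:
  assumes nondeg: "\<And>x. (\<And>y. B x y = 0) \<Longrightarrow> x = 0" and card: "CARD('k) = 2"
  shows "\<exists>(P :: nat set) leq. abstract_regular_polytope P leq 2 \<and> polytope_aut P leq \<cong> orthogonal_group \<phi>"
proof -
  have "(\<chi> i. 1) \<noteq> (0 :: 'a^'k)" by (simp add: vec_eq_iff)
  then obtain v1 v2 where v: "\<phi> v1 = 1" "\<phi> v2 = 1" "B v1 v2 \<noteq> 0" "full_rotation (B v1 v2)"
    using rotation_plane[OF nondeg] by blast
  define v where "v i = (if i = 1 then v1 else v2)" for i :: nat
  have vv: "v 1 = v1" "v 2 = v2" unfolding v_def by auto
  have two: "i = 1" if "1 \<le> i" "i < 2" for i :: nat using that by simp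
  have indep: "\<forall>i\<in>{1..2}. c i = 0" if "(\<Sum>i=1..2. c i *s v i) = 0" for c
  proof (rule even_path_independent[of 2 v c 1])
    show "B (v i) (v (Suc i)) \<noteq> 0" if "1 \<le> i" "i < 2" for i
      using two[OF that] v(3) unfolding v_def by simp
  qed (use that in auto)
  obtain coord where coord:
    "\<And>x. x = (\<Sum>i=1..2. coord i x *s v i)"
    "\<And>i x y. i \<in> {1..2} \<Longrightarrow> coord i (x + y) = coord i x + coord i y"
    "\<And>i c x. i \<in> {1..2} \<Longrightarrow> coord i (c *s x) = c * coord i x"
    "\<And>i j. i \<in> {1..2} \<Longrightarrow> j \<in> {1..2} \<Longrightarrow> coord i (v j) = (if i = j then 1 else 0)"
    using basis_coordinates[of v] indep unfolding card by blast
  interpret quadratic_path ty \<phi> B v 2 coord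
  proof unfold_locales
    fix i :: nat assume "1 \<le> i" "i \<le> 2"
    then show "\<phi> (v i) = 1" using v unfolding v_def by auto
  next
    fix i :: nat assume "1 \<le> i" "i < 2"
    then show "B (v i) (v (Suc i)) \<noteq> 0" using two v(3) unfolding v_def by auto
  qed (use coord nondeg in auto)
  interpret quadratic_string ty \<phi> B v 2 coord
  proof unfold_locales
    have U: "\<And>u. u \<in> v ` {1..2} \<Longrightarrow> \<phi> u = 1" using units_v[of "{1..2}"] by auto
    have vR: "v1 \<in> roots (v ` {1..2})" "v2 \<in> roots (v ` {1..2})"
      using roots_superset[OF U] vv by force+
    show "units UNIV \<subseteq> roots (v ` {1..2})"
    proof
      fix u assume "u \<in> units UNIV"
      then have u: "\<phi> u = 1" unfolding units_def by simp
      have "u = coord 1 u *s v1 + coord 2 u *s v2"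
        using coord(1)[of u] vv by (simp add: numeral_2_eq_2)
      then show "u \<in> roots (v ` {1..2})"
        by (rule units_plane[OF refl_closed_roots vR v(1,2,4) _ u])
    qed
  qed auto
  show ?thesis by (rule orthogonal_polytope)
qed

text \<open>From \<open>k = m - 1\<close> hyperbolic pairs come \<open>v 3, v 4, ...\<close> as a
  path. The vectors \<open>p\<close> and \<open>u\<close> are orthogonal to these pairs, and
  \<open>p\<close> also corrects their norms. The summand \<open>b *s F\<close> attaches
  \<open>v 2\<close> to the path with weight b, its \<open>p\<close> component makes it a unit
  vector, and \<open>v 1\<close> is taken in the plane of \<open>p\<close> and
  \<open>u\<close>.\<close>

lemma even_polytope:
  assumes nondeg: "\<And>x. (\<And>y. B x y = 0) \<Longrightarrow> x = 0" and card: "CARD('k) = 2 * m" and m: "1 \<le> m"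
  shows "\<exists>(P :: nat set) leq. abstract_regular_polytope P leq (2 * m) \<and> polytope_aut P leq \<cong> orthogonal_group \<phi>"
proof (cases "m = 1")
  case True
  then show ?thesis using plane_polytope[OF nondeg] card by simp
next
  case False
  define k where "k = m - 1"
  have k: "1 \<le> k" "m = Suc k" using m False unfolding k_def by auto
  obtain e0 f0 where h0: "hyperbolic m e0 f0" using hyperbolic_exists[OF nondeg, of m] card by auto
  have "B (e0 k) (f0 k) = 1" using h0 k unfolding hyperbolic_def by auto
  then have "\<phi> (e0 k + f0 k) = \<phi> (e0 k) + \<phi> (f0 k) + 1" by (simp add: phi_add)
  \<comment> \<open>In a hyperbolic pair with both vectors singular, their sum has norm 1.\<close>
  then have "\<phi> (e0 k) \<noteq> 0 \<or> \<phi> (f0 k) \<noteq> 0 \<or> \<phi> (e0 k + f0 k) \<noteq> 0" by auto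
  then obtain p0 where p0: "p0 \<in> {e0 k, f0 k, e0 k + f0 k}" "\<phi> p0 \<noteq> 0" by blast
  have old: "B (e0 k) (e0 i) = 0" "B (e0 k) (f0 i) = 0" "B (f0 k) (e0 i) = 0" "B (f0 k) (f0 i) = 0" if "i < k" for i
    using h0 that k B_sym[of "f0 k" "e0 i"] unfolding hyperbolic_def by auto
  define p where "p = (1 / rt (\<phi> p0)) *s p0"
  have p: "\<phi> p = 1" unfolding p_def by (rule scaled_unit[OF p0(2)])
  have p0e: "B p (e0 i) = 0 \<and> B p (f0 i) = 0" if "i < k" for i
    using p0(1) old[OF that] unfolding p_def by (auto simp: bilin)
  have "hyperbolic k e0 f0" using h0 k unfolding hyperbolic_def by auto
  then obtain e f where h: "hyperbolic k e f"
    and pe: "\<And>i. i < k \<Longrightarrow> B p (e i) = 0 \<and> B p (f i) = 0"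
    and norm: "\<And>i. i < k \<Longrightarrow> \<phi> (f i) = 1 \<and> \<phi> (e i) = (if even i then 1 else 0)"
    using hyperbolic_lift[of k e0 f0 p] p p0e by blast
  have "p \<noteq> 0" using p by auto
  then obtain y where y: "B p y \<noteq> 0" using nondeg by blast
  define u where "u = perp_part k e f ((1 / B p y) *s y)"
  have pu: "B p u = 1" unfolding u_def using B_perp_part[of k p e f] pe y by (simp add: bilin)
  have ue: "B u (e i) = 0 \<and> B u (f i) = 0" if "i < k" for i
    unfolding u_def using perp_part[OF h that] by blast
  \<comment> \<open>\<open>s\<close> is to make \<open>s *s p + u\<close> nonsingular; its norm is
    \<open>s * s + s + \<phi> u\<close>.\<close>
  have "card {t. t * t + 1 * t = \<phi> u} \<le> 3" using quadratic_fibre[of 1 "\<phi> u"] by simp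
  then obtain s where "s \<notin> {t. t * t + 1 * t = \<phi> u}" using avoid[of "{t. t * t + 1 * t = \<phi> u}"] by auto
  then have s: "s * s + s + \<phi> u \<noteq> 0" by (simp add: add_eq_zero_iff)
  define z where "z = 1 / (s * s + s + \<phi> u)"
  have z: "z \<noteq> 0" "z * (s * s + s + \<phi> u) = 1" unfolding z_def using s by auto
  obtain b :: 'a where b: "b \<noteq> 0" "b \<noteq> 1" "full_rotation b" "anisotropic b" using anisotropic_rotation by blast
  define F where "F = (\<Sum>i<k. f i)"
  \<comment> \<open>\<open>F\<close> has norm \<open>of_nat k\<close>, so this is the coefficient
    that gives \<open>v2\<close> norm 1; it is nonzero because b \<noteq> 1.\<close>
  define \<kappa> where "\<kappa> = rt (1 + b * b * of_nat k)"
  have \<kappa>: "\<kappa> \<noteq> 0" "\<kappa> * \<kappa> = 1 + b * b * of_nat k"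
    unfolding \<kappa>_def using one_plus_square_neq_zero[OF b(2)] by auto
  \<comment> \<open>The reflection of \<open>p\<close> in \<open>s *s p + u\<close>, a vector of
    norm \<open>1 / z\<close> whose product with \<open>p\<close> is 1. Hence \<open>v1\<close> is a
    unit vector with nonzero \<open>u\<close> component.\<close>
  define v1 where "v1 = (1 + s * z) *s p + z *s u"
  define v2 where "v2 = b *s F + \<kappa> *s p"
  define v where "v j = (if j = 1 then v1 else if j = 2 then v2 else pth e f (j - 3))" for j :: nat
  have vs: "v 1 = v1" "v 2 = v2" "\<And>j. 3 \<le> j \<Longrightarrow> v j = pth e f (j - 3)" unfolding v_def by auto
  have pF: "B p F = 0" "B F p = 0" "B u F = 0"
    using B_perp_sum[of k p e f] B_perp_sum[of k u e f] pe ue B_sym unfolding F_def by auto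
  have phi1: "\<phi> v1 = 1"
  proof -
    have "\<phi> v1 = 1 + z + z * (z * (s * s + s + \<phi> u))"
      unfolding v1_def using p pu B_sym[of u p] by (simp add: phi_add phi_scale bilin algebra_simps)
    then show ?thesis unfolding z(2) by (simp add: add.assoc)
  qed
  have phi2: "\<phi> v2 = 1"
  proof -
    have "\<phi> F = of_nat k" unfolding F_def using phi_sum_f[OF h] norm by auto
    then show ?thesis unfolding v2_def using p pF \<kappa>(2) by (simp add: phi_add phi_scale bilin)
  qed
  have v1pth: "B v1 (pth e f j) = 0" if "j < 2 * k" for j
    using B_perp_pth[of k p e f j] B_perp_pth[of k u e f j] pe ue that unfolding v1_def by (simp add: bilin)
  have v2pth: "B v2 (pth e f j) = (if j = 0 then b else 0)" if "j < 2 * k" for j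
    using B_perp_pth[of k p e f j] pe that B_pth_f[OF h that] unfolding v2_def F_def by (simp add: bilin)
  have v12: "B v1 v2 = z * \<kappa>" unfolding v1_def v2_def using pu pF B_sym[of u p] by (simp add: bilin mult.commute)
  have far: "B (v i) (v j) = 0" if ij: "1 \<le> i" "i + 2 \<le> j" "j \<le> 2 * m" for i j
  proof -
    have j: "v j = pth e f (j - 3)" "j - 3 < 2 * k" using vs(3)[of j] ij k by auto
    consider "i = 1" | "i = 2" | "3 \<le> i" using ij(1) by linarith
    then show ?thesis
    proof cases
      case 1 then show ?thesis using v1pth[OF j(2)] j(1) vs by simp
    next
      case 2 then show ?thesis using v2pth[OF j(2)] j(1) vs ij by simp
    next
      case 3 then show ?thesis using B_pth[OF h, of "i - 3" "j - 3"] j vs(3) ij by auto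
    qed
  qed
  have one: "B (v i) (v (Suc i)) = 1" if i: "3 \<le> i" "i < 2 * m" for i
  proof -
    have "B (pth e f (i - 3)) (pth e f (Suc i - 3)) = (if Suc i - 3 = Suc (i - 3) then 1 else 0)"
      by (rule B_pth[OF h]) (use i k in auto)
    then show ?thesis using vs(3)[of i] vs(3)[of "Suc i"] i by (simp add: Suc_diff_le)
  qed
  have v23: "B (v 2) (v 3) = b" using v2pth[of 0] vs(2) vs(3)[of 3] k by simp
  have v12': "B (v 1) (v 2) \<noteq> 0" using v12 vs z \<kappa> by simp
  have adj: "B (v i) (v (Suc i)) \<noteq> 0" if i: "1 \<le> i" "i < 2 * m" for i
  proof -
    consider "i = 1" | "i = 2" | "3 \<le> i" using i by linarith
    then show ?thesis using v12' v23 b(1) one[of i] i by cases (auto simp: numeral_eq_Suc)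
  qed
  show ?thesis
  proof (rule path_polytope[of "2 * m" v b])
    show "\<phi> (v i) = 1" if i: "1 \<le> i" "i \<le> 2 * m" for i
    proof -
      consider "i = 1" | "i = 2" | "3 \<le> i" using i by linarith
      then show ?thesis
      proof cases
        case 3
        then show ?thesis using phi_pth[OF h norm, of "i - 3"] vs(3) i k by auto
      qed (use phi1 phi2 vs in auto)
    qed
    show "\<forall>i\<in>{1..2 * m}. c i = 0" if "(\<Sum>i=1..2 * m. c i *s v i) = 0" for c
      by (rule even_path_independent[of "2 * m" v c m]) (use far adj that in auto)
    show "2 * m = CARD('k)" using card by simp
  qed (use far one v12' v23 b nondeg k in auto)
qed

text \<open>Multiples of \<open>r\<close> change norms but no products. \<open>v 3, v 4, ...\<close>
  are the vectors of \<open>pth\<close> after the first; the first one, scaled by b, becomes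
  \<open>v2\<close>, so that its weight with \<open>v 3\<close> is b. The front vector of
  \<open>B_pth_f\<close>, scaled by 1 / b, becomes \<open>v1\<close>, with weight 1 at
  \<open>v2\<close>.\<close>

lemma odd_polytope:
  assumes r: "\<phi> r = 1" "\<And>y. B r y = 0"
    and nonsingular: "\<And>x. (\<And>y. B x y = 0) \<Longrightarrow> \<phi> x = 0 \<Longrightarrow> x = 0"
    and h0: "hyperbolic m e0 f0" and card: "CARD('k) = 2 * m + 1" and m: "1 \<le> m"
  shows "\<exists>(P :: nat set) leq. abstract_regular_polytope P leq (2 * m + 1) \<and> polytope_aut P leq \<cong> orthogonal_group \<phi>"
proof -
  have r': "B y r = 0" for y using r(2) B_sym by metis
  obtain e f where h: "hyperbolic m e f"
    and norm: "\<And>i. i < m \<Longrightarrow> \<phi> (f i) = 1 \<and> \<phi> (e i) = (if even i then 1 else 0)"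
    using hyperbolic_lift[OF h0 r(1)] r(2) by blast
  obtain b :: 'a where b: "b \<noteq> 0" "b \<noteq> 1" "full_rotation b" "anisotropic b" using anisotropic_rotation by blast
  define F where "F = (\<Sum>i<m. f i)"
  define \<kappa> where "\<kappa> = rt (1 + (1 / b) * (1 / b) * of_nat m)"
  define v1 where "v1 = (1 / b) *s F + \<kappa> *s r"
  \<comment> \<open>The radical component restores norm 1, as b^2 + (1 + b)^2 = 1.\<close>
  define v2 where "v2 = b *s pth e f 0 + (1 + b) *s r"
  define v where "v j = (if j = 1 then v1 else if j = 2 then v2 else pth e f (j - 2))" for j :: nat
  have vs: "v 1 = v1" "v 2 = v2" "\<And>j. 3 \<le> j \<Longrightarrow> v j = pth e f (j - 2)" unfolding v_def by auto
  have phi1: "\<phi> v1 = 1"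
  proof -
    have "\<phi> F = of_nat m" unfolding F_def using phi_sum_f[OF h] norm by auto
    then show ?thesis unfolding v1_def \<kappa>_def using r r' by (simp add: phi_add phi_scale bilin)
  qed
  have pth1: "\<phi> (pth e f j) = 1" if "j < 2 * m" for j by (rule phi_pth[OF h norm that])
  have phi2: "\<phi> v2 = 1" unfolding v2_def using pth1[of 0] m r r'
    by (simp add: phi_add phi_scale bilin square_add del: pth.simps)
  have v1pth: "B v1 (pth e f j) = (if j = 0 then 1 / b else 0)" if "j < 2 * m" for j
    using B_pth_f[OF h that] r(2) unfolding v1_def F_def by (simp add: bilin del: pth.simps)
  have v2pth: "B v2 (pth e f j) = b * B (pth e f 0) (pth e f j)" for j
    unfolding v2_def using r(2) by (simp add: bilin del: pth.simps)
  have v12: "B v1 v2 = 1"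
    unfolding v2_def using v1pth[of 0] m b r' by (simp add: bilin del: pth.simps)
  have far: "B (v i) (v j) = 0" if ij: "1 \<le> i" "i + 2 \<le> j" "j \<le> 2 * m + 1" for i j
  proof -
    have j: "v j = pth e f (j - 2)" "j - 2 < 2 * m" "j - 2 \<noteq> 0" using vs(3)[of j] ij by auto
    consider "i = 1" | "i = 2" | "3 \<le> i" using ij(1) by linarith
    then show ?thesis
    proof cases
      case 1 then show ?thesis using v1pth[OF j(2)] j(1,3) vs by simp
    next
      case 2
      then have "B (pth e f 0) (pth e f (j - 2)) = 0" using B_pth[OF h _ j(2), of 0] j(3) ij by auto
      then show ?thesis using v2pth j(1) vs(2) 2 by (simp del: pth.simps)
    next
      case 3
      then have "B (pth e f (i - 2)) (pth e f (j - 2)) = 0" using B_pth[OF h _ j(2), of "i - 2"] ij by auto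
      then show ?thesis using vs(3)[OF 3] j(1) by (simp del: pth.simps)
    qed
  qed
  have one: "B (v i) (v (Suc i)) = 1" if i: "3 \<le> i" "i < 2 * m + 1" for i
  proof -
    have "B (pth e f (i - 2)) (pth e f (Suc i - 2)) = (if Suc i - 2 = Suc (i - 2) then 1 else 0)"
      by (rule B_pth[OF h]) (use i in auto)
    then show ?thesis using vs(3)[of i] vs(3)[of "Suc i"] i by (simp add: Suc_diff_le del: pth.simps)
  qed
  have "B (pth e f 0) (pth e f 1) = 1" using B_pth[OF h, of 0 1] m by (simp del: pth.simps)
  then have v23: "B (v 2) (v 3) = b" using v2pth[of 1] vs(2) vs(3)[of 3] by (simp del: pth.simps)
  have unit: "\<phi> (v i) = 1" if i: "1 \<le> i" "i \<le> 2 * m + 1" for i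
  proof -
    consider "i = 1" | "i = 2" | "3 \<le> i" using i by linarith
    then show ?thesis
    proof cases
      case 3
      then show ?thesis using pth1[of "i - 2"] vs(3) i by (auto simp del: pth.simps)
    qed (use phi1 phi2 vs in auto)
  qed
  have v12': "B (v 1) (v 2) = 1" using v12 vs by simp
  show ?thesis
  proof (rule path_polytope[of "2 * m + 1" v b])
    show "\<forall>i\<in>{1..2 * m + 1}. c i = 0" if "(\<Sum>i=1..2 * m + 1. c i *s v i) = 0" for c
      by (rule odd_path_independent[of "2 * m + 1" v b c m]) (use far unit v12' v23 b one that m in auto)
    show "2 * m + 1 = CARD('k)" using card by simp
  qed (use far unit one v12' v23 b nonsingular m in auto)
qed

end

section \<open>The symplectic group as an orthogonal group\<close>

context char2_field
begin

lemma rt_add: "rt (x + y) = rt x + rt y"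
  by (rule rt_unique) (simp add: square_add)

lemma rt_scale: "rt (c * c * x) = c * rt x"
proof (rule rt_unique)
  have "c * rt x * (c * rt x) = c * c * (rt x * rt x)" by (simp only: mult_ac)
  then show "c * rt x * (c * rt x) = c * c * x" by simp
qed

text \<open>
  Any alternating form in characteristic 2 is the polar form of a quadratic form: sum the terms
  above the diagonal with respect to some ordering of the coordinates.
\<close>
lemma polarize:
  fixes B :: "'a^'n \<Rightarrow> 'a^'n \<Rightarrow> 'a"
  assumes add: "\<And>x y z. B (x + y) z = B x z + B y z" and scale: "\<And>c x y. B (c *s x) y = c * B x y"
    and addr: "\<And>x y z. B z (x + y) = B z x + B z y" and scaler: "\<And>c x y. B x (c *s y) = c * B x y"
    and alt: "\<And>x. B x x = 0"
  obtains Q where "quadratic_space Q B"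
proof -
  obtain idx :: "'n \<Rightarrow> nat" where idx: "inj idx"
    using finite_imp_inj_to_nat_seg[of "UNIV :: 'n set"] by auto
  let ?e = "\<lambda>i. axis i (1::'a)"
  have sum_l: "finite S \<Longrightarrow> B (\<Sum>i\<in>S. x $ i *s ?e i) y = (\<Sum>i\<in>S. x $ i * B (?e i) y)" for S x y
    by (induction S rule: finite_induct) (use scale[of 0 0 y] in \<open>simp_all add: add scale\<close>)
  have sum_r: "finite S \<Longrightarrow> B y (\<Sum>i\<in>S. x $ i *s ?e i) = (\<Sum>i\<in>S. x $ i * B y (?e i))" for S x y
    by (induction S rule: finite_induct) (use scaler[of y 0 0] in \<open>simp_all add: addr scaler\<close>)
  have expand: "B x y = (\<Sum>i\<in>UNIV. \<Sum>j\<in>UNIV. x $ i * y $ j * B (?e i) (?e j))" for x y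
  proof -
    have "B x y = (\<Sum>i\<in>UNIV. x $ i * B (?e i) y)"
      using sum_l[of UNIV x y] by (simp add: basis_expansion)
    also have "\<dots> = (\<Sum>i\<in>UNIV. x $ i * (\<Sum>j\<in>UNIV. y $ j * B (?e i) (?e j)))"
      using sum_r[of UNIV _ y] by (simp add: basis_expansion)
    finally show ?thesis by (simp add: sum_distrib_left mult.assoc)
  qed
  have sym: "B x y = B y x" for x y
  proof -
    have "B (x + y) (x + y) = B x x + B y y + (B x y + B y x)" by (simp only: add addr add_ac)
    then show ?thesis using alt by (simp add: add_eq_zero_iff)
  qed
  define A where "A x y = (\<Sum>i\<in>UNIV. \<Sum>j\<in>UNIV. if idx i < idx j then x $ i * y $ j * B (?e i) (?e j) else 0)" for x y
  have A_add: "A (x + y) z = A x z + A y z" "A z (x + y) = A z x + A z y" for x y z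
    unfolding A_def sum.distrib[symmetric] by (intro sum.cong refl; simp add: algebra_simps)+
  have A_scale: "A (c *s x) (c *s x) = c * c * A x x" for c x
    unfolding A_def sum_distrib_left by (intro sum.cong refl) simp
  have A_B: "A x y + A y x = B x y" for x y
  proof -
    have "A y x = (\<Sum>i\<in>UNIV. \<Sum>j\<in>UNIV. if idx j < idx i then x $ i * y $ j * B (?e i) (?e j) else 0)"
      unfolding A_def by (subst sum.swap) (intro sum.cong refl; simp add: sym mult_ac)
    then have "A x y + A y x = (\<Sum>i\<in>UNIV. \<Sum>j\<in>UNIV.
        (if idx i < idx j then x $ i * y $ j * B (?e i) (?e j) else 0) +
        (if idx j < idx i then x $ i * y $ j * B (?e i) (?e j) else 0))"
      unfolding A_def by (simp add: sum.distrib)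
    also have "\<dots> = (\<Sum>i\<in>UNIV. \<Sum>j\<in>UNIV. x $ i * y $ j * B (?e i) (?e j))"
    proof (intro sum.cong refl)
      fix i j
      have "idx i < idx j \<or> idx j < idx i \<or> i = j" using idx by (metis injD linorder_neqE_nat)
      then show "(if idx i < idx j then x $ i * y $ j * B (?e i) (?e j) else 0) +
        (if idx j < idx i then x $ i * y $ j * B (?e i) (?e j) else 0) = x $ i * y $ j * B (?e i) (?e j)"
        using alt by auto
    qed
    finally show ?thesis unfolding expand[symmetric] .
  qed
  have "quadratic_space (\<lambda>x. A x x) B"
  proof unfold_locales
    fix x y
    have "A (x + y) (x + y) = A x x + A y y + (A x y + A y x)" by (simp only: A_add add_ac)
    then show "A (x + y) (x + y) = A x x + A y y + B x y" unfolding A_B .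
  qed (rule A_scale add scale)+
  then show thesis by (rule that)
qed

end

context quadratic_space
begin

definition drop_radical :: "'a^('k option) \<Rightarrow> 'a^'k"
  where "drop_radical x = (\<chi> j. x $ Some j)"

definition embed :: "'a^'k \<Rightarrow> 'a \<Rightarrow> 'a^('k option)"
  where "embed v c = (\<chi> i. case i of None \<Rightarrow> c | Some j \<Rightarrow> v $ j)"

text \<open>The orthogonal sum with a line carrying the form t^2. The line lies in the radical of
  \<open>B_ext\<close>, yet \<open>phi_ext\<close> has no zero on it except 0.\<close>

definition phi_ext :: "'a^('k option) \<Rightarrow> 'a"
  where "phi_ext x = \<phi> (drop_radical x) + x $ None * x $ None"

definition B_ext :: "'a^('k option) \<Rightarrow> 'a^('k option) \<Rightarrow> 'a"
  where "B_ext x y = B (drop_radical x) (drop_radical y)"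

lemma drop_simps [simp]:
  "drop_radical (x + y) = drop_radical x + drop_radical y"
  "drop_radical (c *s x) = c *s drop_radical x"
  "drop_radical (embed v c) = v" "embed v c $ None = c" "drop_radical 0 = 0"
  unfolding drop_radical_def embed_def by (simp_all add: vec_eq_iff)

lemma embed_eq: "x = embed (drop_radical x) (x $ None)"
  unfolding drop_radical_def embed_def by (simp add: vec_eq_iff split: option.split)

lemma ext_eqI: "drop_radical x = drop_radical y \<Longrightarrow> x $ None = y $ None \<Longrightarrow> x = y"
  by (metis embed_eq)

lemma quadratic_ext: "quadratic_space phi_ext B_ext"
  by unfold_locales (simp_all add: phi_ext_def B_ext_def phi_add phi_scale bilin algebra_simps)

definition symplectic_isometries :: "('a^'k \<Rightarrow> 'a^'k) set"
  where "symplectic_isometries = {g. bij g \<and> (\<forall>x y. g (x + y) = g x + g y) \<and> (\<forall>c x. g (c *s x) = c *s g x) \<and>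
    (\<forall>x y. B (g x) (g y) = B x y)}"

lemma carrier_symplectic: "carrier (symplectic_group B) = symplectic_isometries"
  unfolding symplectic_group_def symplectic_isometries_def by (auto simp: Bij_UNIV linear_vec_iff)

lemma mult_symplectic:
  "g \<in> symplectic_isometries \<Longrightarrow> h \<in> symplectic_isometries \<Longrightarrow> g \<otimes>\<^bsub>symplectic_group B\<^esub> h = g \<circ> h"
  unfolding symplectic_group_def BijGroup_def symplectic_isometries_def
  by (simp add: Bij_UNIV compose_def comp_def restrict_UNIV)

text \<open>An isometry preserves the radical and induces a symplectic map on the quotient. The
  induced map determines it, since \<open>phi_ext\<close> gives the square of the radical coordinate
  and square roots are unique. Conversely, a symplectic \<open>s\<close> changes
  \<open>\<phi>\<close> by the square of a linear function, which the radical coordinate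
  absorbs.\<close>

lemma orthogonal_ext_iso_symplectic:
  assumes nondeg: "\<And>x. (\<And>y. B x y = 0) \<Longrightarrow> x = 0"
  shows "orthogonal_group phi_ext \<cong> symplectic_group B"
proof -
  interpret E: quadratic_space ty phi_ext B_ext by (rule quadratic_ext)
  define \<Theta> where "\<Theta> g v = drop_radical (g (embed v 0))" for g :: "'a^('k option) \<Rightarrow> 'a^('k option)" and v
  have drop: "drop_radical (g x) = \<Theta> g (drop_radical x)" if g: "g \<in> E.isometries" for g x
  proof -
    have "B (drop_radical (g (embed 0 1))) y = 0" for y
    proof -
      obtain w where "embed y 0 = g w" using E.isometriesD(4)[OF g] by (metis bij_pointE)
      then have "B (drop_radical (g (embed 0 1))) y = B_ext (g (embed 0 1)) (g w)"
        unfolding B_ext_def by (metis drop_simps(3))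
      then show ?thesis using E.isometries_B[OF g] by (simp add: B_ext_def)
    qed
    then have r: "drop_radical (g (embed 0 1)) = 0" using nondeg by blast
    have "x = embed (drop_radical x) 0 + (x $ None) *s embed 0 1"
      by (rule ext_eqI) simp_all
    then have "g x = g (embed (drop_radical x) 0) + (x $ None) *s g (embed 0 1)"
      using E.isometriesD(1,2)[OF g] by metis
    then show ?thesis unfolding \<Theta>_def by (simp add: r)
  qed
  have emb_lin: "embed (x + y) 0 = embed x 0 + embed y 0" "embed (c *s x) 0 = c *s embed x 0" for x y c
    by (rule ext_eqI; simp)+
  have bijI: "bij g" if lin: "\<And>x y. g (x + y) = g x + g y" and B: "\<And>x y. B (g x) (g y) = B x y" for g
  proof -
    have "inj g"
    proof (rule injI)
      fix x y assume "g x = g y"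
      then have "B (x + y) z = 0" for z using B[of "x + y" z] lin by simp
      then show "x = y" using nondeg vec_add_eq_zero_iff by blast
    qed
    then show ?thesis using finite_UNIV_inj_surj[OF finite] by (simp add: bij_def)
  qed
  have in_sp: "\<Theta> g \<in> symplectic_isometries" if g: "g \<in> E.isometries" for g
  proof -
    have lin: "\<Theta> g (x + y) = \<Theta> g x + \<Theta> g y" for x y
      unfolding \<Theta>_def emb_lin using E.isometriesD[OF g] by simp
    have scale: "\<Theta> g (c *s x) = c *s \<Theta> g x" for c x
      unfolding \<Theta>_def emb_lin using E.isometriesD[OF g] by simp
    have "B (\<Theta> g x) (\<Theta> g y) = B x y" for x y
      using E.isometries_B[OF g, of "embed x 0" "embed y 0"] unfolding \<Theta>_def B_ext_def by simp
    then show ?thesis using lin scale bijI unfolding symplectic_isometries_def by blast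
  qed
  have "\<Theta> \<in> iso (orthogonal_group phi_ext) (symplectic_group B)"
  proof (rule isoI)
    show "\<Theta> \<in> hom (orthogonal_group phi_ext) (symplectic_group B)"
    proof (rule homI)
      fix g h assume "g \<in> carrier (orthogonal_group phi_ext)" "h \<in> carrier (orthogonal_group phi_ext)"
      then have gh: "g \<in> E.isometries" "h \<in> E.isometries" by (simp_all only: E.carrier_OG)
      have "\<Theta> (g \<circ> h) = \<Theta> g \<circ> \<Theta> h"
      proof
        fix v show "\<Theta> (g \<circ> h) v = (\<Theta> g \<circ> \<Theta> h) v"
          using drop[OF gh(1), of "h (embed v 0)"] unfolding \<Theta>_def comp_def by simp
      qed
      then show "\<Theta> (g \<otimes>\<^bsub>orthogonal_group phi_ext\<^esub> h) = \<Theta> g \<otimes>\<^bsub>symplectic_group B\<^esub> \<Theta> h"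
        by (simp only: E.mult_OG[OF gh] mult_symplectic[OF in_sp[OF gh(1)] in_sp[OF gh(2)]])
    qed (simp add: E.carrier_OG carrier_symplectic in_sp)
    show "bij_betw \<Theta> (carrier (orthogonal_group phi_ext)) (carrier (symplectic_group B))"
      unfolding E.carrier_OG carrier_symplectic bij_betw_def
    proof
      show "inj_on \<Theta> E.isometries"
      proof (rule inj_onI)
        fix g h assume g: "g \<in> E.isometries" and h: "h \<in> E.isometries" and eq: "\<Theta> g = \<Theta> h"
        show "g = h"
        proof
          fix x
          have d: "drop_radical (g x) = drop_radical (h x)" using drop[OF g] drop[OF h] eq by simp
          have "phi_ext (g x) = phi_ext (h x)" using E.isometriesD(3) g h by simp
          then have "g x $ None * g x $ None = h x $ None * h x $ None" unfolding phi_ext_def d by simp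
          then show "g x = h x" using d ext_eqI square_inj by blast
        qed
      qed
      have "\<exists>g\<in>E.isometries. \<Theta> g = s" if s: "s \<in> symplectic_isometries" for s
      proof -
        have sD: "bij s" "s (x + y) = s x + s y" "s (c *s x) = c *s s x" "B (s x) (s y) = B x y" for x y c
          using s unfolding symplectic_isometries_def by auto
        \<comment> \<open>\<open>\<phi>\<close> and \<open>\<phi> \<circ> s\<close> have the same
          polar form, so their sum is additive and scales by squares; its square root is
          linear.\<close>
        define D where "D x = rt (\<phi> x + \<phi> (s x))" for x
        have D_add: "D (x + y) = D x + D y" for x y
        proof -
          have "\<phi> (x + y) + \<phi> (s (x + y)) = (\<phi> x + \<phi> (s x)) + (\<phi> y + \<phi> (s y))"
            by (simp add: sD phi_add algebra_simps)
          then show ?thesis unfolding D_def by (simp only: rt_add)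
        qed
        have D_scale: "D (c *s x) = c * D x" for c x
        proof -
          have "\<phi> (c *s x) + \<phi> (s (c *s x)) = c * c * (\<phi> x + \<phi> (s x))"
            by (simp add: sD phi_scale algebra_simps)
          then show ?thesis unfolding D_def by (simp only: rt_scale)
        qed
        define g where "g x = embed (s (drop_radical x)) (x $ None + D (drop_radical x))" for x
        have g_simps: "drop_radical (g x) = s (drop_radical x)" "g x $ None = x $ None + D (drop_radical x)" for x
          unfolding g_def by simp_all
        have "inj g"
        proof (rule injI)
          fix x y assume xy: "g x = g y"
          then have d: "drop_radical x = drop_radical y"
            using g_simps(1) sD(1) by (metis bij_pointE)
          moreover have "x $ None = y $ None" using g_simps(2)[of x] g_simps(2)[of y] xy d by simp
          ultimately show "x = y" by (rule ext_eqI)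
        qed
        then have "bij g" using finite_UNIV_inj_surj[OF finite] by (simp add: bij_def)
        moreover have "g (x + y) = g x + g y" for x y
          by (rule ext_eqI) (simp_all add: g_simps sD D_add add_ac)
        moreover have "g (c *s x) = c *s g x" for c x
          by (rule ext_eqI) (simp_all add: g_simps sD D_scale distrib_left)
        moreover have "phi_ext (g x) = phi_ext x" for x
        proof -
          have "D (drop_radical x) * D (drop_radical x) = \<phi> (drop_radical x) + \<phi> (s (drop_radical x))"
            unfolding D_def by simp
          then show ?thesis unfolding phi_ext_def g_simps square_add by (simp add: add_ac)
        qed
        ultimately have "g \<in> E.isometries" unfolding E.isometries_def by blast
        moreover have "\<Theta> g = s" unfolding \<Theta>_def by (rule ext) (simp add: g_simps)
        ultimately show ?thesis by blast
      qed
      then show "\<Theta> ` E.isometries = symplectic_isometries" using in_sp by blast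
    qed
  qed
  then show ?thesis unfolding is_iso_def by blast
qed

end

text \<open>Translation by 1 permutes the field, so the sum of all elements is unchanged by adding
  CARD('a) copies of 1; hence 2^k = 0 in the field.\<close>

lemma char2_field_of_card:
  assumes "CARD('a::{field,finite}) = 2 ^ k" "2 \<le> k"
  shows "char2_field TYPE('a)"
proof
  have "(\<Sum>x\<in>UNIV. x + 1) = (\<Sum>x\<in>UNIV. x :: 'a)"
  proof (rule sum.reindex_bij_betw)
    show "bij_betw (\<lambda>x::'a. x + 1) UNIV UNIV"
      by (rule bij_betw_byWitness[where f' = "\<lambda>x. x - 1"]) auto
  qed
  then have "of_nat CARD('a) = (0::'a)" by (simp add: sum.distrib)
  then have "(2::'a) ^ k = 0" by (simp add: assms(1))
  then show "(1::'a) + 1 = 0" by simp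
  have "(2::nat) ^ 2 \<le> 2 ^ k" by (rule power_increasing) (use assms in auto)
  then show "4 \<le> CARD('a)" using assms(1) by simp
qed

theorem corollary1p5:
  fixes k m :: nat and \<epsilon> :: form_sign
  assumes "k \<ge> 2" and "m \<ge> 1"
    and "CARD('a::{field,finite}) = 2 ^ k"
    and "CARD('n::finite) = 2 * m"
  shows "(\<forall>\<phi> :: 'a ^ 'n \<Rightarrow> 'a. quadratic_form_of_type \<epsilon> m \<phi> \<longrightarrow>
            (\<exists>(P :: nat set) leq. abstract_regular_polytope P leq (2 * m) \<and>
               polytope_aut P leq \<cong> orthogonal_group \<phi>)) \<and>
         (\<forall>B :: 'a ^ 'n \<Rightarrow> 'a ^ 'n \<Rightarrow> 'a. symplectic_form B \<longrightarrow>
            (\<exists>(Q :: nat set) leq. abstract_regular_polytope Q leq (2 * m + 1) \<and>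
               polytope_aut Q leq \<cong> symplectic_group B))"
proof (intro conjI allI impI)
  interpret char2_field "TYPE('a)" by (rule char2_field_of_card[OF assms(3,1)])
  have bilinD: "B (x + y) z = B x z + B y z" "B (c *s x) z = c * B x z"
      "B z (x + y) = B z x + B z y" "B z (c *s x) = c * B z x"
    if "bilinear_form B" for B :: "'a ^ 'n \<Rightarrow> 'a ^ 'n \<Rightarrow> 'a" and x y z c
    using that unfolding bilinear_form_def Vector_Spaces.linear_iff by auto
  {
    fix \<phi> :: "'a ^ 'n \<Rightarrow> 'a" assume "quadratic_form_of_type \<epsilon> m \<phi>"
    then have q: "\<And>c v. \<phi> (c *s v) = c ^ 2 * \<phi> v" "bilinear_form (polar \<phi>)" "nondegenerate (polar \<phi>)"
      unfolding quadratic_form_of_type_def quadratic_form_def by auto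
    interpret quadratic_space "TYPE('a)" \<phi> "polar \<phi>"
      by unfold_locales (use q(1) bilinD(1,2)[OF q(2)] in \<open>auto simp: polar_def power2_eq_square add_ac\<close>)
    show "\<exists>(P :: nat set) leq. abstract_regular_polytope P leq (2 * m) \<and> polytope_aut P leq \<cong> orthogonal_group \<phi>"
      by (rule even_polytope) (use q(3) assms in \<open>auto simp: nondegenerate_def\<close>)
  next
    fix B :: "'a ^ 'n \<Rightarrow> 'a ^ 'n \<Rightarrow> 'a" assume "symplectic_form B"
    then have s: "bilinear_form B" "\<And>v. B v v = 0" "\<And>u. (\<And>v. B u v = 0) \<Longrightarrow> u = 0"
      unfolding symplectic_form_def alternating_def nondegenerate_def by auto
    \<comment> \<open>Any quadratic form with polar form \<open>B\<close> serves, since the radical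
      coordinate absorbs its variation under symplectic maps.\<close>
    obtain Q where "quadratic_space Q B" using polarize[of B] bilinD[OF s(1)] s(2) by metis
    then interpret quadratic_space "TYPE('a)" Q B .
    interpret E: quadratic_space "TYPE('a)" phi_ext B_ext by (rule quadratic_ext)
    obtain e f where ef: "hyperbolic m e f" using hyperbolic_exists[OF s(3), of m] assms(4) by auto
    have "\<exists>(P :: nat set) leq. abstract_regular_polytope P leq (2 * m + 1) \<and>
        polytope_aut P leq \<cong> orthogonal_group phi_ext"
    proof (rule E.odd_polytope)
      show "phi_ext (embed 0 1) = 1" "B_ext (embed 0 1) y = 0" for y
        unfolding phi_ext_def B_ext_def by simp_all
      show "E.hyperbolic m (\<lambda>i. embed (e i) 0) (\<lambda>i. embed (f i) 0)"
        using ef unfolding hyperbolic_def E.hyperbolic_def B_ext_def by simp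
      fix x assume x: "\<And>y. B_ext x y = 0" "phi_ext x = 0"
      have "drop_radical x = 0"
      proof (rule s(3))
        show "B (drop_radical x) v = 0" for v using x(1)[of "embed v 0"] unfolding B_ext_def by simp
      qed
      then show "x = 0" using x(2) unfolding phi_ext_def by (intro ext_eqI) simp_all
    next
      show "CARD('n option) = 2 * m + 1"
        using assms(4) by (simp add: UNIV_option_conv card_image)
    qed (rule assms(2))
    then show "\<exists>(Q :: nat set) leq. abstract_regular_polytope Q leq (2 * m + 1) \<and>
        polytope_aut Q leq \<cong> symplectic_group B"
      using iso_trans[OF _ orthogonal_ext_iso_symplectic[OF s(3)]] by blast
  }
qed

end
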